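(* There is a unique continuous linear map $u\mapsto\tilde u$ from $L^2(\mathcal{M},\tau)$ into $L^2(\mathcal{M},\tau)$ that coincides on $\mathcal{A}=H^\infty+(H^\infty)^*$ with the conjugation $u\mapsto\tilde u$. This map is of norm $1$, and if $u\in L^2(\mathcal{M},\tau)$ then $u+i\tilde u\in H^2$.
   Context: Setting. $\mathcal{M}$ is a von Neumann algebra on a Hilbert space with unit $I$ and a faithful normal finite trace $\tau$, normalized by $\tau(I)=1$. $L^p(\mathcal{M},\tau)$, $0<p<\infty$, is the usual non-commutative $L^p$-space of $\tau$-measurable operators, with $\|x\|_p=\tau(|x|^p)^{1/p}$. Subdiagonal algebras. $H^\infty$ is a weak$^*$-closed unital subalgebra of $\mathcal{M}$, $(H^\infty)^*=\{x^*: x\in H^\infty\}$, $D=H^\infty\cap(H^\infty)^*$, and $\Phi$ is a faithful normal (conditional) expectation from $\mathcal{M}$ onto $D$. It is assumed that $H^\infty$ is a finite, maximal, subdiagonal algebra with respect to $\Phi$ and $\tau$, i.e.: (1) $H^\infty+(H^\infty)^*$ is weak$^*$-dense in $\mathcal{M}$; (2) $\Phi(ab)=\Phi(a)\Phi(b)$ for all $a,b\in H^\infty$; (3) $H^\infty$ is maximal among the subalgebras satisfying (1) and (2); (4) $\tau\circ\Phi=\tau$. Put $H^\infty_0=\{x\in H^\infty:\Phi(x)=0\}$, and let $H^2$ be the closure of $H^\infty$ in $L^2(\mathcal{M},\tau)$. Conjugation on $\mathcal{A}$. Every $u\in\mathcal{A}=H^\infty+(H^\infty)^*$ has a unique decomposition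 $u=u_1+u_2^*+d$ with $u_1,u_2\in H^\infty_0$, $d\in D$; its conjugate is $\tilde u=i u_2^*-i u_1\in\mathcal{M}$.
   Formalization: "This map is of norm 1" is proved as: the norm is at most 1 always, and equals 1 whenever $H^\infty_0\neq\{0\}$; if $H^\infty_0=\{0\}$ (e.g. $\mathcal{M}=H^\infty=D=\mathbb{C}$) the conjugation is $0$, so its norm is $0$. *)

theory Defs
  imports "HOL-Analysis.Analysis"
begin

section \<open>Complex Hilbert spaces\<close>

text \<open>The inner product is linear in its first argument.\<close>

class complex_hilbert_space = banach +
  fixes scaleC :: "complex \<Rightarrow> 'a \<Rightarrow> 'a"  (infixr \<open>*\<^sub>C\<close> 75)
    and cinner :: "'a \<Rightarrow> 'a \<Rightarrow> complex"
  assumes scaleC_add_right: "c *\<^sub>C (x + y) = c *\<^sub>C x + c *\<^sub>C y"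
    and scaleC_add_left: "(c + d) *\<^sub>C x = c *\<^sub>C x + d *\<^sub>C x"
    and scaleC_scaleC: "c *\<^sub>C d *\<^sub>C x = (c * d) *\<^sub>C x"
    and scaleC_of_real: "complex_of_real r *\<^sub>C x = r *\<^sub>R x"
    and cinner_commute: "cinner x y = cnj (cinner y x)"
    and cinner_add_left: "cinner (x + y) z = cinner x z + cinner y z"
    and cinner_scaleC_left: "cinner (c *\<^sub>C x) y = c * cinner x y"
    and norm_eq_sqrt_cinner: "norm x = sqrt (Re (cinner x x))"

instantiation complex :: complex_hilbert_space
begin

definition "scaleC_complex (c::complex) (x::complex) = c * x"
definition "cinner_complex (x::complex) (y::complex) = x * cnj y"

instance
  by standard
    (auto simp: scaleC_complex_def cinner_complex_def algebra_simps scaleR_conv_of_real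
       cmod_def power2_eq_square)

end


section \<open>Bounded operators\<close>

text \<open>The type of bounded operators in the library is that of real-linear ones; complex
  linearity is a separate predicate, which every element of a von Neumann algebra satisfies.\<close>

definition clinear_op :: "('h::complex_hilbert_space \<Rightarrow>\<^sub>L 'h) \<Rightarrow> bool" where
  "clinear_op x \<longleftrightarrow> (\<forall>c v. blinfun_apply x (c *\<^sub>C v) = c *\<^sub>C blinfun_apply x v)"

definition scale_op ::
  "complex \<Rightarrow> ('h::complex_hilbert_space \<Rightarrow>\<^sub>L 'h) \<Rightarrow> ('h \<Rightarrow>\<^sub>L 'h)"  (infixr \<open>*\<^sub>O\<close> 75) where
  "c *\<^sub>O x = Blinfun (\<lambda>v. c *\<^sub>C blinfun_apply x v)"

definition adj :: "('h::complex_hilbert_space \<Rightarrow>\<^sub>L 'h) \<Rightarrow> ('h \<Rightarrow>\<^sub>L 'h)" where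
  "adj x = (THE y. \<forall>u v. cinner (blinfun_apply x u) v = cinner u (blinfun_apply y v))"

definition positive_op :: "('h::complex_hilbert_space \<Rightarrow>\<^sub>L 'h) \<Rightarrow> bool" where
  "positive_op x \<longleftrightarrow> (\<forall>v. cinner (blinfun_apply x v) v \<in> \<real>\<^sub>\<ge>\<^sub>0)"

definition projection_op :: "('h::complex_hilbert_space \<Rightarrow>\<^sub>L 'h) \<Rightarrow> bool" where
  "projection_op e \<longleftrightarrow> e o\<^sub>L e = e \<and> adj e = e"


section \<open>Von Neumann algebras and the weak* topology\<close>

definition commutant :: "('h::complex_hilbert_space \<Rightarrow>\<^sub>L 'h) set \<Rightarrow> ('h \<Rightarrow>\<^sub>L 'h) set" where
  "commutant S = {y. clinear_op y \<and> (\<forall>x\<in>S. x o\<^sub>L y = y o\<^sub>L x)}"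

definition von_neumann_algebra :: "('h::complex_hilbert_space \<Rightarrow>\<^sub>L 'h) set \<Rightarrow> bool" where
  "von_neumann_algebra M \<longleftrightarrow> (\<forall>x\<in>M. adj x \<in> M) \<and> commutant (commutant M) = M"

text \<open>The weak* (ultraweak) topology: the coarsest one for which the functionals
  \<open>x \<mapsto> (\<Sum>n. \<langle>x \<xi>\<^sub>n, \<eta>\<^sub>n\<rangle>)\<close> with square-summable \<open>\<xi>\<close> and \<open>\<eta>\<close> are continuous.  These functionals
  form the predual of the algebra of all bounded operators, and their restrictions to a von
  Neumann algebra form the predual of that algebra.\<close>

definition ultraweak_topology :: "('h::complex_hilbert_space \<Rightarrow>\<^sub>L 'h) topology" where
  "ultraweak_topology = topology_generated_by
     {{x. (\<Sum>n. cinner (blinfun_apply x (\<xi> n)) (\<eta> n)) \<in> U} | (\<xi> :: nat \<Rightarrow> 'h) \<eta> U.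
        summable (\<lambda>n. (norm (\<xi> n))\<^sup>2) \<and> summable (\<lambda>n. (norm (\<eta> n))\<^sup>2) \<and> open U}"

abbreviation weak_star ::
  "('h::complex_hilbert_space \<Rightarrow>\<^sub>L 'h) set \<Rightarrow> ('h \<Rightarrow>\<^sub>L 'h) topology" where
  "weak_star M \<equiv> subtopology ultraweak_topology M"

text \<open>\<open>Normal\<close> means continuous for the weak* topology.\<close>

definition faithful_normal_tracial_state ::
  "('h::complex_hilbert_space \<Rightarrow>\<^sub>L 'h) set \<Rightarrow> (('h \<Rightarrow>\<^sub>L 'h) \<Rightarrow> complex) \<Rightarrow> bool" where
  "faithful_normal_tracial_state M \<tau> \<longleftrightarrow>
     (\<forall>x\<in>M. \<forall>y\<in>M. \<tau> (x + y) = \<tau> x + \<tau> y) \<and>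
     (\<forall>c. \<forall>x\<in>M. \<tau> (c *\<^sub>O x) = c * \<tau> x) \<and>
     (\<forall>x\<in>M. positive_op x \<longrightarrow> \<tau> x \<in> \<real>\<^sub>\<ge>\<^sub>0) \<and>
     (\<forall>x\<in>M. \<forall>y\<in>M. \<tau> (x o\<^sub>L y) = \<tau> (y o\<^sub>L x)) \<and>
     (\<forall>x\<in>M. positive_op x \<and> \<tau> x = 0 \<longrightarrow> x = 0) \<and>
     continuous_map (weak_star M) euclidean \<tau> \<and>
     \<tau> id_blinfun = 1"


section \<open>Subdiagonal algebras\<close>

definition unital_subalgebra ::
  "('h::complex_hilbert_space \<Rightarrow>\<^sub>L 'h) set \<Rightarrow> ('h \<Rightarrow>\<^sub>L 'h) set \<Rightarrow> bool" where
  "unital_subalgebra M K \<longleftrightarrow> K \<subseteq> M \<and> id_blinfun \<in> K \<and>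
     (\<forall>x\<in>K. \<forall>y\<in>K. x + y \<in> K \<and> x o\<^sub>L y \<in> K) \<and> (\<forall>c. \<forall>x\<in>K. c *\<^sub>O x \<in> K)"

definition diagonal :: "('h::complex_hilbert_space \<Rightarrow>\<^sub>L 'h) set \<Rightarrow> ('h \<Rightarrow>\<^sub>L 'h) set" where
  "diagonal H = H \<inter> adj ` H"

definition star_sum :: "('h::complex_hilbert_space \<Rightarrow>\<^sub>L 'h) set \<Rightarrow> ('h \<Rightarrow>\<^sub>L 'h) set" where
  "star_sum H = {a + adj b | a b. a \<in> H \<and> b \<in> H}"

definition faithful_normal_expectation ::
  "('h::complex_hilbert_space \<Rightarrow>\<^sub>L 'h) set \<Rightarrow> ('h \<Rightarrow>\<^sub>L 'h) set \<Rightarrow>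
   (('h \<Rightarrow>\<^sub>L 'h) \<Rightarrow> ('h \<Rightarrow>\<^sub>L 'h)) \<Rightarrow> bool" where
  "faithful_normal_expectation M D \<Phi> \<longleftrightarrow>
     (\<forall>x\<in>M. \<Phi> x \<in> D) \<and> (\<forall>d\<in>D. \<Phi> d = d) \<and>
     (\<forall>x\<in>M. \<forall>y\<in>M. \<Phi> (x + y) = \<Phi> x + \<Phi> y) \<and>
     (\<forall>c. \<forall>x\<in>M. \<Phi> (c *\<^sub>O x) = c *\<^sub>O \<Phi> x) \<and>
     (\<forall>x\<in>M. positive_op x \<longrightarrow> positive_op (\<Phi> x)) \<and>
     (\<forall>d\<in>D. \<forall>x\<in>M. \<forall>e\<in>D. \<Phi> (d o\<^sub>L x o\<^sub>L e) = d o\<^sub>L \<Phi> x o\<^sub>L e) \<and>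
     (\<forall>x\<in>M. positive_op x \<and> \<Phi> x = 0 \<longrightarrow> x = 0) \<and>
     continuous_map (weak_star M) (weak_star M) \<Phi>"

definition subdiagonal ::
  "('h::complex_hilbert_space \<Rightarrow>\<^sub>L 'h) set \<Rightarrow> (('h \<Rightarrow>\<^sub>L 'h) \<Rightarrow> ('h \<Rightarrow>\<^sub>L 'h)) \<Rightarrow>
   ('h \<Rightarrow>\<^sub>L 'h) set \<Rightarrow> bool" where
  "subdiagonal M \<Phi> K \<longleftrightarrow> unital_subalgebra M K \<and>
     weak_star M closure_of star_sum K = M \<and>
     (\<forall>a\<in>K. \<forall>b\<in>K. \<Phi> (a o\<^sub>L b) = \<Phi> a o\<^sub>L \<Phi> b)"

definition finite_maximal_subdiagonal ::
  "('h::complex_hilbert_space \<Rightarrow>\<^sub>L 'h) set \<Rightarrow> (('h \<Rightarrow>\<^sub>L 'h) \<Rightarrow> complex) \<Rightarrow>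
   (('h \<Rightarrow>\<^sub>L 'h) \<Rightarrow> ('h \<Rightarrow>\<^sub>L 'h)) \<Rightarrow> ('h \<Rightarrow>\<^sub>L 'h) set \<Rightarrow> bool" where
  "finite_maximal_subdiagonal M \<tau> \<Phi> H \<longleftrightarrow>
     closedin (weak_star M) H \<and>
     faithful_normal_expectation M (diagonal H) \<Phi> \<and>
     subdiagonal M \<Phi> H \<and>
     (\<forall>K. subdiagonal M \<Phi> K \<and> H \<subseteq> K \<longrightarrow> K = H) \<and>
     (\<forall>x\<in>M. \<tau> (\<Phi> x) = \<tau> x)"

definition ker_expectation ::
  "(('h::complex_hilbert_space \<Rightarrow>\<^sub>L 'h) \<Rightarrow> ('h \<Rightarrow>\<^sub>L 'h)) \<Rightarrow> ('h \<Rightarrow>\<^sub>L 'h) set \<Rightarrow> ('h \<Rightarrow>\<^sub>L 'h) set" where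
  "ker_expectation \<Phi> H = {x \<in> H. \<Phi> x = 0}"

definition conjugation ::
  "(('h::complex_hilbert_space \<Rightarrow>\<^sub>L 'h) \<Rightarrow> ('h \<Rightarrow>\<^sub>L 'h)) \<Rightarrow> ('h \<Rightarrow>\<^sub>L 'h) set \<Rightarrow>
   ('h \<Rightarrow>\<^sub>L 'h) \<Rightarrow> ('h \<Rightarrow>\<^sub>L 'h)" where
  "conjugation \<Phi> H u = (THE v. \<exists>u1\<in>ker_expectation \<Phi> H. \<exists>u2\<in>ker_expectation \<Phi> H. \<exists>d\<in>diagonal H.
     u = u1 + adj u2 + d \<and> v = \<i> *\<^sub>O adj u2 - \<i> *\<^sub>O u1)"


section \<open>Unbounded operators and the space \<open>L\<^sup>2\<close>\<close>

text \<open>An unbounded operator is its graph.  With this encoding the operator product \<open>b a\<close>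
  (first \<open>a\<close>, then \<open>b\<close>, on its natural domain) is the relational composition \<open>a O b\<close>.\<close>

type_synonym 'h unbounded_op = "('h \<times> 'h) set"

definition graph_of :: "('h::complex_hilbert_space \<Rightarrow>\<^sub>L 'h) \<Rightarrow> 'h unbounded_op" where
  "graph_of x = {(v, blinfun_apply x v) | v. True}"

definition closed_operator :: "'h::complex_hilbert_space unbounded_op \<Rightarrow> bool" where
  "closed_operator x \<longleftrightarrow> single_valued x \<and> (0, 0) \<in> x \<and>
     (\<forall>u v u' v'. (u, v) \<in> x \<and> (u', v') \<in> x \<longrightarrow> (u + u', v + v') \<in> x) \<and>
     (\<forall>c u v. (u, v) \<in> x \<longrightarrow> (c *\<^sub>C u, c *\<^sub>C v) \<in> x) \<and>
     closed x \<and> closure (Domain x) = UNIV"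

definition graph_adj :: "'h::complex_hilbert_space unbounded_op \<Rightarrow> 'h unbounded_op" where
  "graph_adj x = {(w, z). \<forall>(u, v)\<in>x. cinner v w = cinner u z}"

definition affiliated ::
  "('h::complex_hilbert_space \<Rightarrow>\<^sub>L 'h) set \<Rightarrow> 'h unbounded_op \<Rightarrow> bool" where
  "affiliated M x \<longleftrightarrow>
     (\<forall>y\<in>commutant M. \<forall>(u, v)\<in>x. (blinfun_apply y u, blinfun_apply y v) \<in> x)"

definition trace_measurable ::
  "('h::complex_hilbert_space \<Rightarrow>\<^sub>L 'h) set \<Rightarrow> (('h \<Rightarrow>\<^sub>L 'h) \<Rightarrow> complex) \<Rightarrow> 'h unbounded_op \<Rightarrow> bool" where
  "trace_measurable M \<tau> x \<longleftrightarrow> closed_operator x \<and> affiliated M x \<and>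
     (\<forall>\<epsilon>>0. \<exists>e\<in>M. projection_op e \<and> range (blinfun_apply e) \<subseteq> Domain x \<and>
        Re (\<tau> (id_blinfun - e)) \<le> \<epsilon>)"

text \<open>The linear structure on measurable operators is that of strong sums and strong scalar
  multiples: one closes the algebraic sum (the algebraic multiple, which is not closed when
  \<open>c = 0\<close>).\<close>

definition strong_sum ::
  "'h::complex_hilbert_space unbounded_op \<Rightarrow> 'h unbounded_op \<Rightarrow> 'h unbounded_op" where
  "strong_sum x y = closure {(u, v + w) | u v w. (u, v) \<in> x \<and> (u, w) \<in> y}"

definition strong_scale ::
  "complex \<Rightarrow> 'h::complex_hilbert_space unbounded_op \<Rightarrow> 'h unbounded_op" where
  "strong_scale c x = closure {(u, c *\<^sub>C v) | u v. (u, v) \<in> x}"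

text \<open>The canonical extension of the trace to positive self-adjoint affiliated operators:
  \<open>\<tau>(a)\<close> is the supremum of \<open>\<tau>(b)\<close> over all \<open>b \<in> M\<close> with \<open>0 \<le> b \<le> a\<close>.\<close>

definition extended_trace ::
  "('h::complex_hilbert_space \<Rightarrow>\<^sub>L 'h) set \<Rightarrow> (('h \<Rightarrow>\<^sub>L 'h) \<Rightarrow> complex) \<Rightarrow> 'h unbounded_op \<Rightarrow> ennreal" where
  "extended_trace M \<tau> a =
     (SUP b\<in>{b\<in>M. positive_op b \<and>
                  (\<forall>(u, v)\<in>a. Re (cinner (blinfun_apply b u) u) \<le> Re (cinner v u))}.
        ennreal (Re (\<tau> b)))"

text \<open>Since \<open>|x|\<close> is the positive square root of \<open>x\<^sup>* x\<close>, the number \<open>\<tau>(|x|\<^sup>2)\<close> is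
  \<open>\<tau>(x\<^sup>* x)\<close>; here \<open>x\<^sup>* x\<close> is \<open>x O graph_adj x\<close>.\<close>

definition L2 ::
  "('h::complex_hilbert_space \<Rightarrow>\<^sub>L 'h) set \<Rightarrow> (('h \<Rightarrow>\<^sub>L 'h) \<Rightarrow> complex) \<Rightarrow> 'h unbounded_op set" where
  "L2 M \<tau> = {x. trace_measurable M \<tau> x \<and> extended_trace M \<tau> (x O graph_adj x) < \<infinity>}"

definition L2_norm ::
  "('h::complex_hilbert_space \<Rightarrow>\<^sub>L 'h) set \<Rightarrow> (('h \<Rightarrow>\<^sub>L 'h) \<Rightarrow> complex) \<Rightarrow> 'h unbounded_op \<Rightarrow> real" where
  "L2_norm M \<tau> x = sqrt (enn2real (extended_trace M \<tau> (x O graph_adj x)))"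

definition L2_dist ::
  "('h::complex_hilbert_space \<Rightarrow>\<^sub>L 'h) set \<Rightarrow> (('h \<Rightarrow>\<^sub>L 'h) \<Rightarrow> complex) \<Rightarrow>
   'h unbounded_op \<Rightarrow> 'h unbounded_op \<Rightarrow> real" where
  "L2_dist M \<tau> x y = L2_norm M \<tau> (strong_sum x (strong_scale (-1) y))"

definition H2 ::
  "('h::complex_hilbert_space \<Rightarrow>\<^sub>L 'h) set \<Rightarrow> (('h \<Rightarrow>\<^sub>L 'h) \<Rightarrow> complex) \<Rightarrow>
   ('h \<Rightarrow>\<^sub>L 'h) set \<Rightarrow> 'h unbounded_op set" where
  "H2 M \<tau> H = {x \<in> L2 M \<tau>. \<forall>\<epsilon>>0. \<exists>h\<in>H. L2_dist M \<tau> x (graph_of h) < \<epsilon>}"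

text \<open>The maps on \<open>L\<^sup>2\<close> are extensional functions, so that equality of maps is equality on
  \<open>L\<^sup>2\<close>.\<close>

definition L2_continuous_linear ::
  "('h::complex_hilbert_space \<Rightarrow>\<^sub>L 'h) set \<Rightarrow> (('h \<Rightarrow>\<^sub>L 'h) \<Rightarrow> complex) \<Rightarrow>
   ('h unbounded_op \<Rightarrow> 'h unbounded_op) \<Rightarrow> bool" where
  "L2_continuous_linear M \<tau> T \<longleftrightarrow> T \<in> L2 M \<tau> \<rightarrow>\<^sub>E L2 M \<tau> \<and>
     (\<forall>x\<in>L2 M \<tau>. \<forall>y\<in>L2 M \<tau>. T (strong_sum x y) = strong_sum (T x) (T y)) \<and>
     (\<forall>c. \<forall>x\<in>L2 M \<tau>. T (strong_scale c x) = strong_scale c (T x)) \<and>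
     (\<forall>x\<in>L2 M \<tau>. \<forall>\<epsilon>>0. \<exists>\<delta>>0. \<forall>y\<in>L2 M \<tau>.
        L2_dist M \<tau> y x < \<delta> \<longrightarrow> L2_dist M \<tau> (T y) (T x) < \<epsilon>)"

definition L2_opnorm ::
  "('h::complex_hilbert_space \<Rightarrow>\<^sub>L 'h) set \<Rightarrow> (('h \<Rightarrow>\<^sub>L 'h) \<Rightarrow> complex) \<Rightarrow>
   ('h unbounded_op \<Rightarrow> 'h unbounded_op) \<Rightarrow> real" where
  "L2_opnorm M \<tau> T = (SUP x\<in>{x \<in> L2 M \<tau>. L2_norm M \<tau> x \<le> 1}. L2_norm M \<tau> (T x))"

definition extends_conjugation ::
  "('h::complex_hilbert_space \<Rightarrow>\<^sub>L 'h) set \<Rightarrow> (('h \<Rightarrow>\<^sub>L 'h) \<Rightarrow> complex) \<Rightarrow>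
   (('h \<Rightarrow>\<^sub>L 'h) \<Rightarrow> ('h \<Rightarrow>\<^sub>L 'h)) \<Rightarrow> ('h \<Rightarrow>\<^sub>L 'h) set \<Rightarrow> ('h unbounded_op \<Rightarrow> 'h unbounded_op) \<Rightarrow> bool" where
  "extends_conjugation M \<tau> \<Phi> H T \<longleftrightarrow> L2_continuous_linear M \<tau> T \<and>
     (\<forall>u\<in>star_sum H. T (graph_of u) = graph_of (conjugation \<Phi> H u))"

end

theory Submission
  imports Defs
begin

text \<open>Normality of \<open>\<tau>\<close> gives square-summable sequences \<open>\<zeta>\<close>, \<open>\<beta>\<close> of vectors with
  \<open>\<parallel>x\<parallel>\<^sub>2 \<le> \<parallel>x \<zeta>\<parallel>\<close>, \<open>\<tau>(x) = \<langle>x \<zeta>, \<beta>\<rangle>\<close> and \<open>\<parallel>x \<beta>\<parallel> \<le> \<parallel>x\<parallel>\<^sub>2\<close> on \<open>M\<close>.  Hence the vectors \<open>v\<close> for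
  which \<open>x \<mapsto> x v\<close> is bounded in the trace norm are dense; they form a subspace invariant under
  \<open>M\<close> and its commutant.  A Cauchy sequence for the trace norm converges pointwise on them, and the
  limit determines a closed affiliated operator.  Using the resolvents \<open>(1 + e x\<^sup>* x)\<^sup>-\<^sup>1\<close>, which
  belong to \<open>M\<close>, one sees that this subspace is a core for every closed affiliated operator whose
  domain contains it, and that \<open>L\<^sup>2\<close> consists exactly of the operators represented in this way, with
  strong sums and norms computed along the sequences.  Weak-star density of \<open>H + H\<^sup>*\<close> becomes
  density in \<open>L\<^sup>2\<close>.  On \<open>H + H\<^sup>*\<close> the summands of \<open>u = u\<^sub>1 + u\<^sub>2\<^sup>* + d\<close> are orthogonal,
  because \<open>\<tau> = \<tau> o \<Phi>\<close> and \<open>\<Phi>\<close> is multiplicative on \<open>H\<close>, so the conjugation is a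
  contraction there, and \<open>u + i u~ = 2 u\<^sub>1 + d\<close> lies in \<open>H\<close>.\<close>

subsection \<open>Complex Hilbert spaces\<close>

text \<open>The obstacle is that \<open>L2\<close> consists of graphs of unbounded operators, with a
  closure as its sum and a supremum over bounded minorants as its norm; none of this is visibly a
  Hilbert space. Everything is therefore reduced to elements of M. A weak-star continuous functional
  involves whole sequences of vectors, so M is made to act on \<open>ell2\<close> through
  \<open>amp\<close>, where \<tau> becomes one vector functional. Resolvents arise by projecting
  onto a closed graph in the product Hilbert space, which requires no functional calculus. Spectral
  subspaces serve only \<open>trace_measurable\<close>; they are kernels of |B| - B, with |B| found
  by a square-root iteration. Traciality acts through n2 (adj x) = n2 x: right multiplication
  becomes bounded, which makes the bounded vectors M-invariant, and adjoints of Cauchy sequences are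
  Cauchy, which makes the limit operators closed. The norm of the conjugation equals 1 only if
  \<open>ker_expectation \<Phi> H\<close> is nonzero; otherwise the conjugation vanishes.\<close>

lemma scaleC_one [simp]: "1 *\<^sub>C x = (x::'a::complex_hilbert_space)"
  using scaleC_of_real[of 1 x] by simp

lemma scaleC_zero_left [simp]: "0 *\<^sub>C x = (0::'a::complex_hilbert_space)"
  using scaleC_of_real[of 0 x] by simp

lemma scaleC_minus_one [simp]: "(-1) *\<^sub>C x = - (x::'a::complex_hilbert_space)"
  using scaleC_of_real[of "-1" x] by simp

lemma scaleC_zero_right [simp]: "c *\<^sub>C (0::'a::complex_hilbert_space) = 0"
  using scaleC_add_right[of c 0 "0::'a"] by simp

lemma scaleC_minus_right: "c *\<^sub>C (- x) = - (c *\<^sub>C (x::'a::complex_hilbert_space))"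
  using scaleC_add_right[of c x "-x"] by (simp add: eq_neg_iff_add_eq_0 add.commute)

lemma scaleC_diff_right: "c *\<^sub>C (x - y) = c *\<^sub>C x - c *\<^sub>C (y::'a::complex_hilbert_space)"
  using scaleC_add_right[of c x "-y"] by (simp add: scaleC_minus_right)

lemma scaleR_scaleC: "r *\<^sub>R x = complex_of_real r *\<^sub>C (x::'a::complex_hilbert_space)"
  by (simp add: scaleC_of_real)

lemma cinner_scaleC_right: "cinner x (c *\<^sub>C y) = cnj c * cinner x (y::'a::complex_hilbert_space)"
  by (metis cinner_commute cinner_scaleC_left complex_cnj_mult)

lemma cinner_add_right: "cinner x (y + z) = cinner x y + cinner x (z::'a::complex_hilbert_space)"
  by (metis cinner_add_left cinner_commute complex_cnj_add)

lemma cinner_zero [simp]: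
  "cinner 0 x = 0" "cinner x (0::'a::complex_hilbert_space) = 0"
  using cinner_scaleC_left[of 0 x x] cinner_scaleC_right[of x 0 x] by simp_all

lemma cinner_minus:
  "cinner (- x) y = - cinner x y" "cinner x (- y) = - cinner x (y::'a::complex_hilbert_space)"
  using cinner_scaleC_left[of "-1" x y] cinner_scaleC_right[of x "-1" y] by simp_all

lemma cinner_diff_left: "cinner (x - y) z = cinner x z - cinner y (z::'a::complex_hilbert_space)"
  using cinner_add_left[of x "-y" z] by (simp add: cinner_minus)

lemma cinner_diff_right: "cinner x (y - z) = cinner x y - cinner x (z::'a::complex_hilbert_space)"
  using cinner_add_right[of x y "-z"] by (simp add: cinner_minus)

lemma cinner_scaleR:
  "cinner (r *\<^sub>R x) y = of_real r * cinner x y"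
  "cinner x (r *\<^sub>R y) = of_real r * cinner x (y::'a::complex_hilbert_space)"
  by (simp_all add: scaleR_scaleC cinner_scaleC_left cinner_scaleC_right)

lemmas cinner_lin = cinner_add_left cinner_add_right cinner_diff_left cinner_diff_right
  cinner_scaleC_left cinner_scaleC_right cinner_minus cinner_scaleR

text \<open>Positivity of the inner product is not an axiom of the class. Since \<open>sqrt\<close>
  is an odd function on the reals, a nonnegative norm forces \<open>Re (cinner x x)\<close> to be
  nonnegative; reality comes from conjugate symmetry.\<close>

lemma cinner_self: "cinner x x = complex_of_real ((norm (x::'a::complex_hilbert_space))\<^sup>2)"
proof -
  have "Re (cinner x x) \<ge> 0"
    using norm_eq_sqrt_cinner[of x] by (metis norm_ge_zero real_sqrt_ge_0_iff)
  moreover have "Im (cinner x x) = 0"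
    using cinner_commute[of x x] by (metis Reals_cnj_iff complex_is_Real_iff)
  ultimately show ?thesis
    using norm_eq_sqrt_cinner[of x] by (simp add: complex_eq_iff)
qed

lemma complex_mult_cnj_cmod2: "z * cnj z = (complex_of_real (cmod z))\<^sup>2" "cnj z * z = (complex_of_real (cmod z))\<^sup>2"
  using complex_norm_square[of z] by (simp_all add: mult.commute)

lemma norm_scaleC: "norm (c *\<^sub>C x) = cmod c * norm (x::'a::complex_hilbert_space)"
proof -
  have "complex_of_real ((norm (c *\<^sub>C x))\<^sup>2) = of_real ((cmod c * norm x)\<^sup>2)"
    unfolding cinner_self[symmetric]
    by (simp add: cinner_lin power_mult_distrib mult.assoc[symmetric] complex_mult_cnj_cmod2)
      (simp add: cinner_self)
  then have "(norm (c *\<^sub>C x))\<^sup>2 = (cmod c * norm x)\<^sup>2"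
    using of_real_eq_iff by blast
  then show ?thesis
    by (simp add: power2_eq_iff_nonneg)
qed

lemma cinner_Re_commute: "Re (cinner x y) = Re (cinner y (x::'a::complex_hilbert_space))"
  by (metis cinner_commute complex_cnj cnj.simps(1))

lemma norm_add_cinner:
  "(norm (x + y))\<^sup>2 = (norm x)\<^sup>2 + (norm y)\<^sup>2 + 2 * Re (cinner x (y::'a::complex_hilbert_space))"
proof -
  have "complex_of_real ((norm (x + y))\<^sup>2) =
      of_real ((norm x)\<^sup>2) + of_real ((norm y)\<^sup>2) + (cinner x y + cinner y x)"
    unfolding cinner_self[symmetric] by (simp add: cinner_lin)
  then have "Re (complex_of_real ((norm (x + y))\<^sup>2)) =
      Re (of_real ((norm x)\<^sup>2) + of_real ((norm y)\<^sup>2) + (cinner x y + cinner y x))"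
    by simp
  then show ?thesis
    using cinner_Re_commute[of x y] by simp
qed

lemma norm_diff_cinner:
  "(norm (x - y))\<^sup>2 = (norm x)\<^sup>2 + (norm y)\<^sup>2 - 2 * Re (cinner x (y::'a::complex_hilbert_space))"
  using norm_add_cinner[of x "-y"] by (simp add: cinner_minus)

text \<open>The coefficient is that of the projection of x onto the line of y. The identity yields
  Cauchy-Schwarz, its left side being nonnegative, and also the orthogonality of minimisers.\<close>

lemma norm_diff_component:
  fixes x y :: "'a::complex_hilbert_space"
  assumes "y \<noteq> 0"
  shows "(norm (x - (cinner x y / of_real ((norm y)\<^sup>2)) *\<^sub>C y))\<^sup>2
    = (norm x)\<^sup>2 - (cmod (cinner x y))\<^sup>2 / (norm y)\<^sup>2"
proof -
  define c where "c = cinner x y / of_real ((norm y)\<^sup>2)"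
  have y: "(norm y)\<^sup>2 > 0"
    using assms by simp
  have "cinner x (c *\<^sub>C y) = of_real ((cmod (cinner x y))\<^sup>2 / (norm y)\<^sup>2)"
    by (simp add: cinner_lin c_def complex_mult_cnj_cmod2)
  moreover have "cmod c = cmod (cinner x y) / (norm y)\<^sup>2"
    unfolding c_def norm_divide norm_of_real by simp
  then have "(norm (c *\<^sub>C y))\<^sup>2 = (cmod (cinner x y))\<^sup>2 / (norm y)\<^sup>2"
    using y by (simp add: norm_scaleC power_mult_distrib power_divide)
      (simp add: field_simps power2_eq_square power4_eq_xxxx)
  ultimately show ?thesis
    unfolding c_def[symmetric] norm_diff_cinner by (simp del: of_real_divide of_real_power)
qed

lemma cinner_minimizer:
  fixes x y :: "'a::complex_hilbert_space"
  assumes "\<And>c. norm x \<le> norm (x - c *\<^sub>C y)"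
  shows "cinner x y = 0"
proof (cases "y = 0")
  case False
  have "(norm x)\<^sup>2 \<le> (norm (x - (cinner x y / of_real ((norm y)\<^sup>2)) *\<^sub>C y))\<^sup>2"
    using assms by (simp add: power_mono)
  then have "(cmod (cinner x y))\<^sup>2 / (norm y)\<^sup>2 \<le> 0"
    unfolding norm_diff_component[OF False] by linarith
  then show ?thesis
    using False by (simp add: divide_le_0_iff)
qed simp

lemma cinner_norm_le: "cmod (cinner x y) \<le> norm x * norm (y::'a::complex_hilbert_space)"
proof (cases "y = 0")
  case False
  have "(cmod (cinner x y))\<^sup>2 / (norm y)\<^sup>2 \<le> (norm x)\<^sup>2"
    using norm_diff_component[OF False, of x]
      zero_le_power2[of "norm (x - (cinner x y / of_real ((norm y)\<^sup>2)) *\<^sub>C y)"] by linarith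
  then have "(cmod (cinner x y))\<^sup>2 \<le> (norm x * norm y)\<^sup>2"
    using False by (simp add: divide_le_eq power_mult_distrib)
  then show ?thesis
    by (rule power2_le_imp_le) simp
qed simp

interpretation cinner: bounded_bilinear
  "cinner :: 'a::complex_hilbert_space \<Rightarrow> 'a \<Rightarrow> complex"
  by (rule bounded_bilinear.intro)
    (auto simp: cinner_lin scaleR_conv_of_real intro!: exI[of _ 1] cinner_norm_le)

interpretation scaleC: bounded_bilinear
  "scaleC :: complex \<Rightarrow> 'a::complex_hilbert_space \<Rightarrow> 'a"
  by (rule bounded_bilinear.intro)
    (auto simp: scaleC_add_left scaleC_add_right scaleR_scaleC[where 'a='a] scaleC_scaleC norm_scaleC
      scaleR_conv_of_real mult.commute intro!: exI[of _ 1])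

lemma cinner_eq_zero_dense:
  fixes x :: "'a::complex_hilbert_space"
  assumes "closure S = UNIV" "\<And>s. s \<in> S \<Longrightarrow> cinner x s = 0"
  shows "x = 0"
proof -
  have "closed {s. cinner x s = 0}"
    by (intro closed_Collect_eq continuous_intros cinner.continuous_on)
  then have "closure S \<subseteq> {s. cinner x s = 0}"
    using assms(2) by (intro closure_minimal) auto
  then have "cinner x x = 0"
    using assms(1) by auto
  then show ?thesis
    by (simp add: cinner_self)
qed

lemma cinner_self_eq_0 [simp]: "cinner x x = 0 \<longleftrightarrow> x = (0::'a::complex_hilbert_space)"
  by (simp add: cinner_self)

section \<open>Complex subspaces: the projection theorem and the Riesz representation\<close>

definition csubspace :: "'a::complex_hilbert_space set \<Rightarrow> bool" where
  "csubspace S \<longleftrightarrow> 0 \<in> S \<and> (\<forall>x\<in>S. \<forall>y\<in>S. x + y \<in> S) \<and> (\<forall>c. \<forall>x\<in>S. c *\<^sub>C x \<in> S)"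

lemma csubspaceD:
  assumes "csubspace S"
  shows "0 \<in> S" "x \<in> S \<Longrightarrow> y \<in> S \<Longrightarrow> x + y \<in> S" "x \<in> S \<Longrightarrow> c *\<^sub>C x \<in> S"
    "x \<in> S \<Longrightarrow> y \<in> S \<Longrightarrow> x - y \<in> S"
proof -
  show "0 \<in> S" "x \<in> S \<Longrightarrow> y \<in> S \<Longrightarrow> x + y \<in> S" "x \<in> S \<Longrightarrow> c *\<^sub>C x \<in> S"
    using assms by (auto simp: csubspace_def)
  assume "x \<in> S" "y \<in> S"
  then have "x + (-1) *\<^sub>C y \<in> S"
    using assms unfolding csubspace_def by blast
  then show "x - y \<in> S"
    by simp
qed

lemma csubspace_closure:
  assumes "csubspace S"
  shows "csubspace (closure S)"
  unfolding csubspace_def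
proof (intro conjI ballI allI)
  show "0 \<in> closure S"
    using csubspaceD(1)[OF assms] closure_subset by blast
next
  fix x y assume "x \<in> closure S" "y \<in> closure S"
  then obtain f g where "\<And>n. f n \<in> S" "f \<longlonglongrightarrow> x" "\<And>n. g n \<in> S" "g \<longlonglongrightarrow> y"
    unfolding closure_sequential by blast
  then have "(\<lambda>n. f n + g n) \<longlonglongrightarrow> x + y" "\<forall>n. f n + g n \<in> S"
    using csubspaceD(2)[OF assms] by (auto intro: tendsto_add)
  then show "x + y \<in> closure S"
    unfolding closure_sequential by (intro exI[of _ "\<lambda>n. f n + g n"]) simp
next
  fix c x assume "x \<in> closure S"
  then obtain f where "\<And>n. f n \<in> S" "f \<longlonglongrightarrow> x"
    unfolding closure_sequential by blast
  then have "(\<lambda>n. c *\<^sub>C f n) \<longlonglongrightarrow> c *\<^sub>C x" "\<forall>n. c *\<^sub>C f n \<in> S"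
    using csubspaceD(3)[OF assms] by (auto intro: scaleC.tendsto)
  then show "c *\<^sub>C x \<in> closure S"
    unfolding closure_sequential by (intro exI[of _ "\<lambda>n. c *\<^sub>C f n"]) simp
qed

lemma projection_exists:
  fixes S :: "'a::complex_hilbert_space set"
  assumes S: "csubspace S" "closed S"
  obtains p where "p \<in> S" "\<And>s. s \<in> S \<Longrightarrow> cinner (w - p) s = 0"
proof -
  define d where "d = (INF s\<in>S. (norm (w - s))\<^sup>2)"
  have ne: "S \<noteq> {}" and bdd: "bdd_below ((\<lambda>s. (norm (w - s))\<^sup>2) ` S)"
    using csubspaceD(1)[OF S(1)] by (auto intro!: bdd_belowI[of _ 0])
  have d_le: "d \<le> (norm (w - s))\<^sup>2" if "s \<in> S" for s
    unfolding d_def using bdd that by (rule cINF_lower)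
  have "\<exists>s\<in>S. (norm (w - s))\<^sup>2 < d + inverse (real (Suc n))" for n
  proof (rule ccontr)
    assume "\<not> ?thesis"
    then have "d + inverse (real (Suc n)) \<le> d"
      unfolding d_def using ne by (intro cINF_greatest) (auto simp: not_less)
    then show False
      by (simp add: field_simps)
  qed
  then obtain f where f: "\<And>n. f n \<in> S" "\<And>n. (norm (w - f n))\<^sup>2 < d + inverse (real (Suc n))"
    by metis
  \<comment> \<open>Parallelogram law for w - f m and w - f n: the midpoint of f m and f n lies in
    S, so its squared distance from w is at least d.\<close>
  have par: "(norm (f m - f n))\<^sup>2 \<le> 2 * inverse (real (Suc m)) + 2 * inverse (real (Suc n))" for m n
  proof -
    have "(1/2) *\<^sub>R (f m + f n) \<in> S"
      unfolding scaleR_scaleC by (intro csubspaceD[OF S(1)] f)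
    then have "d \<le> (norm (w - (1/2) *\<^sub>R (f m + f n)))\<^sup>2"
      by (rule d_le)
    also have "w - (1/2) *\<^sub>R (f m + f n) = (1/2) *\<^sub>R ((w - f m) + (w - f n))"
      by (simp add: algebra_simps flip: scaleR_add_left)
    finally have "4 * d \<le> (norm ((w - f m) + (w - f n)))\<^sup>2"
      by (simp add: power_divide)
    moreover have "(norm (f m - f n))\<^sup>2 = (norm ((w - f m) - (w - f n)))\<^sup>2"
      by (simp add: norm_minus_commute)
    ultimately show ?thesis
      using f(2)[of m] f(2)[of n]
        norm_add_cinner[of "w - f m" "w - f n"] norm_diff_cinner[of "w - f m" "w - f n"] by linarith
  qed
  have "Cauchy f"
  proof (rule metric_CauchyI)
    fix e :: real assume e: "e > 0"
    obtain N where N: "inverse (real (Suc N)) < e\<^sup>2 / 4"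
      using reals_Archimedean[of "e\<^sup>2 / 4"] e by auto
    have "dist (f m) (f n) < e" if "m \<ge> N" "n \<ge> N" for m n
    proof -
      have "inverse (real (Suc m)) \<le> inverse (real (Suc N))" "inverse (real (Suc n)) \<le> inverse (real (Suc N))"
        using that by (auto simp: le_imp_inverse_le)
      then have "(norm (f m - f n))\<^sup>2 < e\<^sup>2"
        using par[of m n] N by linarith
      then show ?thesis
        using e by (simp add: dist_norm power2_less_imp_less)
    qed
    then show "\<exists>N. \<forall>m\<ge>N. \<forall>n\<ge>N. dist (f m) (f n) < e"
      by blast
  qed
  then obtain p where p: "f \<longlonglongrightarrow> p"
    using Cauchy_convergent convergent_def by blast
  have pS: "p \<in> S"
    using closed_sequentially[OF S(2)] f(1) p by blast
  have "(norm (w - p))\<^sup>2 \<le> d"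
  proof (rule LIMSEQ_le)
    show "(\<lambda>n. (norm (w - f n))\<^sup>2) \<longlonglongrightarrow> (norm (w - p))\<^sup>2"
      by (intro tendsto_intros p)
    show "(\<lambda>n. d + inverse (real (Suc n))) \<longlonglongrightarrow> d"
      using tendsto_add[OF tendsto_const LIMSEQ_inverse_real_of_nat] by simp
    show "\<exists>N. \<forall>n\<ge>N. (norm (w - f n))\<^sup>2 \<le> d + inverse (real (Suc n))"
      using f(2) less_imp_le by blast
  qed
  then have min: "norm (w - p) \<le> norm (w - s)" if "s \<in> S" for s
    using power2_le_imp_le[OF order_trans[OF _ d_le[OF that]]] by auto
  show thesis
  proof
    show "p \<in> S" by fact
    fix s assume "s \<in> S"
    then have "p + c *\<^sub>C s \<in> S" for c
      by (intro csubspaceD(2,3)[OF S(1)] pS)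
    then have "norm (w - p) \<le> norm (w - p - c *\<^sub>C s)" for c
      using min[of "p + c *\<^sub>C s"] by (simp only: diff_diff_eq)
    then show "cinner (w - p) s = 0"
      by (rule cinner_minimizer)
  qed
qed

text \<open>Hilbert space form of the Hahn-Banach separation argument: the residual of the
  projection of w is itself an admissible z, hence orthogonal to w and so zero. The density
  arguments below go through this criterion.\<close>

lemma in_closed_csubspace:
  assumes "csubspace S" "closed S" "\<And>z. (\<And>s. s \<in> S \<Longrightarrow> cinner z s = 0) \<Longrightarrow> cinner w z = 0"
  shows "w \<in> S"
proof -
  obtain p where p: "p \<in> S" "\<And>s. s \<in> S \<Longrightarrow> cinner (w - p) s = 0"
    using projection_exists[OF assms(1,2)] by blast
  have "cinner (w - p) (w - p) = cinner w (w - p) - cinner p (w - p)"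
    by (rule cinner_diff_left)
  also have "\<dots> = 0"
    using assms(3)[of "w - p"] p by (metis cinner_commute complex_cnj_zero diff_zero)
  finally show ?thesis
    using p(1) by (simp add: cinner_self)
qed

text \<open>Graphs of unbounded operators are subsets of this product, so the projection theorem
  becomes available for closed graphs.\<close>

instantiation prod :: (complex_hilbert_space, complex_hilbert_space) complex_hilbert_space
begin

definition "scaleC_prod c (x :: 'a \<times> 'b) = (c *\<^sub>C fst x, c *\<^sub>C snd x)"
definition "cinner_prod (x :: 'a \<times> 'b) y = cinner (fst x) (fst y) + cinner (snd x) (snd y)"

instance
proof
  fix x y z :: "'a \<times> 'b"
  show "cinner x y = cnj (cinner y x)"
    by (simp add: cinner_prod_def flip: cinner_commute)
  show "norm x = sqrt (Re (cinner x x))"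
    by (cases x) (simp add: cinner_prod_def norm_Pair cinner_self)
qed (simp_all add: scaleC_prod_def cinner_prod_def cinner_lin scaleC_add_left scaleC_add_right
    scaleC_scaleC scaleR_scaleC prod_eq_iff algebra_simps)

end

lemma scaleC_Pair [simp]: "c *\<^sub>C (x, y) = (c *\<^sub>C x, c *\<^sub>C y)"
  by (simp add: scaleC_prod_def)

lemma cinner_Pair [simp]: "cinner (x, y) (x', y') = cinner x x' + cinner y y'"
  by (simp add: cinner_prod_def)

text \<open>The representing vector is read off the projection of \<open>(0, 1)\<close> onto the closed graph
  of the functional.\<close>

lemma riesz:
  fixes S :: "'a::complex_hilbert_space set"
  assumes S: "csubspace S"
    and add: "\<And>x y. x \<in> S \<Longrightarrow> y \<in> S \<Longrightarrow> f (x + y) = f x + f y"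
    and scale: "\<And>c x. x \<in> S \<Longrightarrow> f (c *\<^sub>C x) = c * f x"
    and bound: "\<And>x. x \<in> S \<Longrightarrow> cmod (f x) \<le> C * norm x"
  obtains b where "b \<in> closure S" "\<And>x. x \<in> S \<Longrightarrow> f x = cinner x b"
proof -
  define G where "G = (\<lambda>x. (x, f x)) ` S"
  have "f 0 = 0"
    using scale[of 0 0] csubspaceD(1)[OF S] by simp
  then have "csubspace G"
    unfolding csubspace_def G_def using csubspaceD[OF S] add scale
    by (auto simp: image_iff scaleC_complex_def zero_prod_def intro!: bexI[of _ 0])
  then have cG: "csubspace (closure G)"
    by (rule csubspace_closure)
  obtain p where p: "p \<in> closure G" "\<And>s. s \<in> closure G \<Longrightarrow> cinner ((0, 1) - p) s = 0"
    using projection_exists[OF cG closed_closure] by blast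
  obtain s t where st: "p = (s, t)"
    by (cases p)
  have "closure G \<subseteq> closure S \<times> {t. True} \<inter> {p. cmod (snd p) \<le> C * norm (fst p)}"
  proof (rule closure_minimal)
    show "G \<subseteq> closure S \<times> {t. True} \<inter> {p. cmod (snd p) \<le> C * norm (fst p)}"
      using bound closure_subset by (auto simp: G_def)
    show "closed (closure S \<times> {t. True} \<inter> {p. cmod (snd p) \<le> C * norm (fst p)})"
      by (intro closed_Int closed_Times closed_Collect_le continuous_intros) auto
  qed
  then have s: "s \<in> closure S" "cmod t \<le> C * norm s"
    using p(1) st by auto
  have orth: "f x * (1 - cnj t) = cinner x s" if "x \<in> S" for x
  proof -
    have "(x, f x) \<in> closure G"
      using that unfolding G_def by (intro closure_subset[THEN subsetD] imageI)
    then have "cinner (- s, 1 - t) (x, f x) = 0"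
      using p(2)[of "(x, f x)"] unfolding st diff_Pair diff_0 by blast
    then have "cnj (cinner (- s) x + cinner (1 - t) (f x)) = 0"
      unfolding cinner_Pair by simp
    then have "cnj (cinner (- s) x) + cnj ((1 - t) * cnj (f x)) = 0"
      unfolding cinner_complex_def complex_cnj_add .
    then have "- cnj (cinner s x) + (1 - cnj t) * f x = 0"
      unfolding cinner_minus complex_cnj_minus
      by (simp only: complex_cnj_mult complex_cnj_diff complex_cnj_one complex_cnj_cnj)
    then have "cnj (cinner s x) = (1 - cnj t) * f x"
      by (metis eq_neg_iff_add_eq_0 neg_equal_iff_equal)
    then show ?thesis
      using cinner_commute[of x s] by (simp only: mult.commute)
  qed
  \<comment> \<open>For t = 1 the relation \<open>orth\<close> makes s orthogonal to S although s
    lies in its closure; then s = 0, and the bound inherited by the closure of the graph would read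
    1 \<le> 0.\<close>
  have t: "t \<noteq> 1"
  proof
    assume "t = 1"
    then have "cinner x s = 0" if "x \<in> S" for x
      using orth[OF that] by simp
    then have "S \<subseteq> {x. cinner x s = 0}"
      by blast
    then have "closure S \<subseteq> {x. cinner x s = 0}"
      by (intro closure_minimal closed_Collect_eq cinner.continuous_on continuous_intros)
    then have "s = 0"
      using s(1) by auto
    then show False
      using s(2) \<open>t = 1\<close> by simp
  qed
  show thesis
  proof
    show "(1 / (1 - t)) *\<^sub>C s \<in> closure S"
      using csubspaceD(3)[OF csubspace_closure[OF S]] s(1) by blast
    fix x assume "x \<in> S"
    moreover have "1 - cnj t \<noteq> 0"
      using t by (metis complex_cnj_cancel_iff complex_cnj_one right_minus_eq)
    ultimately show "f x = cinner x ((1 / (1 - t)) *\<^sub>C s)"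
      using orth[of x] by (simp add: cinner_lin field_simps)
  qed
qed

subsection \<open>Square-summable sequences\<close>

text \<open>A type of its own allows an instance of \<open>complex_hilbert_space\<close>, so that
  \<open>riesz\<close> and the projection theorem apply to the sequences that define the weak-star
  topology.\<close>

typedef (overloaded) 'a ell2 =
  "{f :: nat \<Rightarrow> 'a::complex_hilbert_space. summable (\<lambda>n. (norm (f n))\<^sup>2)}"
  morphisms coord Ell2
  by (rule exI[of _ "\<lambda>_. 0"]) simp

lemma summable_coord: "summable (\<lambda>n. (norm (coord f n))\<^sup>2)"
  using coord[of f] by simp

lemma coord_Ell2: "summable (\<lambda>n. (norm (f n))\<^sup>2) \<Longrightarrow> coord (Ell2 f) = f"
  by (simp add: Ell2_inverse)

lemma ell2_eqI: "(\<And>n. coord f n = coord g n) \<Longrightarrow> f = g"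
  by (metis coord_inject ext)

lemma norm_add_square_le: "(norm (x + y))\<^sup>2 \<le> 2 * (norm x)\<^sup>2 + 2 * (norm (y::'a::real_normed_vector))\<^sup>2"
proof -
  have "(norm (x + y))\<^sup>2 \<le> (norm x + norm y)\<^sup>2"
    by (intro power_mono norm_triangle_ineq) simp
  also have "\<dots> \<le> 2 * (norm x)\<^sup>2 + 2 * (norm y)\<^sup>2"
    using sum_squares_bound[of "norm x" "norm y"] by (simp add: power2_sum)
  finally show ?thesis .
qed

lemma summable_add_square:
  fixes f g :: "nat \<Rightarrow> 'a::real_normed_vector"
  assumes "summable (\<lambda>n. (norm (f n))\<^sup>2)" "summable (\<lambda>n. (norm (g n))\<^sup>2)"
  shows "summable (\<lambda>n. (norm (f n + g n))\<^sup>2)"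
  by (rule summable_comparison_test'[OF summable_add[OF summable_mult[OF assms(1), of 2]
        summable_mult[OF assms(2), of 2]], of 0])
    (use norm_add_square_le in auto)

lemma summable_scaleC_square:
  fixes f :: "nat \<Rightarrow> 'a::complex_hilbert_space"
  assumes "summable (\<lambda>n. (norm (f n))\<^sup>2)"
  shows "summable (\<lambda>n. (norm (c *\<^sub>C f n))\<^sup>2)"
  using summable_mult[OF assms, of "(cmod c)\<^sup>2"] by (simp add: norm_scaleC power_mult_distrib)

lemma summable_cinner:
  fixes f g :: "nat \<Rightarrow> 'a::complex_hilbert_space"
  assumes "summable (\<lambda>n. (norm (f n))\<^sup>2)" "summable (\<lambda>n. (norm (g n))\<^sup>2)"
  shows "summable (\<lambda>n. cinner (f n) (g n))"
proof (rule summable_comparison_test'[OF summable_add[OF assms], of 0])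
  fix n
  have "norm (cinner (f n) (g n)) \<le> norm (f n) * norm (g n)"
    by (rule cinner_norm_le)
  also have "\<dots> \<le> (norm (f n))\<^sup>2 + (norm (g n))\<^sup>2"
    using sum_squares_bound[of "norm (f n)" "norm (g n)"]
      mult_nonneg_nonneg[OF norm_ge_zero norm_ge_zero, of "f n" "g n"] by linarith
  finally show "norm (cinner (f n) (g n)) \<le> (norm (f n))\<^sup>2 + (norm (g n))\<^sup>2" .
qed

instantiation ell2 :: (complex_hilbert_space) real_normed_vector
begin

definition "0 = Ell2 (\<lambda>_. 0::'a)"
definition "f + g = Ell2 (\<lambda>n. coord f n + coord g n)" for f g :: "'a ell2"
definition "- f = Ell2 (\<lambda>n. - coord f n)" for f :: "'a ell2"
definition "f - g = Ell2 (\<lambda>n. coord f n - coord g n)" for f g :: "'a ell2"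
definition "scaleR_ell2 r f = Ell2 (\<lambda>n. r *\<^sub>R coord f n)" for f :: "'a ell2"
definition "norm_ell2 f = sqrt (\<Sum>n. (norm (coord f n))\<^sup>2)" for f :: "'a ell2"
definition "sgn_ell2 f = scaleR (inverse (norm f)) f" for f :: "'a ell2"
definition "dist_ell2 (f::'a ell2) g = norm (f - g)" for f g :: "'a ell2"
definition "uniformity_ell2 = (INF e\<in>{0<..}. principal {(x, y :: 'a ell2). dist x y < e})"
definition "open_ell2 U \<longleftrightarrow> (\<forall>x\<in>U. eventually (\<lambda>(x', y). x' = x \<longrightarrow> y \<in> U) uniformity)"
  for U :: "'a ell2 set"

lemma coord_zero [simp]: "coord (0 :: 'a ell2) n = 0"
  by (simp add: zero_ell2_def coord_Ell2)

lemma coord_add [simp]: "coord (f + g) n = coord f n + coord (g :: 'a ell2) n"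
  by (simp add: plus_ell2_def coord_Ell2 summable_add_square summable_coord)

lemma coord_minus [simp]: "coord (- f) n = - coord (f :: 'a ell2) n"
  by (simp add: uminus_ell2_def coord_Ell2 summable_coord)

lemma coord_diff [simp]: "coord (f - g) n = coord f n - coord (g :: 'a ell2) n"
proof -
  have "summable (\<lambda>n. (norm (coord f n - coord g n))\<^sup>2)"
    using summable_add_square[of "coord f" "\<lambda>n. - coord g n"] by (simp add: summable_coord)
  then show ?thesis
    by (simp add: minus_ell2_def coord_Ell2)
qed

lemma coord_scaleR [simp]: "coord (r *\<^sub>R f) n = r *\<^sub>R coord (f :: 'a ell2) n"
  by (simp add: scaleR_ell2_def coord_Ell2 scaleR_scaleC[where 'a='a] summable_scaleC_square summable_coord)

lemma norm_ell2_square: "(norm f)\<^sup>2 = (\<Sum>n. (norm (coord (f :: 'a ell2) n))\<^sup>2)"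
  by (simp add: norm_ell2_def suminf_nonneg summable_coord)

text \<open>Finite sections reduce the triangle inequality and completeness to statements about
  \<open>L2_set\<close>.\<close>

lemma L2_set_coord_le: "L2_set (\<lambda>n. norm (coord f n)) {..<N} \<le> norm (f :: 'a ell2)"
  unfolding L2_set_def norm_ell2_def
  by (intro real_sqrt_le_mono sum_le_suminf) (auto simp: summable_coord)

lemma norm_ell2_le:
  fixes f :: "'a ell2"
  assumes "\<And>N. L2_set (\<lambda>n. norm (coord f n)) {..<N} \<le> C"
  shows "norm f \<le> C"
proof -
  have C: "C \<ge> 0"
    using assms[of 0] by simp
  have "(\<Sum>n. (norm (coord f n))\<^sup>2) \<le> C\<^sup>2"
  proof (rule suminf_le_const[OF summable_coord])
    fix N
    have "(L2_set (\<lambda>n. norm (coord f n)) {..<N})\<^sup>2 \<le> C\<^sup>2"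
      using assms by (intro power_mono L2_set_nonneg)
    then show "(\<Sum>n<N. (norm (coord f n))\<^sup>2) \<le> C\<^sup>2"
      by (simp add: L2_set_def sum_nonneg)
  qed
  then show ?thesis
    using C by (simp add: norm_ell2_def real_le_lsqrt suminf_nonneg summable_coord)
qed

lemma norm_coord_le: "norm (coord f n) \<le> norm (f :: 'a ell2)"
proof -
  have "norm (coord f n) \<le> L2_set (\<lambda>n. norm (coord f n)) {..<Suc n}"
    by (rule member_le_L2_set) auto
  then show ?thesis
    using L2_set_coord_le order_trans by blast
qed

instance
proof
  fix f g h :: "'a ell2" and a b :: real
  show "norm (f + g) \<le> norm f + norm g"
  proof (rule norm_ell2_le)
    fix N
    have "L2_set (\<lambda>n. norm (coord (f + g) n)) {..<N}
        \<le> L2_set (\<lambda>n. norm (coord f n) + norm (coord g n)) {..<N}"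
      by (rule L2_set_mono) (auto simp: norm_triangle_ineq)
    also have "\<dots> \<le> L2_set (\<lambda>n. norm (coord f n)) {..<N} + L2_set (\<lambda>n. norm (coord g n)) {..<N}"
      by (rule L2_set_triangle_ineq)
    also have "\<dots> \<le> norm f + norm g"
      by (intro add_mono L2_set_coord_le)
    finally show "L2_set (\<lambda>n. norm (coord (f + g) n)) {..<N} \<le> norm f + norm g" .
  qed
  show "norm f = 0 \<longleftrightarrow> f = 0"
  proof
    assume "norm f = 0"
    then show "f = 0"
      using norm_coord_le[of f] by (intro ell2_eqI) (metis coord_zero norm_le_zero_iff)
  qed (simp add: norm_ell2_def)
  have "norm (a *\<^sub>R f) = sqrt (\<Sum>n. a\<^sup>2 * (norm (coord f n))\<^sup>2)"
    unfolding norm_ell2_def by (simp add: power_mult_distrib)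
  also have "\<dots> = \<bar>a\<bar> * norm f"
    by (simp add: suminf_mult summable_coord norm_ell2_def real_sqrt_mult)
  finally show "norm (a *\<^sub>R f) = \<bar>a\<bar> * norm f" .
qed (auto intro!: ell2_eqI simp: algebra_simps dist_ell2_def sgn_ell2_def uniformity_ell2_def open_ell2_def)

end

lemma tendsto_coord: "(f \<longlongrightarrow> l) F \<Longrightarrow> ((\<lambda>x. coord (f x) n) \<longlongrightarrow> coord (l::'a::complex_hilbert_space ell2) n) F"
  unfolding tendsto_iff dist_norm
  by (erule all_forward, erule imp_forward, assumption, erule eventually_mono)
    (metis coord_diff norm_coord_le order_le_less_trans)

instantiation ell2 :: (complex_hilbert_space) complex_hilbert_space
begin

definition "scaleC_ell2 c f = Ell2 (\<lambda>n. c *\<^sub>C coord f n)" for f :: "'a ell2"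
definition "cinner_ell2 f g = (\<Sum>n. cinner (coord f n) (coord g n))" for f g :: "'a ell2"

lemma coord_scaleC [simp]: "coord (c *\<^sub>C f) n = c *\<^sub>C coord (f :: 'a ell2) n"
  by (simp add: scaleC_ell2_def coord_Ell2 summable_scaleC_square summable_coord)

instance
proof
  fix X :: "nat \<Rightarrow> 'a ell2"
  assume X: "Cauchy X"
  have "Cauchy (\<lambda>k. coord (X k) n)" for n
  proof (rule metric_CauchyI)
    fix e :: real assume "e > 0"
    then obtain N where "\<forall>m\<ge>N. \<forall>k\<ge>N. dist (X m) (X k) < e"
      using metric_CauchyD[OF X] by blast
    then have "\<forall>m\<ge>N. \<forall>k\<ge>N. dist (coord (X m) n) (coord (X k) n) < e"
      unfolding dist_norm by (metis coord_diff norm_coord_le order_le_less_trans)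
    then show "\<exists>N. \<forall>m\<ge>N. \<forall>k\<ge>N. dist (coord (X m) n) (coord (X k) n) < e"
      by blast
  qed
  then have "\<forall>n. \<exists>l. (\<lambda>k. coord (X k) n) \<longlonglongrightarrow> l"
    using Cauchy_convergent convergent_def by blast
  then obtain l where l: "\<And>n. (\<lambda>k. coord (X k) n) \<longlonglongrightarrow> l n"
    by metis
  \<comment> \<open>A finite section involves finitely many coordinates, so m can tend to infinity
    inside it; the resulting bound does not depend on N.\<close>
  have bound: "\<exists>M. \<forall>k\<ge>M. \<forall>N. L2_set (\<lambda>n. norm (coord (X k) n - l n)) {..<N} \<le> e" if "e > 0" for e
  proof -
    obtain M where M: "\<And>m k. m \<ge> M \<Longrightarrow> k \<ge> M \<Longrightarrow> dist (X m) (X k) < e"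
      using metric_CauchyD[OF X \<open>e > 0\<close>] by blast
    have "L2_set (\<lambda>n. norm (coord (X k) n - l n)) {..<N} \<le> e" if k: "k \<ge> M" for k N
    proof (rule tendsto_upperbound)
      show "((\<lambda>m. L2_set (\<lambda>n. norm (coord (X k) n - coord (X m) n)) {..<N})
          \<longlongrightarrow> L2_set (\<lambda>n. norm (coord (X k) n - l n)) {..<N}) sequentially"
        unfolding L2_set_def by (intro tendsto_intros l)
      have "L2_set (\<lambda>n. norm (coord (X k) n - coord (X m) n)) {..<N} \<le> e" if "m \<ge> M" for m
        using L2_set_coord_le[of "X k - X m" N] M[OF k that] by (simp add: dist_norm)
      then show "eventually (\<lambda>m. L2_set (\<lambda>n. norm (coord (X k) n - coord (X m) n)) {..<N} \<le> e) sequentially"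
        using eventually_sequentially by blast
    qed simp
    then show ?thesis
      by blast
  qed
  obtain M where M: "\<And>N. L2_set (\<lambda>n. norm (coord (X M) n - l n)) {..<N} \<le> 1"
    using bound[of 1] by (meson order_refl zero_less_one)
  have "summable (\<lambda>n. (norm (coord (X M) n - l n))\<^sup>2)"
  proof (rule bounded_imp_summable)
    fix N
    have "(L2_set (\<lambda>n. norm (coord (X M) n - l n)) {..<Suc N})\<^sup>2 \<le> 1\<^sup>2"
      using M by (intro power_mono L2_set_nonneg)
    then show "(\<Sum>n\<le>N. (norm (coord (X M) n - l n))\<^sup>2) \<le> 1"
      by (simp add: L2_set_def sum_nonneg lessThan_Suc_atMost)
  qed simp
  then have "summable (\<lambda>n. (norm (coord (X M) n - (coord (X M) n - l n)))\<^sup>2)"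
    using summable_add_square[OF summable_coord[of "X M"], of "\<lambda>n. - (coord (X M) n - l n)"]
    by (simp add: norm_minus_commute)
  then have l': "coord (Ell2 l) = l"
    by (simp add: coord_Ell2)
  have "X \<longlonglongrightarrow> Ell2 l"
  proof (rule metric_LIMSEQ_I)
    fix e :: real assume "e > 0"
    then obtain M where M: "\<And>k N. k \<ge> M \<Longrightarrow> L2_set (\<lambda>n. norm (coord (X k) n - l n)) {..<N} \<le> e / 2"
      using bound[of "e/2"] by auto
    have "norm (X k - Ell2 l) \<le> e / 2" if "k \<ge> M" for k
      using M[OF that] by (intro norm_ell2_le) (simp add: l')
    then show "\<exists>M. \<forall>k\<ge>M. dist (X k) (Ell2 l) < e"
      using \<open>e > 0\<close> by (force simp: dist_norm)
  qed
  then show "convergent X"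
    by (auto simp: convergent_def)
next
  fix f g h :: "'a ell2" and c d :: complex and r :: real
  note sc = summable_cinner[OF summable_coord summable_coord]
  show "cinner f g = cnj (cinner g f)"
    unfolding cinner_ell2_def by (subst bounded_linear.suminf[OF bounded_linear_cnj sc])
      (simp flip: cinner_commute)
  show "cinner (f + g) h = cinner f h + cinner g h"
    unfolding cinner_ell2_def by (simp add: cinner_lin suminf_add[OF sc sc])
  show "cinner (c *\<^sub>C f) g = c * cinner f g"
    unfolding cinner_ell2_def by (simp add: cinner_lin suminf_mult[OF sc])
  have "cinner f f = of_real (\<Sum>n. (norm (coord f n))\<^sup>2)"
    unfolding cinner_ell2_def cinner_self
    by (rule suminf_of_real[symmetric]) (rule summable_coord)
  then show "norm f = sqrt (Re (cinner f f))"
    by (simp add: norm_ell2_def)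
qed (auto intro!: ell2_eqI simp: scaleC_add_left scaleC_add_right scaleC_scaleC scaleR_scaleC)

end

subsection \<open>Bounded operators and adjoints\<close>

declare blinfun.add_left [simp] blinfun.diff_left [simp] blinfun.minus_left [simp]

notation blinfun_apply (infixr \<open>\<cdot>\<close> 90)

lemma clinear_opD: "clinear_op x \<Longrightarrow> x \<cdot> (c *\<^sub>C v) = c *\<^sub>C x \<cdot> v"
  by (simp add: clinear_op_def)

lemma blinfun_apply_scale_op [simp]: "(c *\<^sub>O x) \<cdot> v = c *\<^sub>C x \<cdot> v"
  unfolding scale_op_def
  by (subst bounded_linear_Blinfun_apply)
    (auto intro: bounded_linear_compose[OF scaleC.bounded_linear_right] blinfun.bounded_linear_right)

lemma clinear_op_intros [simp, intro]:
  "clinear_op id_blinfun" "clinear_op 0"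
  "clinear_op x \<Longrightarrow> clinear_op y \<Longrightarrow> clinear_op (x + y)"
  "clinear_op x \<Longrightarrow> clinear_op y \<Longrightarrow> clinear_op (x - y)"
  "clinear_op x \<Longrightarrow> clinear_op y \<Longrightarrow> clinear_op (x o\<^sub>L y)"
  "clinear_op x \<Longrightarrow> clinear_op (c *\<^sub>O x)"
  by (simp_all add: clinear_op_def scaleC_add_right scaleC_diff_right scaleC_scaleC mult.commute)

lemma cinner_eqI: "(\<And>u. cinner u a = cinner u b) \<Longrightarrow> a = (b::'a::complex_hilbert_space)"
  using cinner_self_eq_0[of "a - b"] by (simp add: cinner_diff_right)

text \<open>An operator is well behaved in the sense of \<open>adj\<close> only if it is complex linear: otherwise
  the description in the definition of \<open>adj\<close> denotes an unspecified operator.\<close>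

lemma adj_ex1:
  assumes x: "clinear_op x"
  shows "\<exists>!y. \<forall>u v. cinner (x \<cdot> u) v = cinner u (y \<cdot> v)"
proof -
  have "\<exists>b. \<forall>u. cinner (x \<cdot> u) v = cinner u b" for v
  proof -
    have "cmod (cinner (x \<cdot> u) v) \<le> (norm x * norm v) * norm u" for u
      using order_trans[OF cinner_norm_le mult_right_mono[OF norm_blinfun norm_ge_zero]]
      by (simp add: mult_ac)
    then obtain b where "\<And>u. u \<in> UNIV \<Longrightarrow> cinner (x \<cdot> u) v = cinner u b"
      using riesz[of UNIV "\<lambda>u. cinner (x \<cdot> u) v" "norm x * norm v"]
      by (auto simp: csubspace_def cinner_lin blinfun.add_right clinear_opD[OF x])
    then show ?thesis
      by blast
  qed
  then obtain f where f: "\<And>u v. cinner (x \<cdot> u) v = cinner u (f v)"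
    by metis
  have "bounded_linear f"
  proof (rule bounded_linear_intro)
    show "f (a + b) = f a + f b" for a b
      by (rule cinner_eqI) (simp add: cinner_add_right flip: f)
    show "f (r *\<^sub>R a) = r *\<^sub>R f a" for r a
      by (rule cinner_eqI) (simp add: cinner_scaleR flip: f)
    show "norm (f v) \<le> norm v * norm x" for v
    proof (cases "f v = 0")
      case False
      have "(norm (f v))\<^sup>2 = cmod (cinner (x \<cdot> f v) v)"
        unfolding f cinner_self by (simp add: norm_power)
      also have "\<dots> \<le> norm (x \<cdot> f v) * norm v"
        by (rule cinner_norm_le)
      also have "\<dots> \<le> norm x * norm (f v) * norm v"
        by (intro mult_right_mono norm_blinfun) simp
      finally show ?thesis
        using False by (simp add: power2_eq_square mult_ac)
    qed simp
  qed
  then have "cinner (x \<cdot> u) v = cinner u (Blinfun f \<cdot> v)" for u v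
    by (simp add: bounded_linear_Blinfun_apply f)
  then show ?thesis
    by (intro ex1I[of _ "Blinfun f"] allI blinfun_eqI, simp) (rule cinner_eqI, simp)
qed

lemma cinner_adj: "clinear_op x \<Longrightarrow> cinner (x \<cdot> u) v = cinner u (adj x \<cdot> v)"
  using theI'[OF adj_ex1] unfolding adj_def by blast

lemma cinner_adj': "clinear_op x \<Longrightarrow> cinner (adj x \<cdot> u) v = cinner u (x \<cdot> v)"
  by (metis cinner_adj cinner_commute)

lemma adj_eqI:
  assumes "clinear_op x" "\<And>u v. cinner (x \<cdot> u) v = cinner u (y \<cdot> v)"
  shows "adj x = y"
  using the1_equality[OF adj_ex1[OF assms(1)]] assms(2) unfolding adj_def by blast

lemma clinear_op_adj [simp, intro]: "clinear_op x \<Longrightarrow> clinear_op (adj x)"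
  unfolding clinear_op_def[of "adj x"]
  by (intro allI, rule cinner_eqI) (simp add: cinner_lin cinner_adj[symmetric])

lemma adj_adj [simp]: "clinear_op x \<Longrightarrow> adj (adj x) = x"
  by (rule adj_eqI) (simp_all add: cinner_adj')

lemma adj_simps [simp]:
  "adj id_blinfun = id_blinfun" "adj 0 = 0"
  "clinear_op x \<Longrightarrow> clinear_op y \<Longrightarrow> adj (x + y) = adj x + adj y"
  "clinear_op x \<Longrightarrow> clinear_op y \<Longrightarrow> adj (x - y) = adj x - adj y"
  "clinear_op x \<Longrightarrow> clinear_op y \<Longrightarrow> adj (x o\<^sub>L y) = adj y o\<^sub>L adj x"
  "clinear_op x \<Longrightarrow> adj (c *\<^sub>O x) = cnj c *\<^sub>O adj x"
  by (rule adj_eqI; simp add: cinner_lin cinner_adj)+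

lemma positive_op_iff:
  "positive_op x \<longleftrightarrow> (\<forall>v. Im (cinner (x \<cdot> v) v) = 0 \<and> Re (cinner (x \<cdot> v) v) \<ge> 0)"
  by (auto simp: positive_op_def complex_nonneg_Reals_iff)

lemma positive_op_adj_self: "clinear_op x \<Longrightarrow> positive_op (adj x o\<^sub>L x)"
  by (simp add: positive_op_iff cinner_adj' cinner_self)

lemma scale_op_simps [simp]:
  "1 *\<^sub>O x = x" "(-1) *\<^sub>O x = - x" "0 *\<^sub>O x = 0" "a *\<^sub>O b *\<^sub>O x = (a * b) *\<^sub>O x"
  "c *\<^sub>O (x + y) = c *\<^sub>O x + c *\<^sub>O y" "c *\<^sub>O (x - y) = c *\<^sub>O x - c *\<^sub>O y"
  "(c *\<^sub>O x) o\<^sub>L y = c *\<^sub>O (x o\<^sub>L y)" "c *\<^sub>O 0 = 0"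
  by (rule blinfun_eqI; simp add: scaleC_scaleC scaleC_add_right scaleC_diff_right)+

lemma compose_scale_op [simp]: "clinear_op x \<Longrightarrow> x o\<^sub>L (c *\<^sub>O y) = c *\<^sub>O (x o\<^sub>L y)"
  by (rule blinfun_eqI) (simp add: clinear_opD)

lemma scaleR_scale_op: "r *\<^sub>R x = of_real r *\<^sub>O x"
  by (rule blinfun_eqI) (simp add: scaleR_scaleC blinfun.scaleR_left)

lemma blinfun_compose_distrib:
  "(x + y) o\<^sub>L z = (x o\<^sub>L z) + (y o\<^sub>L z)" "z o\<^sub>L (x + y) = (z o\<^sub>L x) + (z o\<^sub>L y)"
  "(x - y) o\<^sub>L z = (x o\<^sub>L z) - (y o\<^sub>L z)" "z o\<^sub>L (x - y) = (z o\<^sub>L x) - (z o\<^sub>L y)"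
  by (rule blinfun_eqI; simp add: blinfun.add_right blinfun.diff_right)+

lemma blinfun_compose_simps [simp]:
  "id_blinfun o\<^sub>L x = x" "x o\<^sub>L id_blinfun = x" "0 o\<^sub>L x = 0" "x o\<^sub>L 0 = 0"
  by (rule blinfun_eqI; simp)+

lemma norm_adj: assumes "clinear_op x" shows "norm (adj x) = norm x"
proof -
  have le: "norm (adj x) \<le> norm x" if x: "clinear_op x" for x :: "'a \<Rightarrow>\<^sub>L 'a"
  proof (rule norm_blinfun_bound)
    fix v
    show "norm (adj x \<cdot> v) \<le> norm x * norm v"
    proof (cases "adj x \<cdot> v = 0")
      case False
      let ?w = "adj x \<cdot> v"
      have "(norm ?w)\<^sup>2 = cmod (cinner (x \<cdot> ?w) v)"
        unfolding cinner_adj[OF x] cinner_self by (simp add: norm_power)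
      also have "\<dots> \<le> norm (x \<cdot> ?w) * norm v"
        by (rule cinner_norm_le)
      also have "\<dots> \<le> norm x * norm ?w * norm v"
        by (intro mult_right_mono norm_blinfun) simp
      finally show ?thesis
        using False by (simp add: power2_eq_square mult_ac)
    qed simp
  qed simp
  show ?thesis
    using le[OF assms] le[of "adj x"] assms by simp
qed

lemma blinfun_apply_closure_invariant:
  assumes "\<And>s. s \<in> S \<Longrightarrow> a \<cdot> s \<in> closure S" "v \<in> closure S"
  shows "a \<cdot> v \<in> closure S"
proof -
  have "closed (blinfun_apply a -` closure S)"
    by (intro closed_vimage closed_closure blinfun.continuous_on continuous_intros)
  then have "closed {v. a \<cdot> v \<in> closure S}"
    by (simp add: vimage_def)
  then show ?thesis
    using closure_minimal[of S "{v. a \<cdot> v \<in> closure S}"] assms by blast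
qed

section \<open>Orthogonal projections as bounded operators\<close>

definition orth_proj :: "'a::complex_hilbert_space set \<Rightarrow> 'a \<Rightarrow>\<^sub>L 'a" where
  "orth_proj S = Blinfun (\<lambda>w. SOME p. p \<in> S \<and> (\<forall>s\<in>S. cinner (w - p) s = 0))"

context
  fixes S :: "'a::complex_hilbert_space set"
  assumes S: "csubspace S" "closed S"
begin

lemma orth_proj_unique:
  assumes "p \<in> S" "\<And>s. s \<in> S \<Longrightarrow> cinner (w - p) s = 0" "q \<in> S" "\<And>s. s \<in> S \<Longrightarrow> cinner (w - q) s = 0"
  shows "p = q"
proof -
  have "p - q \<in> S"
    using csubspaceD(4)[OF S(1)] assms by blast
  then have "cinner ((w - q) - (w - p)) (p - q) = 0"
    using assms by (simp add: cinner_diff_left)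
  then show ?thesis
    by simp
qed

lemma orth_proj:
  shows orth_proj_in: "orth_proj S \<cdot> w \<in> S"
    and orth_proj_orth: "\<And>s. s \<in> S \<Longrightarrow> cinner (w - orth_proj S \<cdot> w) s = 0"
    and clinear_op_orth_proj: "clinear_op (orth_proj S)"
proof -
  define f where "f w = (SOME p. p \<in> S \<and> (\<forall>s\<in>S. cinner (w - p) s = 0))" for w
  have "\<exists>p. p \<in> S \<and> (\<forall>s\<in>S. cinner (w - p) s = 0)" for w
    by (rule projection_exists[OF S, of w]) (rule exI, rule conjI, assumption, rule ballI)
  then have f: "f w \<in> S \<and> (\<forall>s\<in>S. cinner (w - f w) s = 0)" for w
    unfolding f_def by (rule someI_ex)
  have fS: "f w \<in> S" and fo: "s \<in> S \<Longrightarrow> cinner (f w) s = cinner w s" for w s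
    using f[of w] by (simp_all add: cinner_diff_left)
  have add: "f (v + w) = f v + f w" for v w
    by (rule orth_proj_unique[of _ "v + w"]) (simp_all add: cinner_lin fS fo csubspaceD(2)[OF S(1)])
  have scale: "f (c *\<^sub>C w) = c *\<^sub>C f w" for c w
    by (rule orth_proj_unique[of _ "c *\<^sub>C w"])
      (simp_all add: cinner_lin fS fo csubspaceD(3)[OF S(1)])
  have "norm (f w) \<le> norm w" for w
  proof -
    have "(norm w)\<^sup>2 = (norm ((w - f w) + f w))\<^sup>2"
      by simp
    also have "\<dots> = (norm (w - f w))\<^sup>2 + (norm (f w))\<^sup>2"
      using f[of w] unfolding norm_add_cinner by simp
    finally have "(norm (f w))\<^sup>2 \<le> (norm w)\<^sup>2"
      by simp
    then show ?thesis
      by (rule power2_le_imp_le) simp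
  qed
  then have "bounded_linear f"
    by (intro bounded_linear_intro[of f 1]) (auto simp: add scale scaleR_scaleC[where 'a='a])
  then have "orth_proj S \<cdot> w = f w" for w
    unfolding orth_proj_def f_def[symmetric] by (simp add: bounded_linear_Blinfun_apply)
  then show "orth_proj S \<cdot> w \<in> S"
    "\<And>s. s \<in> S \<Longrightarrow> cinner (w - orth_proj S \<cdot> w) s = 0"
    "clinear_op (orth_proj S)"
    using f by (auto simp: clinear_op_def scale)
qed

lemma orth_proj_ident: "w \<in> S \<Longrightarrow> orth_proj S \<cdot> w = w"
  by (rule orth_proj_unique[of _ w]) (auto intro: orth_proj_in orth_proj_orth)

lemma cinner_orth_proj:
  "cinner (orth_proj S \<cdot> v) w = cinner (orth_proj S \<cdot> v) (orth_proj S \<cdot> w)"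
proof -
  have "cinner (w - orth_proj S \<cdot> w) (orth_proj S \<cdot> v) = 0"
    by (intro orth_proj_orth orth_proj_in)
  then have "cinner (orth_proj S \<cdot> v) (w - orth_proj S \<cdot> w) = 0"
    by (metis cinner_commute complex_cnj_zero)
  then show ?thesis
    by (simp add: cinner_diff_right)
qed

lemma adj_orth_proj: "adj (orth_proj S) = orth_proj S"
  by (rule adj_eqI[OF clinear_op_orth_proj])
    (metis cinner_commute cinner_orth_proj)

lemma orth_proj_idem: "orth_proj S o\<^sub>L orth_proj S = orth_proj S"
  by (rule blinfun_eqI) (simp add: orth_proj_ident orth_proj_in)

lemma projection_op_orth_proj: "projection_op (orth_proj S)"
  by (simp add: projection_op_def adj_orth_proj orth_proj_idem)

text \<open>Invariance under a keeps the image of the projection in S, and invariance under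
  \<open>adj a\<close> keeps the image of the residual orthogonal to S; uniqueness of the
  decomposition does the rest.\<close>

lemma orth_proj_commute:
  assumes a: "clinear_op a" "\<And>s. s \<in> S \<Longrightarrow> a \<cdot> s \<in> S" "\<And>s. s \<in> S \<Longrightarrow> adj a \<cdot> s \<in> S"
  shows "a \<cdot> (orth_proj S \<cdot> w) = orth_proj S \<cdot> (a \<cdot> w)"
proof (rule orth_proj_unique[of _ "a \<cdot> w"])
  fix s assume "s \<in> S"
  then have "cinner (w - orth_proj S \<cdot> w) (adj a \<cdot> s) = 0"
    using a(3) by (intro orth_proj_orth)
  then show "cinner (a \<cdot> w - a \<cdot> (orth_proj S \<cdot> w)) s = 0"
    by (simp add: cinner_adj[OF a(1)] cinner_diff_left)
qed (use a in \<open>auto intro: orth_proj_in orth_proj_orth\<close>)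

end

subsection \<open>Amplification to square-summable sequences\<close>

text \<open>The ampliation of x to countably many copies of the Hilbert space. It turns each
  functional defining the weak-star topology into a vector functional x \<mapsto>
  \<open>cinner (amp x \<xi>) \<eta>\<close>.\<close>

definition amp :: "('h::complex_hilbert_space \<Rightarrow>\<^sub>L 'h) \<Rightarrow> 'h ell2 \<Rightarrow> 'h ell2" where
  "amp x f = Ell2 (\<lambda>n. x \<cdot> coord f n)"

lemma norm_blinfun_square: "(norm (x \<cdot> v))\<^sup>2 \<le> (norm x)\<^sup>2 * (norm v)\<^sup>2"
  using power_mono[OF norm_blinfun[of x v] norm_ge_zero, of 2] by (simp add: power_mult_distrib)

lemma coord_amp [simp]: "coord (amp x f) n = x \<cdot> coord f n"
proof -
  have "summable (\<lambda>n. (norm (x \<cdot> coord f n))\<^sup>2)"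
    by (rule summable_comparison_test'[OF summable_mult[OF summable_coord[of f], of "(norm x)\<^sup>2"], of 0])
      (use norm_blinfun_square in auto)
  then show ?thesis
    by (simp add: amp_def coord_Ell2)
qed

lemma norm_amp_le: "norm (amp x f) \<le> norm x * norm f"
proof (rule norm_ell2_le)
  fix N
  have "L2_set (\<lambda>n. norm (coord (amp x f) n)) {..<N} \<le> L2_set (\<lambda>n. norm x * norm (coord f n)) {..<N}"
    by (rule L2_set_mono) (auto simp: norm_blinfun)
  also have "\<dots> = norm x * L2_set (\<lambda>n. norm (coord f n)) {..<N}"
    by (simp add: L2_set_right_distrib)
  also have "\<dots> \<le> norm x * norm f"
    by (intro mult_left_mono L2_set_coord_le norm_ge_zero)
  finally show "L2_set (\<lambda>n. norm (coord (amp x f) n)) {..<N} \<le> norm x * norm f" .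
qed

lemma amp_simps [simp]:
  "amp x (f + g) = amp x f + amp x g" "amp x (f - g) = amp x f - amp x g"
  "amp (x + y) f = amp x f + amp y f" "amp (x - y) f = amp x f - amp y f"
  "amp (c *\<^sub>O x) f = c *\<^sub>C amp x f" "amp (x o\<^sub>L y) f = amp x (amp y f)"
  "amp id_blinfun f = f" "amp 0 f = 0" "amp x 0 = 0"
  by (rule ell2_eqI; simp add: blinfun.add_right blinfun.diff_right)+

lemma amp_scaleC: "clinear_op x \<Longrightarrow> amp x (c *\<^sub>C f) = c *\<^sub>C amp x f"
  by (rule ell2_eqI) (simp add: clinear_opD)

lemma bounded_linear_amp: "bounded_linear (amp x)"
proof (rule bounded_linear_intro)
  show "norm (amp x f) \<le> norm f * norm x" for f
    using norm_amp_le[of x f] by (simp add: mult.commute)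
qed (auto intro!: ell2_eqI simp: blinfun.scaleR_right)

lemma cinner_amp_adj: "clinear_op x \<Longrightarrow> cinner (amp x f) g = cinner f (amp (adj x) g)"
  by (simp add: cinner_ell2_def cinner_adj)

lemma cinner_amp_adj': "clinear_op x \<Longrightarrow> cinner (amp (adj x) f) g = cinner f (amp x g)"
  by (simp add: cinner_ell2_def cinner_adj')

text \<open>Interleaving f and g yields a vector h whose image under any x has squared norm equal to
  the sum of the two others. One vector thus dominates finitely many, which is what intersections of
  neighbourhoods require.\<close>

lemma merge_ell2:
  obtains h :: "'h::complex_hilbert_space ell2"
  where "\<And>x. norm (amp x f) \<le> norm (amp x h)" "\<And>x. norm (amp x g) \<le> norm (amp x h)"
proof -
  define hh where "hh n = (if even n then coord f (n div 2) else coord g ((n - 1) div 2))" for n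
  have sums: "(\<lambda>n. (norm (x \<cdot> hh n))\<^sup>2) sums ((norm (amp x g))\<^sup>2 + (norm (amp x f))\<^sup>2)" for x
  proof -
    have "(\<lambda>n. (norm (coord (amp x u) n))\<^sup>2) sums (norm (amp x u))\<^sup>2" for u
      unfolding norm_ell2_square by (rule summable_sums[OF summable_coord])
    from sums_if[OF this[of g] this[of f]] show ?thesis
      unfolding hh_def by (rule back_subst[of "\<lambda>f. f sums _"]) auto
  qed
  have h: "coord (Ell2 hh) = hh"
    using sums_summable[OF sums[of id_blinfun]] by (simp add: coord_Ell2)
  have "(norm (amp x (Ell2 hh)))\<^sup>2 = (norm (amp x g))\<^sup>2 + (norm (amp x f))\<^sup>2" for x
    unfolding norm_ell2_square using sums_unique[OF sums[of x]] by (simp add: h norm_ell2_square)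
  then show thesis
    using that[of "Ell2 hh"] by (simp add: power2_le_imp_le)
qed

text \<open>Dominated convergence for series: on bounded sequences strong convergence to zero
  implies ultrastrong convergence, with C^2 times the squared coordinate norms as the summable
  majorant.\<close>

lemma amp_strong_null:
  fixes f :: "'h::complex_hilbert_space ell2"
  assumes bound: "\<And>k. norm (X k) \<le> C" and lim: "\<And>v. (\<lambda>k. X k \<cdot> v) \<longlonglongrightarrow> 0"
  shows "(\<lambda>k. amp (X k) f) \<longlonglongrightarrow> 0"
proof -
  have "(norm (X k \<cdot> v))\<^sup>2 \<le> C\<^sup>2 * (norm v)\<^sup>2" for k v
    by (rule order_trans[OF norm_blinfun_square mult_right_mono[OF power_mono[OF bound]]]) auto
  then have "eventually (\<lambda>(n, k). norm ((norm (coord (amp (X k) f) n))\<^sup>2) \<le> C\<^sup>2 * (norm (coord f n))\<^sup>2)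
      (at_top \<times>\<^sub>F sequentially)"
    by (intro always_eventually) auto
  moreover have "(\<lambda>k. (norm (coord (amp (X k) f) n))\<^sup>2) \<longlonglongrightarrow> 0" for n
    using tendsto_power[OF tendsto_norm[OF lim[of "coord f n"]], of 2] by simp
  ultimately have "(\<lambda>k. \<Sum>n. (norm (coord (amp (X k) f) n))\<^sup>2) \<longlonglongrightarrow> (\<Sum>n. 0)"
    using tannerys_theorem[of "\<lambda>n k. (norm (coord (amp (X k) f) n))\<^sup>2" "\<lambda>_. 0" sequentially
        "\<lambda>n. C\<^sup>2 * (norm (coord f n))\<^sup>2"] summable_mult[OF summable_coord, of "C\<^sup>2" f] by simp
  then have "(\<lambda>k. sqrt ((norm (amp (X k) f))\<^sup>2)) \<longlonglongrightarrow> sqrt 0"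
    unfolding norm_ell2_square by (intro tendsto_real_sqrt) simp
  then show ?thesis
    by (simp add: tendsto_norm_zero_iff)
qed

subsection \<open>Von Neumann algebras with a trace\<close>

locale tracial_vna =
  fixes M :: "('h::complex_hilbert_space \<Rightarrow>\<^sub>L 'h) set"
    and \<tau> :: "('h \<Rightarrow>\<^sub>L 'h) \<Rightarrow> complex"
  assumes vna: "von_neumann_algebra M"
    and trace: "faithful_normal_tracial_state M \<tau>"
begin

lemma M_clinear [simp]: "x \<in> M \<Longrightarrow> clinear_op x"
  using vna unfolding von_neumann_algebra_def commutant_def by blast

lemma M_adj [simp, intro]: "x \<in> M \<Longrightarrow> adj x \<in> M"
  using vna unfolding von_neumann_algebra_def by blast

lemma commutant_clinear: "a \<in> commutant M \<Longrightarrow> clinear_op a"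
  by (simp add: commutant_def)

lemma commutant_apply:
  assumes "a \<in> commutant M" "x \<in> M"
  shows "a \<cdot> (x \<cdot> v) = x \<cdot> (a \<cdot> v)"
proof -
  have "x o\<^sub>L a = a o\<^sub>L x"
    using assms unfolding commutant_def by blast
  then show ?thesis
    by (metis blinfun_apply_blinfun_compose)
qed

lemma commutant_adj:
  assumes "a \<in> commutant M"
  shows "adj a \<in> commutant M"
proof -
  have a: "clinear_op a"
    using assms by (rule commutant_clinear)
  have "x o\<^sub>L adj a = adj a o\<^sub>L x" if "x \<in> M" for x
  proof -
    have "adj x o\<^sub>L a = a o\<^sub>L adj x"
      using assms that unfolding commutant_def by blast
    then have "adj (adj x o\<^sub>L a) = adj (a o\<^sub>L adj x)"
      by simp
    then show ?thesis
      using that a by simp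
  qed
  then show ?thesis
    using a by (simp add: commutant_def)
qed

text \<open>The double commutant condition converts membership in M into commutation with the
  commutant. Projections, limits and resolvents are all shown to lie in M by this rule.\<close>

lemma in_M_I:
  assumes "clinear_op x"
    and "\<And>a v. a \<in> commutant M \<Longrightarrow> a \<cdot> (x \<cdot> v) = x \<cdot> (a \<cdot> v)"
  shows "x \<in> M"
proof -
  have "x \<in> commutant (commutant M)"
    using assms by (auto simp: commutant_def[of "commutant M"] intro!: blinfun_eqI)
  then show ?thesis
    using vna by (simp add: von_neumann_algebra_def)
qed

lemma M_id_zero [simp, intro]: "id_blinfun \<in> M" "0 \<in> M"
  by (rule in_M_I; simp)+

context
  fixes x y
  assumes x: "x \<in> M" and y: "y \<in> M"
begin

lemma M_add [simp, intro]: "x + y \<in> M"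
  by (rule in_M_I) (use x y in \<open>auto simp: blinfun.add_right commutant_apply[OF _ x] commutant_apply[OF _ y]\<close>)

lemma M_diff [simp, intro]: "x - y \<in> M"
  by (rule in_M_I) (use x y in \<open>auto simp: blinfun.diff_right commutant_apply[OF _ x] commutant_apply[OF _ y]\<close>)

lemma M_compose [simp, intro]: "x o\<^sub>L y \<in> M"
  by (rule in_M_I) (use x y in \<open>auto simp: commutant_apply[OF _ x] commutant_apply[OF _ y]\<close>)

end

lemma M_scale [simp, intro]: "x \<in> M \<Longrightarrow> c *\<^sub>O x \<in> M"
  by (rule in_M_I) (simp_all add: clinear_opD[OF commutant_clinear], metis commutant_apply)

lemma M_minus [simp, intro]: "x \<in> M \<Longrightarrow> - x \<in> M"
  using M_scale[of x "-1"] by simp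

lemma M_limit:
  assumes "\<And>n. X n \<in> M" "X \<longlonglongrightarrow> x"
  shows "x \<in> M"
proof (rule in_M_I)
  have lim: "(\<lambda>n. X n \<cdot> v) \<longlonglongrightarrow> x \<cdot> v" for v
    by (intro blinfun.tendsto assms tendsto_const)
  have "x \<cdot> (c *\<^sub>C v) = c *\<^sub>C x \<cdot> v" for c v
  proof (rule LIMSEQ_unique[OF lim])
    show "(\<lambda>n. X n \<cdot> (c *\<^sub>C v)) \<longlonglongrightarrow> c *\<^sub>C x \<cdot> v"
      using scaleC.tendsto[OF tendsto_const lim] assms(1) by (simp add: clinear_opD)
  qed
  then show "clinear_op x"
    by (simp add: clinear_op_def)
  fix a v assume a: "a \<in> commutant M"
  show "a \<cdot> (x \<cdot> v) = x \<cdot> (a \<cdot> v)"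
  proof (rule LIMSEQ_unique[OF _ lim])
    show "(\<lambda>n. X n \<cdot> (a \<cdot> v)) \<longlonglongrightarrow> a \<cdot> (x \<cdot> v)"
      using blinfun.tendsto[OF tendsto_const lim, of a v] commutant_apply[OF a assms(1)] by simp
  qed
qed

lemma orth_proj_in_M:
  assumes S: "csubspace S" "closed S"
    and inv: "\<And>a s. a \<in> commutant M \<Longrightarrow> s \<in> S \<Longrightarrow> a \<cdot> s \<in> S"
  shows "orth_proj S \<in> M"
proof (rule in_M_I)
  show "clinear_op (orth_proj S)"
    by (rule clinear_op_orth_proj[OF S])
  fix a v assume a: "a \<in> commutant M"
  show "a \<cdot> (orth_proj S \<cdot> v) = orth_proj S \<cdot> (a \<cdot> v)"
    by (rule orth_proj_commute[OF S commutant_clinear[OF a] inv[OF a] inv[OF commutant_adj[OF a]]])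
qed

lemma tau_add [simp]: "x \<in> M \<Longrightarrow> y \<in> M \<Longrightarrow> \<tau> (x + y) = \<tau> x + \<tau> y"
  using trace by (simp add: faithful_normal_tracial_state_def)

lemma tau_scale [simp]: "x \<in> M \<Longrightarrow> \<tau> (c *\<^sub>O x) = c * \<tau> x"
  using trace by (simp add: faithful_normal_tracial_state_def)

lemma tau_commute: "x \<in> M \<Longrightarrow> y \<in> M \<Longrightarrow> \<tau> (x o\<^sub>L y) = \<tau> (y o\<^sub>L x)"
  using trace unfolding faithful_normal_tracial_state_def by meson

lemma tau_id [simp]: "\<tau> id_blinfun = 1"
  using trace by (simp add: faithful_normal_tracial_state_def)

lemma tau_positive:
  assumes "x \<in> M" "positive_op x"
  shows "Re (\<tau> x) \<ge> 0" "Im (\<tau> x) = 0"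
proof -
  have "\<tau> x \<in> \<real>\<^sub>\<ge>\<^sub>0"
    using trace assms by (simp add: faithful_normal_tracial_state_def)
  then show "Re (\<tau> x) \<ge> 0" "Im (\<tau> x) = 0"
    by (simp_all add: complex_nonneg_Reals_iff)
qed

lemma tau_faithful: "x \<in> M \<Longrightarrow> positive_op x \<Longrightarrow> \<tau> x = 0 \<Longrightarrow> x = 0"
  using trace by (simp add: faithful_normal_tracial_state_def)

lemma tau_minus [simp]: "x \<in> M \<Longrightarrow> \<tau> (- x) = - \<tau> x"
  using tau_scale[of x "-1"] by simp

lemma tau_diff [simp]: "x \<in> M \<Longrightarrow> y \<in> M \<Longrightarrow> \<tau> (x - y) = \<tau> x - \<tau> y"
  using tau_add[of x "-y"] by simp

lemma tau_zero [simp]: "\<tau> 0 = 0"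
  using tau_scale[of 0 0] by simp

lemma tau_mono:
  assumes "x \<in> M" "y \<in> M" "\<And>v. Re (cinner (x \<cdot> v) v) \<le> Re (cinner (y \<cdot> v) v)"
    "\<And>v. Im (cinner (x \<cdot> v) v) = Im (cinner (y \<cdot> v) v)"
  shows "Re (\<tau> x) \<le> Re (\<tau> y)"
proof -
  have "positive_op (y - x)"
    using assms(3,4) by (simp add: positive_op_iff cinner_diff_left)
  then show ?thesis
    using tau_positive(1)[of "y - x"] assms(1,2) by simp
qed

section \<open>The trace norm on M\<close>

definition n2 :: "('h \<Rightarrow>\<^sub>L 'h) \<Rightarrow> real" where
  "n2 x = sqrt (Re (\<tau> (adj x o\<^sub>L x)))"

lemma tau_adj_self: "x \<in> M \<Longrightarrow> \<tau> (adj x o\<^sub>L x) = of_real ((n2 x)\<^sup>2)"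
  using tau_positive[of "adj x o\<^sub>L x"] positive_op_adj_self[of x]
  by (simp add: n2_def complex_eq_iff)

lemma n2_nonneg [simp]: "x \<in> M \<Longrightarrow> n2 x \<ge> 0"
  using tau_positive[of "adj x o\<^sub>L x"] positive_op_adj_self[of x] by (simp add: n2_def)

lemma n2_eq_0:
  assumes "x \<in> M" "n2 x = 0"
  shows "x = 0"
proof -
  have "\<tau> (adj x o\<^sub>L x) = 0"
    using tau_adj_self[OF assms(1)] assms(2) by simp
  then have 0: "adj x o\<^sub>L x = 0"
    using assms(1) by (intro tau_faithful positive_op_adj_self) auto
  show ?thesis
  proof (rule blinfun_eqI)
    fix v
    have "cinner (x \<cdot> v) (x \<cdot> v) = cinner ((adj x o\<^sub>L x) \<cdot> v) v"
      using assms(1) by (simp add: cinner_adj')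
    then show "x \<cdot> v = 0 \<cdot> v"
      unfolding 0 by simp
  qed
qed

text \<open>The trace is only assumed to be positive on positive elements. Its value at
  \<open>adj (1 + c x) (1 + c x)\<close> is real for every c, and the choices c = 1 and c = \<i>
  determine real and imaginary part of \<tau> (adj x).\<close>

lemma tau_adj:
  assumes "x \<in> M"
  shows "\<tau> (adj x) = cnj (\<tau> x)"
proof -
  have *: "\<tau> (adj (id_blinfun + c *\<^sub>O x) o\<^sub>L (id_blinfun + c *\<^sub>O x))
      = 1 + of_real ((cmod c)\<^sup>2 * (n2 x)\<^sup>2) + (c * \<tau> x + cnj c * \<tau> (adj x))" for c
    using assms by (simp add: blinfun_compose_distrib tau_adj_self complex_mult_cnj_cmod2 mult_ac)
  have "Im (c * \<tau> x + cnj c * \<tau> (adj x)) = 0" for c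
  proof -
    have "Im (1 + of_real ((cmod c)\<^sup>2 * (n2 x)\<^sup>2) + (c * \<tau> x + cnj c * \<tau> (adj x))) = 0"
      unfolding *[symmetric] using tau_adj_self[of "id_blinfun + c *\<^sub>O x"] assms by (simp del: of_real_power)
    then show ?thesis
      by (simp del: of_real_power of_real_mult)
  qed
  from this[of 1] this[of \<i>] show ?thesis
    by (simp add: complex_eq_iff)
qed

lemma tau_adj_compose_commute:
  "x \<in> M \<Longrightarrow> y \<in> M \<Longrightarrow> \<tau> (adj y o\<^sub>L x) = cnj (\<tau> (adj x o\<^sub>L y))"
  using tau_adj[of "adj x o\<^sub>L y"] by simp

lemma n2_add_scale:
  assumes "x \<in> M" "y \<in> M"
  shows "(n2 (x + c *\<^sub>O y))\<^sup>2 = (n2 x)\<^sup>2 + (cmod c)\<^sup>2 * (n2 y)\<^sup>2 + 2 * Re (c * \<tau> (adj x o\<^sub>L y))"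
proof -
  have "complex_of_real ((n2 (x + c *\<^sub>O y))\<^sup>2) = of_real ((n2 x)\<^sup>2) + of_real ((cmod c)\<^sup>2 * (n2 y)\<^sup>2)
      + (c * \<tau> (adj x o\<^sub>L y) + cnj (c * \<tau> (adj x o\<^sub>L y)))"
    using assms tau_adj_compose_commute[of x y] unfolding tau_adj_self[of "x + c *\<^sub>O y", symmetric]
    by (subst tau_adj_self[of "x + c *\<^sub>O y", symmetric])
      (simp_all add: blinfun_compose_distrib tau_adj_self complex_mult_cnj_cmod2 mult_ac)
  then have "Re (complex_of_real ((n2 (x + c *\<^sub>O y))\<^sup>2)) = Re (of_real ((n2 x)\<^sup>2) + of_real ((cmod c)\<^sup>2 * (n2 y)\<^sup>2)
      + (c * \<tau> (adj x o\<^sub>L y) + cnj (c * \<tau> (adj x o\<^sub>L y))))"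
    by simp
  then show ?thesis
    by simp
qed

lemma tau_Cauchy_Schwarz:
  assumes "x \<in> M" "y \<in> M"
  shows "cmod (\<tau> (adj x o\<^sub>L y)) \<le> n2 x * n2 y"
proof (cases "n2 y = 0")
  case True
  then show ?thesis
    using n2_eq_0[OF assms(2)] by simp
next
  case False
  define t where "t = \<tau> (adj x o\<^sub>L y)"
  define r where "r = (n2 y)\<^sup>2"
  have r: "r > 0"
    using False by (simp add: r_def)
  \<comment> \<open>This c minimises n2 (x + c y), as in the Hilbert space proof.\<close>
  define c where "c = - cnj t / of_real r"
  have "(cmod c)\<^sup>2 * r = (cmod t)\<^sup>2 / r"
    using r by (simp add: c_def norm_divide power_divide) (simp add: power2_eq_square)
  moreover have "Re (c * t) = - (cmod t)\<^sup>2 / r"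
  proof -
    have "c * t = of_real (- (cmod t)\<^sup>2 / r)"
      by (simp add: c_def complex_mult_cnj_cmod2)
    then show ?thesis
      by simp
  qed
  ultimately have "(n2 (x + c *\<^sub>O y))\<^sup>2 = (n2 x)\<^sup>2 - (cmod t)\<^sup>2 / r"
    unfolding n2_add_scale[OF assms] t_def[symmetric] r_def[symmetric] by simp
  then have "(cmod t)\<^sup>2 / r \<le> (n2 x)\<^sup>2"
    using zero_le_power2[of "n2 (x + c *\<^sub>O y)"] by linarith
  then have "(cmod t)\<^sup>2 \<le> (n2 x * n2 y)\<^sup>2"
    using r by (simp add: divide_le_eq power_mult_distrib r_def)
  then show ?thesis
    unfolding t_def by (rule power2_le_imp_le) (use assms in simp)
qed

lemma n2_triangle:
  assumes "x \<in> M" "y \<in> M"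
  shows "n2 (x + y) \<le> n2 x + n2 y"
proof -
  have "Re (\<tau> (adj x o\<^sub>L y)) \<le> n2 x * n2 y"
    using tau_Cauchy_Schwarz[OF assms] complex_Re_le_cmod order_trans by blast
  then have "(n2 (x + y))\<^sup>2 \<le> (n2 x + n2 y)\<^sup>2"
    using n2_add_scale[OF assms, of 1] by (simp add: power2_sum)
  then show ?thesis
    by (rule power2_le_imp_le) (use assms in simp)
qed

lemma n2_zero [simp]: "n2 0 = 0"
  by (simp add: n2_def)

lemma n2_scale [simp]: "x \<in> M \<Longrightarrow> n2 (c *\<^sub>O x) = cmod c * n2 x"
  using n2_add_scale[of 0 x c] power2_eq_iff_nonneg[of "n2 (c *\<^sub>O x)" "cmod c * n2 x"]
  by (simp add: power_mult_distrib)

lemma n2_minus [simp]: "x \<in> M \<Longrightarrow> n2 (- x) = n2 x"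
  using n2_scale[of x "-1"] by simp

lemma n2_minus_commute: "x \<in> M \<Longrightarrow> y \<in> M \<Longrightarrow> n2 (x - y) = n2 (y - x)"
  using n2_minus[of "x - y"] by simp

lemma n2_triangle_diff: "x \<in> M \<Longrightarrow> y \<in> M \<Longrightarrow> z \<in> M \<Longrightarrow> n2 (x - z) \<le> n2 (x - y) + n2 (y - z)"
  using n2_triangle[of "x - y" "y - z"] by simp

lemma n2_reverse_triangle:
  assumes "x \<in> M" "y \<in> M"
  shows "\<bar>n2 x - n2 y\<bar> \<le> n2 (x - y)"
  using n2_triangle[of "x - y" y] n2_triangle[of "y - x" x] n2_minus_commute[OF assms] assms by simp

lemma n2_adj [simp]: "x \<in> M \<Longrightarrow> n2 (adj x) = n2 x"
  by (simp add: n2_def tau_commute[of x "adj x"])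

lemma n2_compose_left:
  assumes "x \<in> M" "y \<in> M"
  shows "n2 (x o\<^sub>L y) \<le> norm x * n2 y"
proof -
  have "Re (\<tau> (adj (x o\<^sub>L y) o\<^sub>L (x o\<^sub>L y))) \<le> Re (\<tau> (of_real ((norm x)\<^sup>2) *\<^sub>O (adj y o\<^sub>L y)))"
    by (rule tau_mono)
      (use assms norm_blinfun_square in \<open>auto simp: cinner_adj' cinner_lin cinner_self\<close>)
  then have "(n2 (x o\<^sub>L y))\<^sup>2 \<le> (norm x * n2 y)\<^sup>2"
    using tau_adj_self[of "x o\<^sub>L y"] tau_adj_self[of y] assms
    by (simp add: power_mult_distrib)
  then show ?thesis
    by (rule power2_le_imp_le) (use assms in simp)
qed

text \<open>Traciality makes \<open>adj\<close> isometric for \<open>n2\<close>, which transfers the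
  bound from left to right multiplication. This is the form behind \<open>BV_M\<close> and
  \<open>Cauchy2_compose_right\<close>.\<close>

lemma n2_compose_right:
  assumes "x \<in> M" "y \<in> M"
  shows "n2 (x o\<^sub>L y) \<le> norm y * n2 x"
  using n2_compose_left[of "adj y" "adj x"] n2_adj[of "x o\<^sub>L y"] assms by (simp add: norm_adj)

lemma n2_id [simp]: "n2 id_blinfun = 1"
  by (simp add: n2_def)

lemma cmod_tau_le: "x \<in> M \<Longrightarrow> cmod (\<tau> x) \<le> n2 x"
  using tau_Cauchy_Schwarz[of id_blinfun x] by simp

end

text \<open>Products \<open>adj x o\<^sub>L x\<close> are used because their pairing with \<xi> and
  \<eta> is that of \<open>amp x \<xi>\<close> with \<open>amp x \<eta>\<close>, so one seminorm of
  x controls both factors. The proof follows the generation of the topology from its subbasis;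
  finite intersections are handled by \<open>merge_ell2\<close>.\<close>

lemma ultraweak_nhd_zero:
  fixes W :: "('h::complex_hilbert_space \<Rightarrow>\<^sub>L 'h) set"
  assumes "openin ultraweak_topology W" "0 \<in> W"
  obtains \<zeta> where "\<And>x. clinear_op x \<Longrightarrow> norm (amp x \<zeta>) < 1 \<Longrightarrow> adj x o\<^sub>L x \<in> W"
proof -
  define S where "S = {{x :: 'h \<Rightarrow>\<^sub>L 'h. (\<Sum>n. cinner (x \<cdot> (\<xi> n)) (\<eta> n)) \<in> U} | (\<xi> :: nat \<Rightarrow> 'h) \<eta> U.
        summable (\<lambda>n. (norm (\<xi> n))\<^sup>2) \<and> summable (\<lambda>n. (norm (\<eta> n))\<^sup>2) \<and> open U}"
  have "generate_topology_on S W"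
    using assms(1) by (simp add: ultraweak_topology_def openin_topology_generated_by_iff S_def)
  then have "0 \<in> W \<longrightarrow> (\<exists>\<zeta>. \<forall>x. clinear_op x \<longrightarrow> norm (amp x \<zeta>) < 1 \<longrightarrow> adj x o\<^sub>L x \<in> W)"
  proof (induction rule: generate_topology_on.induct)
    case Empty
    then show ?case
      by simp
  next
    case (Int a b)
    show ?case
    proof
      assume "0 \<in> a \<inter> b"
      then obtain \<xi> \<eta> where
        "\<forall>x. clinear_op x \<longrightarrow> norm (amp x \<xi>) < 1 \<longrightarrow> adj x o\<^sub>L x \<in> a"
        "\<forall>x. clinear_op x \<longrightarrow> norm (amp x \<eta>) < 1 \<longrightarrow> adj x o\<^sub>L x \<in> b"
        using Int by blast
      moreover obtain \<zeta> where "\<And>x. norm (amp x \<xi>) \<le> norm (amp x \<zeta>)" "\<And>x. norm (amp x \<eta>) \<le> norm (amp x \<zeta>)"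
        using merge_ell2[of \<xi> \<eta>] by blast
      ultimately have "\<forall>x. clinear_op x \<longrightarrow> norm (amp x \<zeta>) < 1 \<longrightarrow> adj x o\<^sub>L x \<in> a \<inter> b"
        by (meson IntI le_less_trans)
      then show "\<exists>\<zeta>. \<forall>x. clinear_op x \<longrightarrow> norm (amp x \<zeta>) < 1 \<longrightarrow> adj x o\<^sub>L x \<in> a \<inter> b"
        by blast
    qed
  next
    case (UN K)
    then show ?case
      by (meson UnionE UnionI)
  next
    case (Basis s)
    then obtain \<xi> \<eta> U where s: "s = {x. (\<Sum>n. cinner (x \<cdot> (\<xi> n)) (\<eta> n)) \<in> U}"
      and sum: "summable (\<lambda>n. (norm (\<xi> n))\<^sup>2)" "summable (\<lambda>n. (norm (\<eta> n))\<^sup>2)" and U: "open U"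
      by (auto simp: S_def)
    show ?case
    proof
      assume "0 \<in> s"
      then have "0 \<in> U"
        by (simp add: s)
      then obtain e where e: "e > 0" "\<And>z. cmod z < e \<Longrightarrow> z \<in> U"
        using U by (auto simp: open_contains_ball subset_iff)
      obtain h where h: "\<And>x. norm (amp x (Ell2 \<xi>)) \<le> norm (amp x h)" "\<And>x. norm (amp x (Ell2 \<eta>)) \<le> norm (amp x h)"
        using merge_ell2[of "Ell2 \<xi>" "Ell2 \<eta>"] by blast
      \<comment> \<open>With this scaling \<open>norm (amp x \<zeta>) < 1\<close> says that the
        squared norm of \<open>amp x h\<close> is below e, the radius available in U.\<close>
      define \<zeta> where "\<zeta> = of_real (1 / sqrt e) *\<^sub>C h"
      have "adj x o\<^sub>L x \<in> s" if x: "clinear_op x" "norm (amp x \<zeta>) < 1" for x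
      proof -
        have "norm (amp x h) < sqrt e"
          using x e(1) by (simp add: \<zeta>_def amp_scaleC norm_scaleC norm_divide divide_less_eq)
        have "cmod (\<Sum>n. cinner ((adj x o\<^sub>L x) \<cdot> (\<xi> n)) (\<eta> n)) = cmod (cinner (amp x (Ell2 \<xi>)) (amp x (Ell2 \<eta>)))"
          using x(1) by (simp add: cinner_ell2_def coord_Ell2 sum cinner_adj')
        also have "\<dots> \<le> norm (amp x (Ell2 \<xi>)) * norm (amp x (Ell2 \<eta>))"
          by (rule cinner_norm_le)
        also have "\<dots> \<le> norm (amp x h) * norm (amp x h)"
          by (intro mult_mono h) auto
        also have "\<dots> < sqrt e * sqrt e"
          using \<open>norm (amp x h) < sqrt e\<close> by (intro mult_strict_mono) (use e in auto)
        finally show ?thesis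
          using e by (simp add: s)
      qed
      then show "\<exists>\<zeta>. \<forall>x. clinear_op x \<longrightarrow> norm (amp x \<zeta>) < 1 \<longrightarrow> adj x o\<^sub>L x \<in> s"
        by blast
    qed
  qed
  then show thesis
    using that assms(2) by blast
qed

lemma openin_ultraweak_cinner_amp:
  "open U \<Longrightarrow> openin ultraweak_topology {x. cinner (amp x \<xi>) \<eta> \<in> U}"
  unfolding ultraweak_topology_def
proof (rule topology_generated_by_Basis, rule CollectI, intro exI conjI)
  show "{x. cinner (amp x \<xi>) \<eta> \<in> U} = {x. (\<Sum>n. cinner (x \<cdot> (coord \<xi> n)) (coord \<eta> n)) \<in> U}"
    by (simp add: cinner_ell2_def)
qed (auto simp: summable_coord)

lemma topspace_ultraweak: "topspace ultraweak_topology = UNIV"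
  using openin_subset[OF openin_ultraweak_cinner_amp[OF open_UNIV]] by auto

section \<open>Vectors implementing the normal trace\<close>

context tracial_vna
begin

text \<open>Weak-star continuity of \<tau> at 0 gives a vector for which norm below 1 implies
  \<open>n2\<close> below 1. Homogeneity, applied with a number r strictly between two norms in the
  wrong order, turns this into an inequality.\<close>

lemma dominating_vector: "\<exists>\<zeta>. \<forall>x\<in>M. n2 x \<le> norm (amp x \<zeta>)"
proof -
  have "continuous_map (weak_star M) euclidean \<tau>"
    using trace by (simp add: faithful_normal_tracial_state_def)
  then have "openin (weak_star M) {x \<in> topspace (weak_star M). \<tau> x \<in> ball 0 1}"
    by (rule openin_continuous_map_preimage) simp
  then obtain W where W: "openin ultraweak_topology W" "{x \<in> topspace (weak_star M). \<tau> x \<in> ball 0 1} = W \<inter> M"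
    by (auto simp: openin_subtopology)
  have "0 \<in> {x \<in> topspace (weak_star M). \<tau> x \<in> ball 0 1}"
    by (simp add: topspace_ultraweak)
  then have "0 \<in> W"
    unfolding W(2) by (rule IntD1)
  then obtain \<zeta> where \<zeta>: "\<And>x. clinear_op x \<Longrightarrow> norm (amp x \<zeta>) < 1 \<Longrightarrow> adj x o\<^sub>L x \<in> W"
    using ultraweak_nhd_zero[OF W(1)] by blast
  have small: "n2 x < 1" if x: "x \<in> M" "norm (amp x \<zeta>) < 1" for x
  proof -
    have "adj x o\<^sub>L x \<in> W \<inter> M"
      using x \<zeta> by simp
    then have "cmod (\<tau> (adj x o\<^sub>L x)) < 1"
      unfolding W(2)[symmetric] by simp
    then have "(n2 x)\<^sup>2 < 1\<^sup>2"
      using x by (simp add: tau_adj_self norm_power)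
    then show ?thesis
      by (rule power2_less_imp_less) simp
  qed
  have "n2 x \<le> norm (amp x \<zeta>)" if x: "x \<in> M" for x
  proof (rule ccontr)
    assume "\<not> ?thesis"
    then obtain r where r: "norm (amp x \<zeta>) < r" "r < n2 x"
      using dense not_le by blast
    have r0: "r > 0"
      using r(1) norm_ge_zero[of "amp x \<zeta>"] by linarith
    have "n2 (of_real (1 / r) *\<^sub>O x) < 1"
      using x r r0 by (intro small) (auto simp: norm_scaleC norm_divide divide_less_eq)
    then show False
      using x r r0 by (simp add: norm_divide divide_less_eq)
  qed
  then show ?thesis
    by blast
qed

definition \<zeta> :: "'h ell2" where "\<zeta> = (SOME \<zeta>. \<forall>x\<in>M. n2 x \<le> norm (amp x \<zeta>))"

lemma n2_le_amp: "x \<in> M \<Longrightarrow> n2 x \<le> norm (amp x \<zeta>)"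
  using someI_ex[OF dominating_vector] unfolding \<zeta>_def by blast

text \<open>\<open>\<zeta>\<close> is separating for M, so prescribing a functional on the vectors
  \<open>amp x \<zeta>\<close> by its value in x is legitimate.\<close>

lemma amp_zeta_inj:
  assumes "x \<in> M" "y \<in> M" "amp x \<zeta> = amp y \<zeta>"
  shows "x = y"
proof -
  have "n2 (x - y) = 0"
    using n2_le_amp[of "x - y"] assms by (intro antisym) simp_all
  then show ?thesis
    using n2_eq_0[of "x - y"] assms by simp
qed

lemma csubspace_amp_zeta:
  assumes "0 \<in> K" "\<And>x y. x \<in> K \<Longrightarrow> y \<in> K \<Longrightarrow> x + y \<in> K" "\<And>c x. x \<in> K \<Longrightarrow> c *\<^sub>O x \<in> K"
  shows "csubspace ((\<lambda>x. amp x \<zeta>) ` K)"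
  unfolding csubspace_def
proof (intro conjI ballI allI)
  show "0 \<in> (\<lambda>x. amp x \<zeta>) ` K"
    using imageI[OF assms(1), of "\<lambda>x. amp x \<zeta>"] by simp
next
  fix s t assume "s \<in> (\<lambda>x. amp x \<zeta>) ` K" "t \<in> (\<lambda>x. amp x \<zeta>) ` K"
  then obtain x y where xy: "x \<in> K" "y \<in> K" "s = amp x \<zeta>" "t = amp y \<zeta>"
    by (elim imageE)
  have "s + t = amp (x + y) \<zeta>"
    by (simp add: xy)
  then show "s + t \<in> (\<lambda>x. amp x \<zeta>) ` K"
    using assms(2)[OF xy(1,2)] by (rule image_eqI)
next
  fix c s assume "s \<in> (\<lambda>x. amp x \<zeta>) ` K"
  then obtain x where x: "x \<in> K" "s = amp x \<zeta>"
    by (elim imageE)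
  have "c *\<^sub>C s = amp (c *\<^sub>O x) \<zeta>"
    by (simp add: x)
  then show "c *\<^sub>C s \<in> (\<lambda>x. amp x \<zeta>) ` K"
    using assms(3)[OF x(1)] by (rule image_eqI)
qed

text \<open>\<beta> represents the functional \<open>amp x \<zeta>\<close> \<mapsto> \<tau> x, a
  contraction since |\<tau> x| \<le> n2 x. Then
  \<open>cinner (amp x \<zeta>) (amp y \<beta>)\<close> is \<tau> of
  \<open>adj y o\<^sub>L x\<close>, and Cauchy-Schwarz for the trace bounds it by n2 y times the
  norm of \<open>amp x \<zeta>\<close>.\<close>

lemma bounded_vector_exists:
  "\<exists>\<beta>. (\<forall>x\<in>M. \<tau> x = cinner (amp x \<zeta>) \<beta>) \<and> (\<forall>x\<in>M. norm (amp x \<beta>) \<le> n2 x)"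
proof -
  let ?S = "(\<lambda>x. amp x \<zeta>) ` M"
  have inj: "inj_on (\<lambda>x. amp x \<zeta>) M"
    using amp_zeta_inj by (auto simp: inj_on_def)
  define f where "f s = \<tau> (the_inv_into M (\<lambda>x. amp x \<zeta>) s)" for s
  have f: "f (amp x \<zeta>) = \<tau> x" if "x \<in> M" for x
    by (simp add: f_def the_inv_into_f_f[OF inj that])
  have S: "csubspace ?S"
    by (rule csubspace_amp_zeta) auto
  obtain \<beta> where \<beta>: "\<beta> \<in> closure ?S" "\<And>s. s \<in> ?S \<Longrightarrow> f s = cinner s \<beta>"
  proof (rule riesz[OF S, of f 1])
    fix s t assume "s \<in> ?S" "t \<in> ?S"
    then obtain x y where xy: "x \<in> M" "y \<in> M" "s = amp x \<zeta>" "t = amp y \<zeta>"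
      by (elim imageE)
    have "s + t = amp (x + y) \<zeta>"
      by (simp add: xy)
    then show "f (s + t) = f s + f t"
      using f[of x] f[of y] f[of "x + y"] xy by simp
  next
    fix c s assume "s \<in> ?S"
    then obtain x where x: "x \<in> M" "s = amp x \<zeta>"
      by (elim imageE)
    have "c *\<^sub>C s = amp (c *\<^sub>O x) \<zeta>"
      by (simp add: x)
    then show "f (c *\<^sub>C s) = c * f s"
      using f[of x] f[of "c *\<^sub>O x"] x by simp
  next
    fix s assume "s \<in> ?S"
    then obtain x where x: "x \<in> M" "s = amp x \<zeta>"
      by (elim imageE)
    then show "cmod (f s) \<le> 1 * norm s"
      using f[of x] cmod_tau_le[of x] n2_le_amp[of x] by simp
  qed blast
  have tau: "\<tau> x = cinner (amp x \<zeta>) \<beta>" if "x \<in> M" for x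
    using \<beta>(2)[OF imageI[OF that]] f[OF that] by simp
  have "norm (amp y \<beta>) \<le> n2 y" if y: "y \<in> M" for y
  proof -
    have le: "cmod (cinner s (amp y \<beta>)) \<le> norm s * n2 y" if "s \<in> closure ?S" for s
    proof -
      have "closed {s. cmod (cinner s (amp y \<beta>)) \<le> norm s * n2 y}"
        by (intro closed_Collect_le continuous_intros cinner.continuous_on)
      moreover have "?S \<subseteq> {s. cmod (cinner s (amp y \<beta>)) \<le> norm s * n2 y}"
      proof safe
        fix x assume x: "x \<in> M"
        have "cinner (amp x \<zeta>) (amp y \<beta>) = \<tau> (adj y o\<^sub>L x)"
          using x y tau[of "adj y o\<^sub>L x"] by (simp add: cinner_amp_adj')
        then have "cmod (cinner (amp x \<zeta>) (amp y \<beta>)) \<le> n2 y * n2 x"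
          using tau_Cauchy_Schwarz[OF y x] by simp
        also have "\<dots> \<le> n2 y * norm (amp x \<zeta>)"
          using n2_le_amp[OF x] y by (intro mult_left_mono) auto
        finally show "cmod (cinner (amp x \<zeta>) (amp y \<beta>)) \<le> norm (amp x \<zeta>) * n2 y"
          by (simp add: mult.commute)
      qed
      ultimately show ?thesis
        using closure_minimal that by blast
    qed
    \<comment> \<open>Riesz places \<beta> in the closure of the M-invariant space ?S; hence
      \<open>amp y \<beta>\<close> may be inserted for s in \<open>le\<close>, which gives its
      norm.\<close>
    have "amp y \<beta> \<in> closure ?S"
    proof -
      have "amp y ` closure ?S \<subseteq> closure ?S"
      proof (rule image_closure_subset)
        show "continuous_on (closure ?S) (amp y)"
          by (rule linear_continuous_on[OF bounded_linear_amp])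
        have "amp y ` ?S \<subseteq> ?S"
          using y by (auto simp flip: amp_simps)
        then show "amp y ` ?S \<subseteq> closure ?S"
          using closure_subset by blast
      qed simp
      then show ?thesis
        using \<beta>(1) by blast
    qed
    from le[OF this] have "norm (amp y \<beta>) * norm (amp y \<beta>) \<le> norm (amp y \<beta>) * n2 y"
      by (simp add: cinner_self norm_power power2_eq_square norm_mult)
    then show ?thesis
      using y by (cases "amp y \<beta> = 0") auto
  qed
  then show ?thesis
    using tau by blast
qed

definition \<beta> :: "'h ell2" where
  "\<beta> = (SOME \<beta>. (\<forall>x\<in>M. \<tau> x = cinner (amp x \<zeta>) \<beta>) \<and> (\<forall>x\<in>M. norm (amp x \<beta>) \<le> n2 x))"

lemma tau_eq_cinner: "x \<in> M \<Longrightarrow> \<tau> x = cinner (amp x \<zeta>) \<beta>"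
  and amp_beta_le: "x \<in> M \<Longrightarrow> norm (amp x \<beta>) \<le> n2 x"
  using someI_ex[OF bounded_vector_exists] unfolding \<beta>_def[symmetric] by blast+

text \<open>The vectors on which convergence in the trace norm implies pointwise convergence.\<close>

definition BV :: "'h set" where
  "BV = {v. \<exists>C. \<forall>x\<in>M. norm (x \<cdot> v) \<le> C * n2 x}"

lemma BV_E:
  assumes "v \<in> BV"
  obtains C where "C \<ge> 0" "\<And>x. x \<in> M \<Longrightarrow> norm (x \<cdot> v) \<le> C * n2 x"
proof -
  obtain C where C: "\<And>x. x \<in> M \<Longrightarrow> norm (x \<cdot> v) \<le> C * n2 x"
    using assms by (auto simp: BV_def)
  have "norm (x \<cdot> v) \<le> \<bar>C\<bar> * n2 x" if "x \<in> M" for x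
    using C[OF that] mult_right_mono[OF abs_ge_self n2_nonneg[OF that], of C] by linarith
  then show thesis
    using that[of "\<bar>C\<bar>"] by simp
qed

lemma BV_beta: "coord \<beta> n \<in> BV"
proof -
  have "norm (x \<cdot> coord \<beta> n) \<le> 1 * n2 x" if "x \<in> M" for x
    using norm_coord_le[of "amp x \<beta>" n] amp_beta_le[OF that] by simp
  then show ?thesis
    unfolding BV_def by blast
qed

lemma csubspace_BV: "csubspace BV"
  unfolding csubspace_def
proof (intro conjI ballI allI)
  show "0 \<in> BV"
    by (auto simp: BV_def intro: exI[of _ 0])
next
  fix v w assume "v \<in> BV" "w \<in> BV"
  then obtain C D where *: "\<And>x. x \<in> M \<Longrightarrow> norm (x \<cdot> v) \<le> C * n2 x"
    "\<And>x. x \<in> M \<Longrightarrow> norm (x \<cdot> w) \<le> D * n2 x"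
    by (metis BV_E)
  have "norm (x \<cdot> (v + w)) \<le> (C + D) * n2 x" if "x \<in> M" for x
    using norm_triangle_ineq[of "x \<cdot> v" "x \<cdot> w"] *[OF that]
    by (simp add: blinfun.add_right distrib_right)
  then show "v + w \<in> BV"
    unfolding BV_def by blast
next
  fix c v assume "v \<in> BV"
  then obtain C where *: "\<And>x. x \<in> M \<Longrightarrow> norm (x \<cdot> v) \<le> C * n2 x"
    by (metis BV_E)
  have "norm (x \<cdot> (c *\<^sub>C v)) \<le> (cmod c * C) * n2 x" if "x \<in> M" for x
    using mult_left_mono[OF *[OF that] norm_ge_zero, of c] that by (simp add: clinear_opD norm_scaleC)
  then show "c *\<^sub>C v \<in> BV"
    unfolding BV_def by blast
qed

lemma BV_commutant:
  assumes "a \<in> commutant M" "v \<in> BV"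
  shows "a \<cdot> v \<in> BV"
proof -
  obtain C where C: "\<And>x. x \<in> M \<Longrightarrow> norm (x \<cdot> v) \<le> C * n2 x"
    using assms(2) by (metis BV_E)
  have "norm (x \<cdot> (a \<cdot> v)) \<le> (norm a * C) * n2 x" if "x \<in> M" for x
    using order_trans[OF norm_blinfun[of a "x \<cdot> v"] mult_left_mono[OF C[OF that] norm_ge_zero]]
    by (simp add: commutant_apply[OF assms(1) that, symmetric] mult.assoc)
  then show ?thesis
    unfolding BV_def by blast
qed

lemma BV_M:
  assumes "y \<in> M" "v \<in> BV"
  shows "y \<cdot> v \<in> BV"
proof -
  obtain C where C: "C \<ge> 0" "\<And>x. x \<in> M \<Longrightarrow> norm (x \<cdot> v) \<le> C * n2 x"
    using assms(2) by (metis BV_E)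
  have "norm (x \<cdot> (y \<cdot> v)) \<le> (C * norm y) * n2 x" if "x \<in> M" for x
    using order_trans[OF C(2)[of "x o\<^sub>L y"] mult_left_mono[OF n2_compose_right[OF that assms(1)] C(1)]] that assms
    by (simp add: mult.assoc)
  then show ?thesis
    unfolding BV_def by blast
qed

text \<open>The projection p onto the closure of \<open>BV\<close> lies in M, by invariance under
  the commutant. Since 1 - p kills all coordinates of \<beta>, the trace of 1 - p vanishes, and
  faithfulness gives p = 1.\<close>

lemma closure_BV: "closure BV = UNIV"
proof -
  let ?S = "closure BV"
  have S: "csubspace ?S" "closed ?S"
    by (simp_all add: csubspace_closure csubspace_BV)
  define p where "p = orth_proj ?S"
  have p: "p \<in> M"
    unfolding p_def
  proof (rule orth_proj_in_M[OF S])
    fix a s assume a: "a \<in> commutant M" and s: "s \<in> ?S"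
    show "a \<cdot> s \<in> ?S"
      by (rule blinfun_apply_closure_invariant[OF _ s])
        (rule closure_subset[THEN subsetD, OF BV_commutant[OF a]])
  qed
  have q: "adj (id_blinfun - p) = id_blinfun - p" "(id_blinfun - p) o\<^sub>L (id_blinfun - p) = id_blinfun - p"
    using p adj_orth_proj[OF S] orth_proj_idem[OF S]
    by (simp_all add: p_def blinfun_compose_distrib)
  have "amp (id_blinfun - p) \<beta> = 0"
    by (rule ell2_eqI) (simp add: p_def orth_proj_ident[OF S closure_subset[THEN subsetD]] BV_beta)
  moreover have "\<tau> (id_blinfun - p) = cinner \<zeta> (amp (id_blinfun - p) \<beta>)"
    using tau_eq_cinner[of "id_blinfun - p"] cinner_amp_adj[of "id_blinfun - p" \<zeta> \<beta>] p q by simp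
  ultimately have "\<tau> (adj (id_blinfun - p) o\<^sub>L (id_blinfun - p)) = 0"
    by (simp only: q cinner_zero)
  then have "n2 (id_blinfun - p) = 0"
    using p by (simp only: tau_adj_self M_id_zero M_diff) simp
  then have "id_blinfun - p = 0"
    using p by (intro n2_eq_0) auto
  then have "v = p \<cdot> v" for v
    by (metis blinfun_apply_id_blinfun id_apply right_minus_eq)
  then show ?thesis
    using orth_proj_in[OF S] unfolding p_def by (metis UNIV_eq_I)
qed

section \<open>Cauchy sequences for the trace norm\<close>

definition Cauchy2 :: "(nat \<Rightarrow> 'h \<Rightarrow>\<^sub>L 'h) \<Rightarrow> bool" where
  "Cauchy2 X \<longleftrightarrow> (\<forall>k. X k \<in> M) \<and> (\<forall>e>0. \<exists>N. \<forall>j\<ge>N. \<forall>k\<ge>N. n2 (X j - X k) < e)"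

lemma Cauchy2_M [simp]: "Cauchy2 X \<Longrightarrow> X k \<in> M"
  by (simp add: Cauchy2_def)

lemma Cauchy2_D:
  assumes "Cauchy2 X" "e > 0"
  obtains N where "\<And>j k. j \<ge> N \<Longrightarrow> k \<ge> N \<Longrightarrow> n2 (X j - X k) < e"
  using assms unfolding Cauchy2_def by blast

lemma Cauchy2_dominated:
  assumes "Cauchy2 X" "\<And>k. Y k \<in> M" "\<And>j k. n2 (Y j - Y k) \<le> C * n2 (X j - X k)"
  shows "Cauchy2 Y"
  unfolding Cauchy2_def
proof (intro conjI allI impI)
  fix e :: real assume e: "e > 0"
  obtain N where N: "\<And>j k. j \<ge> N \<Longrightarrow> k \<ge> N \<Longrightarrow> n2 (X j - X k) < e / (\<bar>C\<bar> + 1)"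
    using Cauchy2_D[OF assms(1), of "e / (\<bar>C\<bar> + 1)"] e by auto
  have "n2 (Y j - Y k) < e" if "j \<ge> N" "k \<ge> N" for j k
  proof -
    have n: "0 \<le> n2 (X j - X k)"
      using assms(1) by simp
    have "n2 (Y j - Y k) \<le> C * n2 (X j - X k)"
      by (rule assms(3))
    also have "\<dots> \<le> (\<bar>C\<bar> + 1) * n2 (X j - X k)"
      using n by (intro mult_right_mono) auto
    also have "\<dots> < e"
      using N[OF that] by (simp add: pos_less_divide_eq[OF add_nonneg_pos[OF abs_ge_zero zero_less_one]] mult.commute)
    finally show ?thesis .
  qed
  then show "\<exists>N. \<forall>j\<ge>N. \<forall>k\<ge>N. n2 (Y j - Y k) < e"
    by blast
qed (rule assms(2))

lemma Cauchy2_const [simp]: "x \<in> M \<Longrightarrow> Cauchy2 (\<lambda>_. x)"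
  by (simp add: Cauchy2_def)

lemma Cauchy2_adj: "Cauchy2 X \<Longrightarrow> Cauchy2 (\<lambda>k. adj (X k))"
  by (rule Cauchy2_dominated[of X _ 1]) (simp_all flip: adj_simps)

lemma Cauchy2_scale: "Cauchy2 X \<Longrightarrow> Cauchy2 (\<lambda>k. c *\<^sub>O X k)"
  by (rule Cauchy2_dominated[of X _ "cmod c"]) (simp_all flip: scale_op_simps)

lemma Cauchy2_compose_right: "Cauchy2 X \<Longrightarrow> y \<in> M \<Longrightarrow> Cauchy2 (\<lambda>k. X k o\<^sub>L y)"
  by (rule Cauchy2_dominated[of X _ "norm y"])
    (simp_all add: n2_compose_right flip: blinfun_compose_distrib)

lemma Cauchy2_add:
  assumes "Cauchy2 X" "Cauchy2 Y"
  shows "Cauchy2 (\<lambda>k. X k + Y k)"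
  unfolding Cauchy2_def
proof (intro conjI allI impI)
  fix e :: real assume "e > 0"
  then have e: "e / 2 > 0"
    by simp
  obtain N where N: "\<And>j k. j \<ge> N \<Longrightarrow> k \<ge> N \<Longrightarrow> n2 (X j - X k) < e / 2"
    using Cauchy2_D[OF assms(1) e] by blast
  obtain N' where N': "\<And>j k. j \<ge> N' \<Longrightarrow> k \<ge> N' \<Longrightarrow> n2 (Y j - Y k) < e / 2"
    using Cauchy2_D[OF assms(2) e] by blast
  have "n2 ((X j + Y j) - (X k + Y k)) < e" if "j \<ge> max N N'" "k \<ge> max N N'" for j k
    using n2_triangle[of "X j - X k" "Y j - Y k"] N[of j k] N'[of j k] that assms
    by (simp add: algebra_simps)
  then show "\<exists>N. \<forall>j\<ge>N. \<forall>k\<ge>N. n2 ((X j + Y j) - (X k + Y k)) < e"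
    by blast
qed (use assms in simp)

lemma Cauchy2_diff: "Cauchy2 X \<Longrightarrow> Cauchy2 Y \<Longrightarrow> Cauchy2 (\<lambda>k. X k - Y k)"
  using Cauchy2_add[of X "\<lambda>k. (-1) *\<^sub>O Y k"] Cauchy2_scale[of Y "-1"] by simp

lemma Cauchy2_close:
  assumes "Cauchy2 X" "\<And>k. Y k \<in> M" "(\<lambda>k. n2 (X k - Y k)) \<longlonglongrightarrow> 0"
  shows "Cauchy2 Y"
  unfolding Cauchy2_def
proof (intro conjI allI impI)
  fix e :: real assume "e > 0"
  then have e: "e / 3 > 0"
    by simp
  obtain N where N: "\<And>j k. j \<ge> N \<Longrightarrow> k \<ge> N \<Longrightarrow> n2 (X j - X k) < e / 3"
    using Cauchy2_D[OF assms(1) e] by blast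
  obtain N' where N': "\<And>k. k \<ge> N' \<Longrightarrow> \<bar>n2 (X k - Y k)\<bar> < e / 3"
    using LIMSEQ_D[OF assms(3) e] by auto
  have "n2 (Y j - Y k) < e" if "j \<ge> max N N'" "k \<ge> max N N'" for j k
  proof -
    have "n2 (Y j - Y k) \<le> n2 (Y j - X j) + n2 (X j - Y k)"
      using assms by (intro n2_triangle_diff) auto
    also have "n2 (X j - Y k) \<le> n2 (X j - X k) + n2 (X k - Y k)"
      using assms by (intro n2_triangle_diff) auto
    finally show ?thesis
      using N[of j k] N'[of j] N'[of k] that n2_minus_commute[of "Y j" "X j"] assms by simp
  qed
  then show "\<exists>N. \<forall>j\<ge>N. \<forall>k\<ge>N. n2 (Y j - Y k) < e"
    by blast
qed (rule assms(2))

lemma Cauchy2_apply: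
  assumes "Cauchy2 X" "v \<in> BV"
  shows "convergent (\<lambda>k. X k \<cdot> v)"
proof -
  obtain C where C: "C \<ge> 0" "\<And>x. x \<in> M \<Longrightarrow> norm (x \<cdot> v) \<le> C * n2 x"
    using assms(2) by (metis BV_E)
  have "Cauchy (\<lambda>k. X k \<cdot> v)"
  proof (rule metric_CauchyI)
    fix e :: real assume e: "e > 0"
    obtain N where N: "\<And>j k. j \<ge> N \<Longrightarrow> k \<ge> N \<Longrightarrow> n2 (X j - X k) < e / (C + 1)"
      using Cauchy2_D[OF assms(1), of "e / (C + 1)"] e C(1) by auto
    have "dist (X j \<cdot> v) (X k \<cdot> v) < e" if "j \<ge> N" "k \<ge> N" for j k
    proof -
      have "dist (X j \<cdot> v) (X k \<cdot> v) \<le> C * n2 (X j - X k)"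
        using C(2)[of "X j - X k"] assms(1) by (simp add: dist_norm)
      also have "\<dots> \<le> (C + 1) * n2 (X j - X k)"
        using assms(1) by (intro mult_right_mono) auto
      also have "\<dots> < e"
        using N[OF that] by (simp add: pos_less_divide_eq[OF add_nonneg_pos[OF C(1) zero_less_one]] mult.commute)
      finally show ?thesis .
    qed
    then show "\<exists>N. \<forall>j\<ge>N. \<forall>k\<ge>N. dist (X j \<cdot> v) (X k \<cdot> v) < e"
      by blast
  qed
  then show ?thesis
    by (rule Cauchy_convergent)
qed

lemma Cauchy2_n2: "Cauchy2 X \<Longrightarrow> convergent (\<lambda>k. n2 (X k))"
proof (rule Cauchy_convergent, rule metric_CauchyI)
  fix e :: real assume X: "Cauchy2 X" and "e > 0"
  then obtain N where "\<And>j k. j \<ge> N \<Longrightarrow> k \<ge> N \<Longrightarrow> n2 (X j - X k) < e"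
    using Cauchy2_D[OF X] by metis
  then show "\<exists>N. \<forall>j\<ge>N. \<forall>k\<ge>N. dist (n2 (X j)) (n2 (X k)) < e"
    using n2_reverse_triangle X unfolding dist_real_def by (meson Cauchy2_M le_less_trans)
qed

text \<open>Closability of the trace norm with respect to pointwise convergence on bounded vectors:
  \<open>\<tau>(X\<^sub>k\<^sup>* y) = \<langle>y \<zeta>, X\<^sub>k \<beta>\<rangle>\<close>, and \<open>X\<^sub>k \<beta>\<close> is a Cauchy sequence that vanishes coordinatewise
  in the limit.\<close>

lemma Cauchy2_null:
  assumes X: "Cauchy2 X" and null: "\<And>v. v \<in> BV \<Longrightarrow> (\<lambda>k. X k \<cdot> v) \<longlonglongrightarrow> 0"
  shows "(\<lambda>k. n2 (X k)) \<longlonglongrightarrow> 0"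
proof -
  have "Cauchy (\<lambda>k. amp (X k) \<beta>)"
  proof (rule metric_CauchyI)
    fix e :: real assume "e > 0"
    then obtain N where N: "\<And>j k. j \<ge> N \<Longrightarrow> k \<ge> N \<Longrightarrow> n2 (X j - X k) < e"
      using Cauchy2_D[OF X] by metis
    have "dist (amp (X j) \<beta>) (amp (X k) \<beta>) < e" if "j \<ge> N" "k \<ge> N" for j k
      using amp_beta_le[of "X j - X k"] N[OF that] X by (simp add: dist_norm)
    then show "\<exists>N. \<forall>j\<ge>N. \<forall>k\<ge>N. dist (amp (X j) \<beta>) (amp (X k) \<beta>) < e"
      by blast
  qed
  then obtain l where l: "(\<lambda>k. amp (X k) \<beta>) \<longlonglongrightarrow> l"
    using Cauchy_convergent convergent_def by blast
  have "l = 0"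
  proof (rule ell2_eqI)
    fix n
    have "(\<lambda>k. X k \<cdot> coord \<beta> n) \<longlonglongrightarrow> coord l n"
      using tendsto_coord[OF l, of n] by simp
    then show "coord l n = coord 0 n"
      using LIMSEQ_unique[OF _ null[OF BV_beta]] by simp
  qed
  have tau0: "(\<lambda>k. \<tau> (adj (X k) o\<^sub>L y)) \<longlonglongrightarrow> 0" if y: "y \<in> M" for y
  proof -
    have "\<tau> (adj (X k) o\<^sub>L y) = cinner (amp y \<zeta>) (amp (X k) \<beta>)" for k
      using tau_eq_cinner[of "adj (X k) o\<^sub>L y"] X y by (simp add: cinner_amp_adj')
    then show ?thesis
      using cinner.tendsto[OF tendsto_const l, of "amp y \<zeta>"] \<open>l = 0\<close> by simp
  qed
  obtain L where L: "(\<lambda>k. n2 (X k)) \<longlonglongrightarrow> L"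
    using Cauchy2_n2[OF X] convergent_def by blast
  obtain B where "\<And>k. norm (n2 (X k)) \<le> B"
    using convergent_imp_Bseq[OF Cauchy2_n2[OF X]] by (auto simp: Bseq_def)
  then have B: "n2 (X k) \<le> B" for k
    using abs_ge_self order_trans unfolding real_norm_def by blast
  have B0: "B \<ge> 0"
    using order_trans[OF n2_nonneg[OF Cauchy2_M[OF X]] B[of 0]] .
  \<comment> \<open>The square of n2 (X j) splits into the trace pairings of X j with X j - X k and
    with X k. The first is small by the Cauchy property, the second tends to 0 in k by
    \<open>tau0\<close>.\<close>
  have "L\<^sup>2 \<le> 0"
  proof (rule field_le_epsilon)
    fix e :: real assume e: "e > 0"
    obtain N where N: "\<And>j k. j \<ge> N \<Longrightarrow> k \<ge> N \<Longrightarrow> n2 (X j - X k) < e / (B + 1)"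
      using Cauchy2_D[OF X, of "e / (B + 1)"] e B0 by auto
    have "(n2 (X j))\<^sup>2 \<le> e" if j: "j \<ge> N" for j
    proof (rule tendsto_lowerbound)
      show "(\<lambda>k. e + cmod (\<tau> (adj (X k) o\<^sub>L X j))) \<longlonglongrightarrow> e"
        using tendsto_add[OF tendsto_const tendsto_norm[OF tau0[of "X j"]], of e] X by simp
      have "(n2 (X j))\<^sup>2 \<le> e + cmod (\<tau> (adj (X k) o\<^sub>L X j))" if k: "k \<ge> N" for k
      proof -
        have "(n2 (X j))\<^sup>2 = cmod (\<tau> (adj (X j) o\<^sub>L X j))"
          using X by (simp add: tau_adj_self norm_power)
        also have "\<tau> (adj (X j) o\<^sub>L X j) = \<tau> (adj (X j - X k) o\<^sub>L X j) + \<tau> (adj (X k) o\<^sub>L X j)"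
          using X by (simp add: blinfun_compose_distrib)
        also have "cmod \<dots> \<le> n2 (X j - X k) * n2 (X j) + cmod (\<tau> (adj (X k) o\<^sub>L X j))"
          using tau_Cauchy_Schwarz[of "X j - X k" "X j"] X by (intro norm_triangle_le add_mono) auto
        also have "n2 (X j - X k) * n2 (X j) \<le> e / (B + 1) * (B + 1)"
          using N[OF j k] B[of j] B0 e X by (intro mult_mono) auto
        also have "\<dots> = e"
          using B0 by simp
        finally show ?thesis
          by simp
      qed
      then show "\<forall>\<^sub>F k in sequentially. (n2 (X j))\<^sup>2 \<le> e + cmod (\<tau> (adj (X k) o\<^sub>L X j))"
        using eventually_sequentially by blast
    qed simp
    then have "\<forall>\<^sub>F j in sequentially. (n2 (X j))\<^sup>2 \<le> e"
      using eventually_sequentially by blast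
    then have "L\<^sup>2 \<le> e"
      using tendsto_upperbound[OF tendsto_power[OF L, of 2]] by simp
    then show "L\<^sup>2 \<le> 0 + e"
      by simp
  qed
  then show ?thesis
    using L by simp
qed

lemma n2_strong_null:
  assumes "\<And>k. X k \<in> M" "\<And>k. norm (X k) \<le> C" "\<And>v. (\<lambda>k. X k \<cdot> v) \<longlonglongrightarrow> 0"
  shows "(\<lambda>k. n2 (X k)) \<longlonglongrightarrow> 0"
proof (rule tendsto_sandwich[OF _ _ tendsto_const])
  show "(\<lambda>k. norm (amp (X k) \<zeta>)) \<longlonglongrightarrow> 0"
    using tendsto_norm[OF amp_strong_null[OF assms(2,3)]] by simp
qed (use assms(1) n2_le_amp in auto)

end

subsection \<open>Resolvents of closed operators\<close>

lemma closed_operatorD: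
  assumes "closed_operator x"
  shows "csubspace x" "closed x" "closure (Domain x) = UNIV"
    "(u, v) \<in> x \<Longrightarrow> (u, v') \<in> x \<Longrightarrow> v = v'"
proof -
  show "csubspace x"
    unfolding csubspace_def
  proof (intro conjI ballI allI)
    show "0 \<in> x"
      using assms by (simp add: closed_operator_def zero_prod_def)
    show "p + q \<in> x" if "p \<in> x" "q \<in> x" for p q
      using assms that by (cases p, cases q) (simp add: closed_operator_def)
    show "c *\<^sub>C p \<in> x" if "p \<in> x" for c p
      using assms that by (cases p) (simp add: closed_operator_def)
  qed
qed (use assms in \<open>auto simp: closed_operator_def single_valued_def\<close>)

lemma csubspace_image:
  fixes f :: "'a::complex_hilbert_space \<Rightarrow> 'b::complex_hilbert_space"
  assumes "csubspace S" "f 0 = 0" "\<And>x y. x \<in> S \<Longrightarrow> y \<in> S \<Longrightarrow> f (x + y) = f x + f y" "\<And>c x. x \<in> S \<Longrightarrow> f (c *\<^sub>C x) = c *\<^sub>C f x"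
  shows "csubspace (f ` S)"
proof -
  have "f x + f y \<in> f ` S" if "x \<in> S" "y \<in> S" for x y
    using imageI[OF csubspaceD(2)[OF assms(1) that], of f] assms(3)[OF that] by simp
  moreover have "c *\<^sub>C f x \<in> f ` S" if "x \<in> S" for c x
    using imageI[OF csubspaceD(3)[OF assms(1) that], of f c] assms(4)[OF that] by simp
  moreover have "0 \<in> f ` S"
    using imageI[OF csubspaceD(1)[OF assms(1)], of f] assms(2) by simp
  ultimately show ?thesis
    unfolding csubspace_def by blast
qed

lemma csubspace_vimage:
  fixes f :: "'a::complex_hilbert_space \<Rightarrow> 'b::complex_hilbert_space"
  assumes "csubspace S" "f 0 = 0" "\<And>x y. f (x + y) = f x + f y" "\<And>c x. f (c *\<^sub>C x) = c *\<^sub>C f x"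
  shows "csubspace (f -` S)"
  unfolding csubspace_def using csubspaceD(1-3)[OF assms(1)] by (simp add: assms(2-4))

text \<open>The weight e is put into the operator, so the inner product of the product type stays
  unchanged and \<open>orth_proj\<close> applies as it is.\<close>

definition weighted_graph :: "'h::complex_hilbert_space unbounded_op \<Rightarrow> real \<Rightarrow> ('h \<times> 'h) set" where
  "weighted_graph x e = {(u, v). (u, of_real (1 / sqrt e) *\<^sub>C v) \<in> x}"

text \<open>The operators \<open>(1 + e x\<^sup>* x)\<^sup>-\<^sup>1\<close> and \<open>x (1 + e x\<^sup>* x)\<^sup>-\<^sup>1\<close>; the pair of their values at
  \<open>w\<close> is obtained by projecting \<open>(w, 0)\<close> onto the graph of \<open>\<surd>e x\<close>.\<close>

definition resR :: "'h::complex_hilbert_space unbounded_op \<Rightarrow> real \<Rightarrow> 'h \<Rightarrow>\<^sub>L 'h" where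
  "resR x e = Blinfun (\<lambda>w. fst (orth_proj (weighted_graph x e) \<cdot> (w, 0)))"

definition resZ :: "'h::complex_hilbert_space unbounded_op \<Rightarrow> real \<Rightarrow> 'h \<Rightarrow>\<^sub>L 'h" where
  "resZ x e = Blinfun (\<lambda>w. of_real (1 / sqrt e) *\<^sub>C snd (orth_proj (weighted_graph x e) \<cdot> (w, 0)))"

context
  fixes x :: "'h::complex_hilbert_space unbounded_op" and e :: real
  assumes x: "closed_operator x" and e: "e > 0"
begin

lemma weighted_graph: "csubspace (weighted_graph x e)" "closed (weighted_graph x e)"
proof -
  have eq: "weighted_graph x e = (\<lambda>p. (fst p, of_real (1 / sqrt e) *\<^sub>C snd p)) -` x"
    by (auto simp: weighted_graph_def)
  show "csubspace (weighted_graph x e)"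
    unfolding eq
    by (rule csubspace_vimage[OF closed_operatorD(1)[OF x]])
      (simp_all add: zero_prod_def scaleC_prod_def scaleC_add_right scaleC_scaleC mult.commute)
  show "closed (weighted_graph x e)"
    unfolding eq
    by (intro closed_vimage closed_operatorD(2)[OF x] continuous_intros scaleC.continuous_on)
qed

lemma bounded_linear_resolvent:
  "bounded_linear (\<lambda>w. fst (orth_proj (weighted_graph x e) \<cdot> (w, 0)))"
  "bounded_linear (\<lambda>w. of_real (1 / sqrt e) *\<^sub>C snd (orth_proj (weighted_graph x e) \<cdot> (w, 0)))"
proof -
  have p: "bounded_linear (\<lambda>w. orth_proj (weighted_graph x e) \<cdot> (w, 0))"
    by (rule bounded_linear_compose[OF blinfun.bounded_linear_right])
      (rule bounded_linear_Pair[OF bounded_linear_ident bounded_linear_zero])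
  show "bounded_linear (\<lambda>w. fst (orth_proj (weighted_graph x e) \<cdot> (w, 0)))"
    by (rule bounded_linear_compose[OF bounded_linear_fst p])
  show "bounded_linear (\<lambda>w. of_real (1 / sqrt e) *\<^sub>C snd (orth_proj (weighted_graph x e) \<cdot> (w, 0)))"
    by (rule bounded_linear_compose[OF scaleC.bounded_linear_right])
      (rule bounded_linear_compose[OF bounded_linear_snd p])
qed

lemma resolvent_apply:
  "resR x e \<cdot> w = fst (orth_proj (weighted_graph x e) \<cdot> (w, 0))"
  "resZ x e \<cdot> w = of_real (1 / sqrt e) *\<^sub>C snd (orth_proj (weighted_graph x e) \<cdot> (w, 0))"
  unfolding resR_def resZ_def by (simp_all only: bounded_linear_Blinfun_apply bounded_linear_resolvent)

lemma clinear_resolvent: "clinear_op (resR x e)" "clinear_op (resZ x e)"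
proof -
  have "orth_proj (weighted_graph x e) \<cdot> (c *\<^sub>C w, 0)
      = c *\<^sub>C orth_proj (weighted_graph x e) \<cdot> (w, 0)" for c w
    using clinear_opD[OF clinear_op_orth_proj[OF weighted_graph], of c "(w, 0)"] by simp
  then show "clinear_op (resR x e)" "clinear_op (resZ x e)"
    by (simp_all add: clinear_op_def resolvent_apply scaleC_prod_def scaleC_scaleC mult.commute)
qed

lemma resolvent_graph: "(resR x e \<cdot> w, resZ x e \<cdot> w) \<in> x"
  using orth_proj_in[OF weighted_graph, of "(w, 0)"]
  unfolding resolvent_apply weighted_graph_def by (simp add: case_prod_beta)

text \<open>The weak form of u + e x* x u = w for u = \<open>resR x e\<close> applied to w, tested
  against the graph of x. It never mentions the domain of the adjoint.\<close>

lemma resolvent_eq: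
  assumes "(s, t) \<in> x"
  shows "cinner (w - resR x e \<cdot> w) s = of_real e * cinner (resZ x e \<cdot> w) t"
proof -
  define p where "p = orth_proj (weighted_graph x e) \<cdot> (w, 0)"
  have "of_real (1 / sqrt e) *\<^sub>C of_real (sqrt e) *\<^sub>C t = t"
    using e by (simp add: scaleC_scaleC flip: of_real_mult)
  then have "(s, of_real (sqrt e) *\<^sub>C t) \<in> weighted_graph x e"
    using assms by (simp add: weighted_graph_def)
  then have "cinner ((w, 0) - p) (s, of_real (sqrt e) *\<^sub>C t) = 0"
    unfolding p_def by (rule orth_proj_orth[OF weighted_graph])
  then have "cinner (w - fst p) s = of_real (sqrt e) * cinner (snd p) t"
    by (cases p) (simp add: cinner_lin)
  also have "\<dots> = of_real e * (of_real (1 / sqrt e) * cinner (snd p) t)"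
  proof -
    have "sqrt e = e * (1 / sqrt e)"
      using e by (simp add: real_div_sqrt)
    then show ?thesis
      by (metis mult.assoc of_real_mult)
  qed
  finally show ?thesis
    by (simp add: resolvent_apply p_def cinner_lin)
qed

lemma resolvent_unique:
  assumes "(u, v) \<in> x" "\<And>s t. (s, t) \<in> x \<Longrightarrow> cinner (w - u) s = of_real e * cinner v t"
  shows "u = resR x e \<cdot> w" "v = resZ x e \<cdot> w"
proof -
  let ?a = "u - resR x e \<cdot> w" and ?b = "v - resZ x e \<cdot> w"
  have ab: "(?a, ?b) \<in> x"
    using csubspaceD(4)[OF closed_operatorD(1)[OF x] assms(1) resolvent_graph[of w]] by simp
  have "cinner ?a ?a = cinner (w - resR x e \<cdot> w) ?a - cinner (w - u) ?a"
    by (simp flip: cinner_diff_left)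
  also have "\<dots> = - (of_real e * (cinner v ?b - cinner (resZ x e \<cdot> w) ?b))"
    unfolding resolvent_eq[OF ab] assms(2)[OF ab] by (simp only: right_diff_distrib minus_diff_eq)
  also have "\<dots> = - (of_real e * cinner ?b ?b)"
    by (simp only: cinner_diff_left)
  finally have "complex_of_real ((norm ?a)\<^sup>2 + e * (norm ?b)\<^sup>2) = 0"
    by (simp add: cinner_self)
  then have "(norm ?a)\<^sup>2 + e * (norm ?b)\<^sup>2 = 0"
    using of_real_eq_0_iff by blast
  then show "u = resR x e \<cdot> w" "v = resZ x e \<cdot> w"
    using e by (simp_all add: add_nonneg_eq_0_iff)
qed

text \<open>The weak form rewrites \<open>cinner v (resR x e \<cdot> w)\<close> as the sum of a
  pairing of \<open>resR\<close> values and e times a pairing of \<open>resZ\<close> values, an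
  expression that is Hermitian in v and w.\<close>

lemma resR_cinner: "cinner (resR x e \<cdot> v) w = cinner v (resR x e \<cdot> w)"
proof -
  have *: "cinner v (resR x e \<cdot> w) = cinner (resR x e \<cdot> v) (resR x e \<cdot> w)
      + of_real e * cinner (resZ x e \<cdot> v) (resZ x e \<cdot> w)" for v w
    using resolvent_eq[OF resolvent_graph[of w], of v] by (simp add: cinner_diff_left diff_eq_eq add.commute)
  have "cinner (resR x e \<cdot> v) w = cnj (cinner w (resR x e \<cdot> v))"
    by (rule cinner_commute)
  also have "\<dots> = cinner (resR x e \<cdot> v) (resR x e \<cdot> w)
      + of_real e * cinner (resZ x e \<cdot> v) (resZ x e \<cdot> w)"
    unfolding *[of w v] complex_cnj_add complex_cnj_mult cinner_commute[symmetric] by simp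
  also have "\<dots> = cinner v (resR x e \<cdot> w)"
    by (rule *[symmetric])
  finally show ?thesis .
qed

lemma adj_resR: "adj (resR x e) = resR x e"
  by (rule adj_eqI[OF clinear_resolvent(1)]) (rule resR_cinner)

lemma resZ_cinner:
  "of_real e * cinner (resZ x e \<cdot> v) (resZ x e \<cdot> w)
   = cinner (v - resR x e \<cdot> v) (resR x e \<cdot> w)"
  using resolvent_eq[OF resolvent_graph[of w], of v] by simp

lemma resZ_norm:
  "e * (norm (resZ x e \<cdot> w))\<^sup>2
   = Re (cinner w (resR x e \<cdot> w)) - (norm (resR x e \<cdot> w))\<^sup>2"
proof -
  have "Re (of_real e * cinner (resZ x e \<cdot> w) (resZ x e \<cdot> w))
      = Re (cinner (w - resR x e \<cdot> w) (resR x e \<cdot> w))"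
    by (simp only: resZ_cinner)
  then show ?thesis
    by (simp add: cinner_lin cinner_self del: of_real_power)
qed

lemma norm_resR_le: "norm (resR x e \<cdot> w) \<le> norm w"
proof (cases "resR x e \<cdot> w = 0")
  case False
  have "0 \<le> e * (norm (resZ x e \<cdot> w))\<^sup>2"
    using e by simp
  then have "(norm (resR x e \<cdot> w))\<^sup>2 \<le> Re (cinner w (resR x e \<cdot> w))"
    unfolding resZ_norm by simp
  also have "\<dots> \<le> norm w * norm (resR x e \<cdot> w)"
    using order_trans[OF complex_Re_le_cmod cinner_norm_le] .
  finally show ?thesis
    using False by (simp add: power2_eq_square)
qed simp

lemma norm_resR: "norm (resR x e) \<le> 1"
  by (rule norm_blinfun_bound) (simp_all add: norm_resR_le)

text \<open>The weak form is literally membership in \<open>graph_adj x\<close>. It shows that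
  values of \<open>resR\<close> lie in the domain of x* x, where the minorants in
  \<open>extended_trace\<close> can be compared.\<close>

lemma resolvent_adjoint:
  "(resZ x e \<cdot> w, of_real (1 / e) *\<^sub>C (w - resR x e \<cdot> w)) \<in> graph_adj x"
  unfolding graph_adj_def
proof (clarify)
  fix s t assume "(s, t) \<in> x"
  from resolvent_eq[OF this, of w]
  have "cinner (of_real (1 / e) *\<^sub>C (w - resR x e \<cdot> w)) s = cinner (resZ x e \<cdot> w) t"
    using e by (simp add: cinner_scaleC_left)
  then show "cinner t (resZ x e \<cdot> w) = cinner s (of_real (1 / e) *\<^sub>C (w - resR x e \<cdot> w))"
    by (metis cinner_commute)
qed

lemma resolvent_square:
  "(resR x e \<cdot> w, of_real (1 / e) *\<^sub>C (w - resR x e \<cdot> w)) \<in> x O graph_adj x"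
  using resolvent_graph resolvent_adjoint by blast

text \<open>Testing the weak form with the difference of (w, y) and its resolvent pair (u, v) gives
  norm (w - u)^2 = e (Re <v, y> - norm v^2). An upper bound of the right side is the first claim,
  its nonnegativity the second.\<close>

lemma resolvent_approx:
  assumes "(w, y) \<in> x"
  shows "(norm (w - resR x e \<cdot> w))\<^sup>2 \<le> e * (norm y)\<^sup>2"
    and "norm (resZ x e \<cdot> w) \<le> norm y"
proof -
  let ?u = "resR x e \<cdot> w" and ?v = "resZ x e \<cdot> w"
  have "(w - ?u, y - ?v) \<in> x"
    using csubspaceD(4)[OF closed_operatorD(1)[OF x] assms resolvent_graph[of w]] by simp
  from resolvent_eq[OF this, of w] have "Re (cinner (w - ?u) (w - ?u)) = Re (of_real e * cinner ?v (y - ?v))"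
    by simp
  then have eq: "(norm (w - ?u))\<^sup>2 = e * (Re (cinner ?v y) - (norm ?v)\<^sup>2)"
    by (simp add: cinner_self cinner_diff_right[of ?v] del: of_real_power)
  have le: "Re (cinner ?v y) \<le> norm ?v * norm y"
    using order_trans[OF complex_Re_le_cmod cinner_norm_le] .
  have "Re (cinner ?v y) - (norm ?v)\<^sup>2 \<le> (norm y)\<^sup>2"
    using le sum_squares_bound[of "norm ?v" "norm y"] zero_le_power2[of "norm ?v"] zero_le_power2[of "norm y"] by linarith
  then show "(norm (w - ?u))\<^sup>2 \<le> e * (norm y)\<^sup>2"
    unfolding eq using e by simp
  have "0 \<le> e * (Re (cinner ?v y) - (norm ?v)\<^sup>2)"
    unfolding eq[symmetric] by simp
  then have "(norm ?v)\<^sup>2 \<le> norm ?v * norm y"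
    using e le by (simp add: zero_le_mult_iff)
  then show "norm ?v \<le> norm y"
    by (cases "?v = 0") (simp_all add: power2_eq_square)
qed

lemma resR_inj:
  assumes "resR x e \<cdot> w = 0"
  shows "w = 0"
proof -
  have "(0, resZ x e \<cdot> w) \<in> x" "(0, 0) \<in> x"
    using resolvent_graph[of w] assms csubspaceD(1)[OF closed_operatorD(1)[OF x]] by (simp_all add: zero_prod_def)
  then have z: "resZ x e \<cdot> w = 0"
    by (rule closed_operatorD(4)[OF x])
  show ?thesis
  proof (rule cinner_eq_zero_dense[OF closed_operatorD(3)[OF x]])
    fix s assume "s \<in> Domain x"
    then obtain t where "(s, t) \<in> x"
      by blast
    from resolvent_eq[OF this, of w] show "cinner w s = 0"
      by (simp add: z assms)
  qed
qed

end

text \<open>For e = 1 the weak form matches the inner product of the graph: if (s, t) in x is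
  orthogonal to the resolvent pair of s, then <s, s> = 0, hence also t = 0. So the resolvent pairs
  span a core.\<close>

lemma resolvent_dense:
  assumes x: "closed_operator x" and N: "csubspace N" "closed N" "N \<subseteq> x"
    and R: "\<And>w. (resR x 1 \<cdot> w, resZ x 1 \<cdot> w) \<in> N"
  shows "N = x"
proof
  show "x \<subseteq> N"
  proof
    fix p assume p: "p \<in> x"
    obtain q where q: "q \<in> N" "\<And>s. s \<in> N \<Longrightarrow> cinner (p - q) s = 0"
      using projection_exists[OF N(1,2)] by metis
    obtain s t where st: "p - q = (s, t)"
      by (cases "p - q")
    have "p - q \<in> x"
      using p q(1) N(3) by (intro csubspaceD(4)[OF closed_operatorD(1)[OF x]]) auto
    then have "(s, t) \<in> x"
      by (simp add: st)
    then have eq: "cinner (w - resR x 1 \<cdot> w) s = cinner (resZ x 1 \<cdot> w) t" for w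
      using resolvent_eq[OF x zero_less_one] by simp
    have "cinner (resR x 1 \<cdot> s) s + cinner (resZ x 1 \<cdot> s) t
        = cnj (cinner (s, t) (resR x 1 \<cdot> s, resZ x 1 \<cdot> s))"
      unfolding cinner_Pair complex_cnj_add cinner_commute[symmetric] ..
    also have "\<dots> = 0"
      using q(2)[OF R[of s]] unfolding st by simp
    finally have zero: "cinner (resR x 1 \<cdot> s) s + cinner (resZ x 1 \<cdot> s) t = 0" .
    have "cinner s s = cinner (resZ x 1 \<cdot> s) t + cinner (resR x 1 \<cdot> s) s"
      using eq[of s] unfolding cinner_diff_left diff_eq_eq .
    then have "s = 0"
      using zero by (metis add.commute cinner_self_eq_0)
    moreover have "(0, 0) \<in> x"
      using csubspaceD(1)[OF closed_operatorD(1)[OF x]] by (simp add: zero_prod_def)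
    ultimately have "t = 0"
      using closed_operatorD(4)[OF x] \<open>(s, t) \<in> x\<close> by blast
    then have "p = q"
      using st \<open>s = 0\<close> by (simp add: prod_eq_iff)
    then show "p \<in> N"
      using q(1) by simp
  qed
qed (rule N(3))

text \<open>On the domain of x the error is of order sqrt e by \<open>resolvent_approx\<close>; the
  uniform bound of \<open>resR\<close> carries convergence to the closure of the domain.\<close>

lemma resR_tendsto:
  fixes x :: "'h::complex_hilbert_space unbounded_op"
  assumes x: "closed_operator x"
  shows "(\<lambda>k. (resR x (1 / real (Suc k))) \<cdot> v) \<longlonglongrightarrow> v"
proof (rule metric_LIMSEQ_I)
  fix r :: real assume r: "r > 0"
  have "v \<in> closure (Domain x)"
    using closed_operatorD(3)[OF x] by simp
  then obtain w where "w \<in> Domain x" and w: "dist w v < r / 3"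
    using r closure_approachable by (metis zero_less_divide_iff zero_less_numeral)
  then obtain y where y: "(w, y) \<in> x"
    by blast
  have "(\<lambda>k. 1 / real (Suc k) * (norm y)\<^sup>2) \<longlonglongrightarrow> 0 * (norm y)\<^sup>2"
    using LIMSEQ_inverse_real_of_nat by (intro tendsto_mult tendsto_const) (simp add: inverse_eq_divide)
  then have "\<forall>\<^sub>F k in sequentially. 1 / real (Suc k) * (norm y)\<^sup>2 < (r / 3)\<^sup>2"
    using r by (intro order_tendstoD(2)) auto
  then obtain K where K: "\<And>k. k \<ge> K \<Longrightarrow> 1 / real (Suc k) * (norm y)\<^sup>2 < (r / 3)\<^sup>2"
    by (auto simp: eventually_sequentially)
  have "dist ((resR x (1 / real (Suc k))) \<cdot> v) v < r" if "k \<ge> K" for k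
  proof -
    have e: "1 / real (Suc k) > 0"
      by simp
    let ?R = "blinfun_apply (resR x (1 / real (Suc k)))"
    have "(norm (w - ?R w))\<^sup>2 < (r / 3)\<^sup>2"
      using resolvent_approx(1)[OF x e y] K[OF that] by linarith
    then have 1: "norm (w - ?R w) < r / 3"
      by (rule power2_less_imp_less) (use r in simp)
    have "norm (?R (v - w)) \<le> norm (v - w)"
      by (rule norm_resR_le[OF x e])
    then have 2: "norm (?R v - ?R w) < r / 3"
      using w by (simp add: blinfun.diff_right dist_norm norm_minus_commute)
    have "(?R v - ?R w) - (w - ?R w) + (w - v) = ?R v - v"
      by simp
    then have "norm (?R v - v) \<le> norm (?R v - ?R w) + norm (w - ?R w) + norm (w - v)"
      using norm_triangle_ineq[of "(?R v - ?R w) - (w - ?R w)" "w - v"]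
        norm_triangle_ineq4[of "?R v - ?R w" "w - ?R w"] by simp
    then show ?thesis
      using 1 2 w by (simp add: dist_norm)
  qed
  then show "\<exists>K. \<forall>k\<ge>K. dist ((resR x (1 / real (Suc k))) \<cdot> v) v < r"
    by blast
qed

section \<open>Affiliated operators and their resolvents in M\<close>

context tracial_vna
begin

text \<open>For a in the commutant, applying a to the resolvent pair of w solves the weak equation
  for a w, because \<open>adj a\<close> also preserves the graph; uniqueness then gives
  commutation.\<close>

lemma resolvent_in_M:
  assumes x: "closed_operator x" and aff: "affiliated M x" and e: "e > 0"
  shows "resR x e \<in> M" "resZ x e \<in> M"
proof -
  have *: "a \<cdot> (resR x e \<cdot> w) = resR x e \<cdot> (a \<cdot> w)"
    "a \<cdot> (resZ x e \<cdot> w) = resZ x e \<cdot> (a \<cdot> w)"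
    if a: "a \<in> commutant M" for a w
  proof -
    have inv: "(b \<cdot> u, b \<cdot> v) \<in> x" if "b \<in> commutant M" "(u, v) \<in> x" for b u v
      using aff that unfolding affiliated_def by blast
    have g: "(a \<cdot> (resR x e \<cdot> w), a \<cdot> (resZ x e \<cdot> w)) \<in> x"
      by (rule inv[OF a resolvent_graph[OF x e]])
    have eq: "cinner (a \<cdot> w - a \<cdot> (resR x e \<cdot> w)) s
        = of_real e * cinner (a \<cdot> (resZ x e \<cdot> w)) t" if "(s, t) \<in> x" for s t
      using resolvent_eq[OF x e inv[OF commutant_adj[OF a] that], of w] commutant_clinear[OF a]
      by (simp add: cinner_adj[symmetric] blinfun.diff_right)
    show "a \<cdot> (resR x e \<cdot> w) = resR x e \<cdot> (a \<cdot> w)"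
      "a \<cdot> (resZ x e \<cdot> w) = resZ x e \<cdot> (a \<cdot> w)"
      using resolvent_unique[OF x e g eq] by simp_all
  qed
  show "resR x e \<in> M" "resZ x e \<in> M"
    by (rule in_M_I, rule clinear_resolvent[OF x e], erule *)+
qed

text \<open>The bounded vectors are invariant under the resolvent, hence form a core.\<close>

lemma core_eq:
  assumes x: "closed_operator x" "affiliated M x"
    and N: "csubspace N" "closed N" "N \<subseteq> x" "BV \<subseteq> Domain N"
  shows "N = x"
proof (rule resolvent_dense[OF x(1) N(1-3)])
  fix w
  let ?f = "\<lambda>w. (resR x 1 \<cdot> w, resZ x 1 \<cdot> w)"
  have "closed (?f -` N)"
    by (intro closed_vimage N(2) continuous_intros blinfun.continuous_on)
  moreover have "BV \<subseteq> ?f -` N"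
  proof
    fix v assume "v \<in> BV"
    then have "resR x 1 \<cdot> v \<in> Domain N"
      using N(4) BV_M[OF resolvent_in_M(1)[OF x zero_less_one]] by blast
    then obtain y where y: "(resR x 1 \<cdot> v, y) \<in> N"
      by blast
    then have "y = resZ x 1 \<cdot> v"
      using N(3) resolvent_graph[OF x(1) zero_less_one, of v] closed_operatorD(4)[OF x(1)] by blast
    then show "v \<in> ?f -` N"
      using y by simp
  qed
  ultimately have "closure BV \<subseteq> ?f -` N"
    by (intro closure_minimal)
  then show "?f w \<in> N"
    using closure_BV by blast
qed

subsection \<open>The operator represented by a Cauchy sequence\<close>

text \<open>Convergence is tested weakly and against \<open>BV\<close> only. This makes the graph an
  adjoint, hence closed without taking a closure; pointwise limits on \<open>BV\<close> are
  contained in it by \<open>Lop_apply\<close>.\<close>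

definition Lop :: "(nat \<Rightarrow> 'h \<Rightarrow>\<^sub>L 'h) \<Rightarrow> 'h unbounded_op" where
  "Lop X = {(u, y). \<forall>w\<in>BV. (\<lambda>k. cinner (X k \<cdot> u) w) \<longlonglongrightarrow> cinner y w}"

lemma Lop_apply: "(\<lambda>k. X k \<cdot> v) \<longlonglongrightarrow> y \<Longrightarrow> (v, y) \<in> Lop X"
  unfolding Lop_def by (auto intro: cinner.tendsto)

lemma BV_Domain_Lop: "Cauchy2 X \<Longrightarrow> BV \<subseteq> Domain (Lop X)"
  using Cauchy2_apply Lop_apply by (meson DomainI convergent_def subsetI)

lemma Lop_unique:
  assumes "(u, y) \<in> Lop X" "(u, y') \<in> Lop X"
  shows "y = y'"
proof -
  have "cinner (y - y') w = 0" if "w \<in> BV" for w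
  proof -
    have "(\<lambda>k. cinner (X k \<cdot> u) w) \<longlonglongrightarrow> cinner y w"
      "(\<lambda>k. cinner (X k \<cdot> u) w) \<longlonglongrightarrow> cinner y' w"
      using assms that by (auto simp: Lop_def)
    then show ?thesis
      using LIMSEQ_unique by (auto simp: cinner_diff_left)
  qed
  then have "y - y' = 0"
    by (rule cinner_eq_zero_dense[OF closure_BV])
  then show ?thesis
    by simp
qed

lemma Lop_BV_tendsto:
  assumes "Cauchy2 X" "v \<in> BV" "(v, y) \<in> Lop X"
  shows "(\<lambda>k. X k \<cdot> v) \<longlonglongrightarrow> y"
proof -
  obtain l where l: "(\<lambda>k. X k \<cdot> v) \<longlonglongrightarrow> l"
    using Cauchy2_apply[OF assms(1,2)] convergent_def by blast
  then show ?thesis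
    using Lop_unique[OF assms(3) Lop_apply[OF l]] by simp
qed

text \<open>The adjoint sequence is Cauchy as well, so it has pointwise limits l on
  \<open>BV\<close>, and \<open>cinner (X k \<cdot> u) w\<close> tends to
  \<open>cinner u (l w)\<close> for every u. The graph is thus the adjoint of l, an intersection of
  closed conditions.\<close>

lemma closed_operator_Lop:
  assumes X: "Cauchy2 X"
  shows "closed_operator (Lop X)"
proof -
  have "\<exists>l. (\<lambda>k. adj (X k) \<cdot> w) \<longlonglongrightarrow> l" if "w \<in> BV" for w
    using Cauchy2_apply[OF Cauchy2_adj[OF X] that] by (simp add: convergent_def)
  then obtain l where l: "\<And>w. w \<in> BV \<Longrightarrow> (\<lambda>k. adj (X k) \<cdot> w) \<longlonglongrightarrow> l w"
    by metis
  have lim: "(\<lambda>k. cinner (X k \<cdot> u) w) \<longlonglongrightarrow> cinner u (l w)" if "w \<in> BV" for u w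
    using cinner.tendsto[OF tendsto_const l[OF that], of u] X by (simp add: cinner_adj)
  have "Lop X = (\<Inter>w\<in>BV. {p. cinner (fst p) (l w) = cinner (snd p) w})"
  proof -
    have "(\<lambda>k. cinner (X k \<cdot> u) w) \<longlonglongrightarrow> cinner y w \<longleftrightarrow> cinner u (l w) = cinner y w"
      if "w \<in> BV" for u y w
    proof
      assume "(\<lambda>k. cinner (X k \<cdot> u) w) \<longlonglongrightarrow> cinner y w"
      then show "cinner u (l w) = cinner y w"
        by (rule LIMSEQ_unique[OF lim[OF that]])
    next
      assume "cinner u (l w) = cinner y w"
      then show "(\<lambda>k. cinner (X k \<cdot> u) w) \<longlonglongrightarrow> cinner y w"
        using lim[OF that, of u] by simp
    qed
    then show ?thesis
      by (auto simp: Lop_def)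
  qed
  moreover have "closed (\<Inter>w\<in>BV. {p. cinner (fst p) (l w) = cinner (snd p) w})"
    by (intro closed_INT ballI closed_Collect_eq cinner.continuous_on continuous_intros)
  ultimately have "closed (Lop X)"
    by simp
  moreover have "closure (Domain (Lop X)) = UNIV"
    using closure_mono[OF BV_Domain_Lop[OF X]] closure_BV by auto
  moreover have "(u + u', v + v') \<in> Lop X" if "(u, v) \<in> Lop X" "(u', v') \<in> Lop X" for u v u' v'
    using that unfolding Lop_def by (auto simp: cinner_lin blinfun.add_right intro: tendsto_add)
  moreover have "(c *\<^sub>C u, c *\<^sub>C v) \<in> Lop X" if "(u, v) \<in> Lop X" for c u v
    using that X unfolding Lop_def by (auto simp: cinner_lin clinear_opD intro: tendsto_mult_left)
  moreover have "(0, 0) \<in> Lop X"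
    by (simp add: Lop_def)
  ultimately show ?thesis
    using Lop_unique[of _ _ X] by (simp add: closed_operator_def single_valued_def)
qed

lemma affiliated_Lop:
  assumes X: "Cauchy2 X"
  shows "affiliated M (Lop X)"
  unfolding affiliated_def
proof (intro ballI, clarify)
  fix a u v assume a: "a \<in> commutant M" and uv: "(u, v) \<in> Lop X"
  have "(\<lambda>k. cinner (X k \<cdot> (a \<cdot> u)) w) \<longlonglongrightarrow> cinner (a \<cdot> v) w"
    if w: "w \<in> BV" for w
  proof -
    have "adj a \<cdot> w \<in> BV"
      by (rule BV_commutant[OF commutant_adj[OF a] w])
    then have "(\<lambda>k. cinner (X k \<cdot> u) (adj a \<cdot> w)) \<longlonglongrightarrow> cinner v (adj a \<cdot> w)"
      using uv by (simp add: Lop_def)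
    then show ?thesis
      using commutant_apply[OF a Cauchy2_M[OF X]] commutant_clinear[OF a] by (simp add: cinner_adj[symmetric])
  qed
  then show "(a \<cdot> u, a \<cdot> v) \<in> Lop X"
    by (simp add: Lop_def)
qed

text \<open>The intersection of the two graphs is a closed restriction of both whose domain contains
  \<open>BV\<close>; by \<open>core_eq\<close> it equals each of them.\<close>

lemma Lop_eqI:
  assumes X: "Cauchy2 X" and x: "closed_operator x" "affiliated M x"
    and lim: "\<And>v y. v \<in> BV \<Longrightarrow> (\<lambda>k. X k \<cdot> v) \<longlonglongrightarrow> y \<Longrightarrow> (v, y) \<in> x"
  shows "x = Lop X"
proof -
  define N where "N = Lop X \<inter> x"
  have N: "csubspace N" "closed N"
    unfolding N_def using closed_operatorD(1,2)[OF closed_operator_Lop[OF X]] closed_operatorD(1,2)[OF x(1)]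
    by (auto simp: csubspace_def)
  have "BV \<subseteq> Domain N"
  proof
    fix v assume v: "v \<in> BV"
    then obtain y where "(\<lambda>k. X k \<cdot> v) \<longlonglongrightarrow> y"
      using Cauchy2_apply[OF X] convergent_def by blast
    then show "v \<in> Domain N"
      using lim[OF v] Lop_apply unfolding N_def by blast
  qed
  moreover have "N \<subseteq> Lop X" "N \<subseteq> x"
    by (auto simp: N_def)
  ultimately have "N = Lop X" "N = x"
    using core_eq[OF closed_operator_Lop[OF X] affiliated_Lop[OF X] N] core_eq[OF x N] by blast+
  then show ?thesis
    by simp
qed

lemma graph_of_eq_Lop:
  assumes "x \<in> M"
  shows "graph_of x = Lop (\<lambda>_. x)"
proof -
  have "(u, x \<cdot> u) \<in> Lop (\<lambda>_. x)" for u
    by (rule Lop_apply) simp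
  then have "(u, y) \<in> Lop (\<lambda>_. x) \<longleftrightarrow> y = x \<cdot> u" for u y
    using Lop_unique[of u y "\<lambda>_. x" "x \<cdot> u"] by metis
  then show ?thesis
    by (auto simp: graph_of_def)
qed

lemma Cauchy2_limit:
  assumes "Cauchy2 X" "z \<in> M" "\<And>v. v \<in> BV \<Longrightarrow> (\<lambda>k. X k \<cdot> v) \<longlonglongrightarrow> z \<cdot> v"
  shows "(\<lambda>k. n2 (X k - z)) \<longlonglongrightarrow> 0"
proof (rule Cauchy2_null)
  show "Cauchy2 (\<lambda>k. X k - z)"
    using assms by (intro Cauchy2_diff) auto
  show "(\<lambda>k. (X k - z) \<cdot> v) \<longlonglongrightarrow> 0" if "v \<in> BV" for v
    using tendsto_diff[OF assms(3)[OF that] tendsto_const[of "z \<cdot> v"]] by simp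
qed

text \<open>Represented operators correspond to Cauchy sequences modulo null sequences. Equality
  forces the difference to vanish pointwise on \<open>BV\<close>, hence in \<open>n2\<close> by
  \<open>Cauchy2_null\<close>; conversely \<open>n2\<close> controls evaluation at bounded
  vectors.\<close>

lemma Lop_eq_iff:
  assumes X: "Cauchy2 X" and Y: "Cauchy2 Y"
  shows "Lop X = Lop Y \<longleftrightarrow> (\<lambda>k. n2 (X k - Y k)) \<longlonglongrightarrow> 0"
proof
  assume eq: "Lop X = Lop Y"
  show "(\<lambda>k. n2 (X k - Y k)) \<longlonglongrightarrow> 0"
  proof (rule Cauchy2_null[OF Cauchy2_diff[OF X Y]])
    fix v assume v: "v \<in> BV"
    then obtain y where y: "(v, y) \<in> Lop X"
      using BV_Domain_Lop[OF X] by blast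
    show "(\<lambda>k. (X k - Y k) \<cdot> v) \<longlonglongrightarrow> 0"
      using tendsto_diff[OF Lop_BV_tendsto[OF X v y] Lop_BV_tendsto[OF Y v y[unfolded eq]]] by simp
  qed
next
  assume lim: "(\<lambda>k. n2 (X k - Y k)) \<longlonglongrightarrow> 0"
  show "Lop X = Lop Y"
  proof (rule Lop_eqI[OF Y closed_operator_Lop[OF X] affiliated_Lop[OF X]])
    fix v y assume v: "v \<in> BV" and y: "(\<lambda>k. Y k \<cdot> v) \<longlonglongrightarrow> y"
    obtain C where C: "\<And>x. x \<in> M \<Longrightarrow> norm (x \<cdot> v) \<le> C * n2 x"
      using v by (metis BV_E)
    have "(\<lambda>k. C * n2 (X k - Y k)) \<longlonglongrightarrow> 0"
      using tendsto_mult_left[OF lim, of C] by simp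
    moreover have "norm ((X k - Y k) \<cdot> v) \<le> C * n2 (X k - Y k)" for k
      using X Y by (intro C) auto
    ultimately have "(\<lambda>k. (X k - Y k) \<cdot> v) \<longlonglongrightarrow> 0"
      using Lim_null_comparison[of "\<lambda>k. (X k - Y k) \<cdot> v" "\<lambda>k. C * n2 (X k - Y k)" sequentially]
      by (simp del: blinfun.diff_left)
    then have "(\<lambda>k. X k \<cdot> v) \<longlonglongrightarrow> y"
      using tendsto_add[OF _ y, of "\<lambda>k. (X k - Y k) \<cdot> v" 0] by simp
    then show "(v, y) \<in> Lop X"
      by (rule Lop_apply)
  qed
qed

text \<open>The closed sum is a closed restriction of the operator on the right and is defined on
  \<open>BV\<close>; \<open>core_eq\<close> removes the ambiguity of domains.\<close>

lemma strong_sum_Lop: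
  assumes X: "Cauchy2 X" and Y: "Cauchy2 Y"
  shows "strong_sum (Lop X) (Lop Y) = Lop (\<lambda>k. X k + Y k)"
proof -
  let ?S = "{(u, v + w) |u v w. (u, v) \<in> Lop X \<and> (u, w) \<in> Lop Y}"
  have XY: "Cauchy2 (\<lambda>k. X k + Y k)"
    by (rule Cauchy2_add[OF X Y])
  note cX = closed_operatorD(1)[OF closed_operator_Lop[OF X]]
  note cY = closed_operatorD(1)[OF closed_operator_Lop[OF Y]]
  have "csubspace ?S"
    unfolding csubspace_def
  proof (intro conjI ballI allI)
    show "0 \<in> ?S"
      using csubspaceD(1)[OF cX] csubspaceD(1)[OF cY] by (auto simp: zero_prod_def intro!: exI[of _ 0])
  next
    fix p q assume "p \<in> ?S" "q \<in> ?S"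
    then obtain u v w u' v' w' where *: "p = (u, v + w)" "q = (u', v' + w')"
      "(u, v) \<in> Lop X" "(u, w) \<in> Lop Y" "(u', v') \<in> Lop X" "(u', w') \<in> Lop Y"
      by blast
    have "p + q = (u + u', (v + v') + (w + w'))" "(u + u', v + v') \<in> Lop X" "(u + u', w + w') \<in> Lop Y"
      using * csubspaceD(2)[OF cX *(3,5)] csubspaceD(2)[OF cY *(4,6)] by simp_all
    then show "p + q \<in> ?S"
      by blast
  next
    fix c p assume "p \<in> ?S"
    then obtain u v w where *: "p = (u, v + w)" "(u, v) \<in> Lop X" "(u, w) \<in> Lop Y"
      by blast
    have "c *\<^sub>C p = (c *\<^sub>C u, c *\<^sub>C v + c *\<^sub>C w)" "(c *\<^sub>C u, c *\<^sub>C v) \<in> Lop X" "(c *\<^sub>C u, c *\<^sub>C w) \<in> Lop Y"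
      using * csubspaceD(3)[OF cX *(2), of c] csubspaceD(3)[OF cY *(3), of c] by (simp_all add: scaleC_add_right)
    then show "c *\<^sub>C p \<in> ?S"
      by blast
  qed
  then have 1: "csubspace (closure ?S)"
    by (rule csubspace_closure)
  have "?S \<subseteq> Lop (\<lambda>k. X k + Y k)"
    unfolding Lop_def by (auto simp: cinner_lin intro!: tendsto_add)
  then have 2: "closure ?S \<subseteq> Lop (\<lambda>k. X k + Y k)"
    by (rule closure_minimal) (rule closed_operatorD(2)[OF closed_operator_Lop[OF XY]])
  have "BV \<subseteq> Domain ?S"
    using BV_Domain_Lop[OF X] BV_Domain_Lop[OF Y] by blast
  then have "BV \<subseteq> Domain (closure ?S)"
    using Domain_mono[OF closure_subset[of ?S]] by blast
  then show ?thesis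
    unfolding strong_sum_def
    by (intro core_eq closed_operator_Lop affiliated_Lop XY 1 2 closed_closure)
qed

lemma strong_scale_Lop:
  assumes X: "Cauchy2 X"
  shows "strong_scale c (Lop X) = Lop (\<lambda>k. c *\<^sub>O X k)"
proof -
  let ?f = "\<lambda>p :: 'h \<times> 'h. (fst p, c *\<^sub>C snd p)"
  have S: "{(u, c *\<^sub>C v) |u v. (u, v) \<in> Lop X} = ?f ` Lop X"
    by force
  have cX: "Cauchy2 (\<lambda>k. c *\<^sub>O X k)"
    by (rule Cauchy2_scale[OF X])
  have "csubspace (?f ` Lop X)"
    by (rule csubspace_image[OF closed_operatorD(1)[OF closed_operator_Lop[OF X]]])
      (auto simp: scaleC_add_right scaleC_prod_def scaleC_scaleC mult.commute zero_prod_def)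
  then have 1: "csubspace (closure (?f ` Lop X))"
    by (rule csubspace_closure)
  have "?f ` Lop X \<subseteq> Lop (\<lambda>k. c *\<^sub>O X k)"
    unfolding Lop_def by (auto simp: cinner_lin intro!: tendsto_mult_left)
  then have 2: "closure (?f ` Lop X) \<subseteq> Lop (\<lambda>k. c *\<^sub>O X k)"
    by (rule closure_minimal) (rule closed_operatorD(2)[OF closed_operator_Lop[OF cX]])
  have "BV \<subseteq> Domain (?f ` Lop X)"
    using BV_Domain_Lop[OF X] by force
  then have "BV \<subseteq> Domain (closure (?f ` Lop X))"
    using Domain_mono[OF closure_subset[of "?f ` Lop X"]] by blast
  then show ?thesis
    unfolding strong_scale_def S
    by (intro core_eq closed_operator_Lop affiliated_Lop cX 1 2 closed_closure)
qed

end

subsection \<open>The space of square-integrable operators\<close>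

lemma cinner_eqI_left: "(\<And>w. cinner a w = cinner b w) \<Longrightarrow> a = (b::'a::complex_hilbert_space)"
  using cinner_self_eq_0[of "a - b"] by (simp add: cinner_diff_left)

lemma blinfun_compose_assoc: "(a o\<^sub>L b) o\<^sub>L c = a o\<^sub>L (b o\<^sub>L c)"
  by (rule blinfun_eqI) simp

text \<open>The bounded approximants \<open>x\<^sup>* x (1 + e x\<^sup>* x)\<^sup>-\<^sup>1\<close> of \<open>x\<^sup>* x\<close>.\<close>

definition resA :: "'h::complex_hilbert_space unbounded_op \<Rightarrow> real \<Rightarrow> 'h \<Rightarrow>\<^sub>L 'h" where
  "resA x e = of_real (1 / e) *\<^sub>O (id_blinfun - resR x e)"

lemma resA_apply: "resA x e \<cdot> v = of_real (1 / e) *\<^sub>C (v - resR x e \<cdot> v)"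
  by (simp add: resA_def scaleC_diff_right)

context
  fixes x :: "'h::complex_hilbert_space unbounded_op"
  assumes x: "closed_operator x"
begin

text \<open>Formally Z_e = x R_e, so the product is R_e x* x R_d, and x* x R_d is
  \<open>resA x d\<close>. Two different parameters are allowed because the cross term of
  \<open>n2_resZ_diff\<close> involves both.\<close>

lemma resZ_product:
  assumes "d > 0" "e > 0"
  shows "adj (resZ x e) o\<^sub>L resZ x d = resR x e o\<^sub>L resA x d"
proof (rule blinfun_eqI, rule cinner_eqI_left)
  fix v w
  have "of_real d * cinner ((adj (resZ x e) o\<^sub>L resZ x d) \<cdot> v) w
      = of_real d * cinner (resZ x d \<cdot> v) (resZ x e \<cdot> w)"
    by (simp add: cinner_adj'[OF clinear_resolvent(2)[OF x assms(2)]])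
  also have "\<dots> = cinner (v - resR x d \<cdot> v) (resR x e \<cdot> w)"
    using resolvent_eq[OF x assms(1) resolvent_graph[OF x assms(2)]] by simp
  also have "\<dots> = of_real d * cinner ((resR x e o\<^sub>L resA x d) \<cdot> v) w"
    using assms by (simp add: resR_cinner[OF x assms(2)] resA_apply cinner_scaleC_left
        clinear_opD[OF clinear_resolvent(1)[OF x assms(2)]])
  finally show "cinner ((adj (resZ x e) o\<^sub>L resZ x d) \<cdot> v) w
      = cinner ((resR x e o\<^sub>L resA x d) \<cdot> v) w"
    using assms by simp
qed

lemma resR_resA: "e > 0 \<Longrightarrow> resR x e = id_blinfun - of_real e *\<^sub>O resA x e"
  by (simp add: resA_def flip: of_real_mult)

lemma clinear_resA: "e > 0 \<Longrightarrow> clinear_op (resA x e)"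
  by (simp add: resA_def clinear_resolvent[OF x])

lemma adj_resA: "e > 0 \<Longrightarrow> adj (resA x e) = resA x e"
  by (simp add: resA_def clinear_resolvent[OF x] adj_resR[OF x])

lemma positive_resA:
  assumes "e > 0"
  shows "positive_op (resA x e)"
  unfolding positive_op_iff
proof (intro allI conjI)
  fix v
  have "cinner (resA x e \<cdot> v) v = cnj (cinner (resA x e \<cdot> v) v)"
    using cinner_adj[OF clinear_resA[OF assms], of v v] cinner_commute[of "resA x e \<cdot> v" v]
    unfolding adj_resA[OF assms] by (metis cinner_commute)
  then show "Im (cinner (resA x e \<cdot> v) v) = 0"
    by (metis Reals_cnj_iff complex_is_Real_iff)
  have "Re (cinner (resR x e \<cdot> v) v) \<le> norm (resR x e \<cdot> v) * norm v"
    by (rule order_trans[OF complex_Re_le_cmod cinner_norm_le])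
  also have "\<dots> \<le> norm v * norm v"
    by (intro mult_right_mono norm_resR_le[OF x assms]) simp
  finally have "0 \<le> (1 / e) * ((norm v)\<^sup>2 - Re (cinner (resR x e \<cdot> v) v))"
    using assms by (simp add: power2_eq_square)
  then show "0 \<le> Re (cinner (resA x e \<cdot> v) v)"
    using assms by (simp add: resA_apply cinner_scaleC_left cinner_diff_left cinner_self del: of_real_power)
qed

text \<open>This makes \<open>resA x e\<close> a competitor in the supremum that defines the trace
  of x* x. The weak form turns its quadratic form at u into <Z u, x u>, and Z u is no longer than x
  u.\<close>

lemma resA_le:
  assumes e: "e > 0" and uc: "(u, c) \<in> x O graph_adj x"
  shows "Re (cinner (resA x e \<cdot> u) u) \<le> Re (cinner c u)"
proof -
  obtain v where v: "(u, v) \<in> x" "(v, c) \<in> graph_adj x"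
    using uc by blast
  then have "cinner v v = cinner u c"
    unfolding graph_adj_def by blast
  then have c: "Re (cinner c u) = (norm v)\<^sup>2"
    by (metis Re_complex_of_real cinner_Re_commute cinner_self)
  have "cinner (resA x e \<cdot> u) u = cinner (resZ x e \<cdot> u) v"
    using resolvent_eq[OF x e v(1), of u] e by (simp add: resA_apply cinner_scaleC_left)
  then have "Re (cinner (resA x e \<cdot> u) u) \<le> norm (resZ x e \<cdot> u) * norm v"
    by (simp only: order_trans[OF complex_Re_le_cmod cinner_norm_le])
  also have "\<dots> \<le> norm v * norm v"
    by (intro mult_right_mono resolvent_approx(2)[OF x e v(1)]) simp
  finally show ?thesis
    by (simp add: c power2_eq_square)
qed

end

section \<open>Bounded approximation of affiliated operators and the extended trace\<close>

context tracial_vna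
begin

context
  fixes x :: "'h unbounded_op"
  assumes x: "closed_operator x" and aff: "affiliated M x"
begin

lemma resA_in_M: "e > 0 \<Longrightarrow> resA x e \<in> M"
  by (simp add: resA_def resolvent_in_M[OF x aff])

lemma tau_resA_le: "e > 0 \<Longrightarrow> ennreal (Re (\<tau> (resA x e))) \<le> extended_trace M \<tau> (x O graph_adj x)"
  unfolding extended_trace_def using resA_le[OF x, of e]
  by (intro SUP_upper CollectI conjI ballI) (auto intro: resA_in_M positive_resA[OF x] simp del: relcomp.simps)

lemma tau_resZ:
  assumes "e > 0"
  shows "(n2 (resZ x e))\<^sup>2 = Re (\<tau> (resA x e)) - e * (n2 (resA x e))\<^sup>2"
proof -
  have "\<tau> (adj (resZ x e) o\<^sub>L resZ x e) = \<tau> (resA x e) - of_real e * \<tau> (adj (resA x e) o\<^sub>L resA x e)"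
    unfolding resZ_product[OF x assms assms] adj_resA[OF x assms] resR_resA[OF x assms]
    using resA_in_M[OF assms] by (simp add: blinfun_compose_distrib)
  then have "Re (of_real ((n2 (resZ x e))\<^sup>2)) = Re (\<tau> (resA x e) - of_real e * of_real ((n2 (resA x e))\<^sup>2))"
    using resA_in_M[OF assms] resolvent_in_M(2)[OF x aff assms] by (simp only: tau_adj_self)
  then show ?thesis
    by (simp del: of_real_power)
qed

text \<open>With a = \<open>resA x d\<close> and b = \<open>resA x e\<close>, expansion by
  \<open>resZ_product\<close> leaves the difference of traces minus d n2(a)^2 + e n2(b)^2 - 2 d Re
  \<tau>(a b), which is nonnegative by Cauchy-Schwarz and d \<le> e. Monotone traces thus control
  the approximants.\<close>

lemma n2_resZ_diff:
  assumes d: "0 < d" and de: "d \<le> e"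
  shows "(n2 (resZ x d - resZ x e))\<^sup>2 \<le> Re (\<tau> (resA x d)) - Re (\<tau> (resA x e))"
proof -
  have e: "e > 0"
    using assms by simp
  let ?a = "resA x d" and ?b = "resA x e"
  note M = resA_in_M[OF d] resA_in_M[OF e] resolvent_in_M(2)[OF x aff d] resolvent_in_M(2)[OF x aff e]
  have "\<tau> (adj (resZ x d) o\<^sub>L resZ x e) = \<tau> ?b - of_real d * \<tau> (adj ?a o\<^sub>L ?b)"
    unfolding resZ_product[OF x e d] adj_resA[OF x d] resR_resA[OF x d]
    using M by (simp add: blinfun_compose_distrib)
  then have S: "Re (\<tau> (adj (resZ x d) o\<^sub>L resZ x e)) = Re (\<tau> ?b) - d * Re (\<tau> (adj ?a o\<^sub>L ?b))"
    by simp
  have "(n2 (resZ x d - resZ x e))\<^sup>2 = (n2 (resZ x d))\<^sup>2 + (n2 (resZ x e))\<^sup>2 - 2 * Re (\<tau> (adj (resZ x d) o\<^sub>L resZ x e))"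
    using n2_add_scale[OF M(3,4), of "-1"] by simp
  also have "\<dots> = Re (\<tau> ?a) - Re (\<tau> ?b) - (d * (n2 ?a)\<^sup>2 + e * (n2 ?b)\<^sup>2 - d * (2 * Re (\<tau> (adj ?a o\<^sub>L ?b))))"
    unfolding S tau_resZ[OF d] tau_resZ[OF e] by (simp add: algebra_simps)
  also have "\<dots> \<le> Re (\<tau> ?a) - Re (\<tau> ?b)"
  proof -
    have "Re (\<tau> (adj ?a o\<^sub>L ?b)) \<le> n2 ?a * n2 ?b"
      by (rule order_trans[OF complex_Re_le_cmod tau_Cauchy_Schwarz[OF M(1,2)]])
    then have "2 * Re (\<tau> (adj ?a o\<^sub>L ?b)) \<le> (n2 ?a)\<^sup>2 + (n2 ?b)\<^sup>2"
      using sum_squares_bound[of "n2 ?a" "n2 ?b"] by linarith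
    then have "d * (2 * Re (\<tau> (adj ?a o\<^sub>L ?b))) \<le> d * ((n2 ?a)\<^sup>2 + (n2 ?b)\<^sup>2)"
      using d by (intro mult_left_mono) auto
    moreover have "d * (n2 ?b)\<^sup>2 \<le> e * (n2 ?b)\<^sup>2"
      using de by (intro mult_right_mono) auto
    ultimately show ?thesis
      by (simp add: distrib_left)
  qed
  finally show ?thesis .
qed

text \<open>The representing sequence is \<open>resZ x e\<close> for e = 1 / (k + 1). The traces of
  \<open>resA x e\<close> increase and are bounded by the trace of x* x, so
  \<open>n2_resZ_diff\<close> makes it Cauchy; closedness of x identifies the limit.\<close>

lemma affiliated_eq_Lop:
  assumes fin: "extended_trace M \<tau> (x O graph_adj x) < \<infinity>"
  obtains X where "Cauchy2 X" "x = Lop X"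
proof -
  define E where "E = enn2real (extended_trace M \<tau> (x O graph_adj x))"
  define Z where "Z k = resZ x (1 / real (Suc k))" for k
  define t where "t k = Re (\<tau> (resA x (1 / real (Suc k))))" for k
  have t_le: "t k \<le> E" for k
  proof -
    have "ennreal (t k) \<le> ennreal E"
      unfolding t_def E_def using tau_resA_le[of "1 / real (Suc k)"] fin by (simp add: less_top)
    then show ?thesis
      by (simp add: E_def ennreal_le_iff)
  qed
  have diff: "(n2 (Z j - Z k))\<^sup>2 \<le> t j - t k" if "k \<le> j" for j k
    unfolding Z_def t_def using that by (intro n2_resZ_diff) (auto simp: frac_le)
  have inc: "incseq t"
  proof (rule incseq_SucI)
    show "t k \<le> t (Suc k)" for k
      using order_trans[OF zero_le_power2 diff[of k "Suc k"]] by simp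
  qed
  have "convergent t"
    by (rule incseq_convergent[OF inc]) (use t_le in \<open>auto simp: convergent_def\<close>)
  then have "Cauchy t"
    by (rule convergent_Cauchy)
  have ZM: "Z k \<in> M" for k
    unfolding Z_def by (rule resolvent_in_M(2)[OF x aff]) simp
  have "Cauchy2 Z"
    unfolding Cauchy2_def
  proof (intro conjI allI impI ZM)
    fix e :: real assume e: "e > 0"
    obtain N where N: "\<And>j k. j \<ge> N \<Longrightarrow> k \<ge> N \<Longrightarrow> dist (t j) (t k) < e\<^sup>2"
      using metric_CauchyD[OF \<open>Cauchy t\<close>, of "e\<^sup>2"] e by auto
    have lt: "n2 (Z j - Z k) < e" if "j \<ge> N" "k \<ge> N" "k \<le> j" for j k
    proof -
      have "(n2 (Z j - Z k))\<^sup>2 < e\<^sup>2"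
        using diff[OF that(3)] N[OF that(1,2)] by (simp add: dist_real_def)
      then show ?thesis
        by (rule power2_less_imp_less) (use e in simp)
    qed
    have "n2 (Z j - Z k) < e" if "j \<ge> N" "k \<ge> N" for j k
      using lt[OF that] lt[OF that(2,1)] n2_minus_commute[OF ZM ZM, of j k] by (cases "k \<le> j") auto
    then show "\<exists>N. \<forall>j\<ge>N. \<forall>k\<ge>N. n2 (Z j - Z k) < e"
      by blast
  qed
  moreover have "x = Lop Z"
  proof (rule Lop_eqI[OF \<open>Cauchy2 Z\<close> x aff])
    fix v y assume lim: "(\<lambda>k. Z k \<cdot> v) \<longlonglongrightarrow> y"
    have "(\<lambda>k. ((resR x (1 / real (Suc k))) \<cdot> v, Z k \<cdot> v)) \<longlonglongrightarrow> (v, y)"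
      by (intro tendsto_Pair lim resR_tendsto[OF x])
    moreover have "((resR x (1 / real (Suc k))) \<cdot> v, Z k \<cdot> v) \<in> x" for k
      unfolding Z_def by (rule resolvent_graph[OF x]) simp
    ultimately show "(v, y) \<in> x"
      by (rule closed_sequentially[OF closed_operatorD(2)[OF x], rotated])
  qed
  ultimately show thesis
    by (rule that)
qed

lemma n2_resR_tendsto: "(\<lambda>k. n2 (id_blinfun - resR x (1 / real (Suc k)))) \<longlonglongrightarrow> 0"
proof (rule n2_strong_null)
  show "id_blinfun - resR x (1 / real (Suc k)) \<in> M" for k
    by (intro M_diff M_id_zero resolvent_in_M[OF x aff]) simp
  show "norm (id_blinfun - resR x (1 / real (Suc k))) \<le> 2" for k
    using norm_triangle_ineq4[of id_blinfun "resR x (1 / real (Suc k))"] norm_resR[OF x, of "1 / real (Suc k)"]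
      norm_blinfun_id_le[where 'a='h] by simp
  show "(\<lambda>k. (id_blinfun - resR x (1 / real (Suc k))) \<cdot> v) \<longlonglongrightarrow> 0" for v
    using tendsto_diff[OF tendsto_const[of v] resR_tendsto[OF x, of v]] by simp
qed

text \<open>An inequality between b and x* x only speaks about the domain of x* x. Compressing by
  \<open>resR\<close> moves all vectors into that domain and compares two bounded operators, R b R
  and \<open>adj Z o\<^sub>L Z\<close>.\<close>

lemma admissible_compress:
  assumes e: "e > 0" and b: "b \<in> M" "positive_op b"
    and le: "\<forall>(u, v)\<in>x O graph_adj x. Re (cinner (b \<cdot> u) u) \<le> Re (cinner v u)"
  shows "Re (\<tau> (resR x e o\<^sub>L b o\<^sub>L resR x e)) \<le> (n2 (resZ x e))\<^sup>2"
proof -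
  let ?R = "resR x e" and ?Z = "resZ x e"
  note RM = resolvent_in_M(1)[OF x aff e] and ZM = resolvent_in_M(2)[OF x aff e]
  have "Re (\<tau> (?R o\<^sub>L b o\<^sub>L ?R)) \<le> Re (\<tau> (adj ?Z o\<^sub>L ?Z))"
  proof (rule tau_mono)
    fix v
    have R: "cinner ((?R o\<^sub>L b o\<^sub>L ?R) \<cdot> v) v = cinner (b \<cdot> (?R \<cdot> v)) (?R \<cdot> v)"
      by (simp add: resR_cinner[OF x e])
    have Z: "cinner ((adj ?Z o\<^sub>L ?Z) \<cdot> v) v = of_real ((norm (?Z \<cdot> v))\<^sup>2)"
      using ZM by (simp add: cinner_adj' cinner_self)
    show "Im (cinner ((?R o\<^sub>L b o\<^sub>L ?R) \<cdot> v) v) = Im (cinner ((adj ?Z o\<^sub>L ?Z) \<cdot> v) v)"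
      unfolding R Z using b(2) by (simp add: positive_op_iff del: of_real_power)
    have "Re (cinner (b \<cdot> (?R \<cdot> v)) (?R \<cdot> v))
        \<le> Re (cinner (of_real (1 / e) *\<^sub>C (v - ?R \<cdot> v)) (?R \<cdot> v))"
      using le resolvent_square[OF x e, of v] by blast
    also have "cinner (of_real (1 / e) *\<^sub>C (v - ?R \<cdot> v)) (?R \<cdot> v)
        = of_real ((norm (?Z \<cdot> v))\<^sup>2)"
      unfolding cinner_scaleC_left resZ_cinner[OF x e, symmetric] cinner_self
      using e by (simp add: mult.assoc[symmetric] flip: of_real_mult)
    finally show "Re (cinner ((?R o\<^sub>L b o\<^sub>L ?R) \<cdot> v) v) \<le> Re (cinner ((adj ?Z o\<^sub>L ?Z) \<cdot> v) v)"
      unfolding R Z .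
  qed (use RM ZM b in auto)
  then show ?thesis
    using ZM by (simp add: tau_adj_self)
qed

lemma compress_tendsto:
  assumes b: "b \<in> M"
  shows "(\<lambda>k. \<tau> (resR x (1 / real (Suc k)) o\<^sub>L b o\<^sub>L resR x (1 / real (Suc k)))) \<longlonglongrightarrow> \<tau> b"
proof -
  let ?R = "\<lambda>k. resR x (1 / real (Suc k))"
  have "cmod (\<tau> (?R k o\<^sub>L b o\<^sub>L ?R k) - \<tau> b) \<le> 2 * norm b * n2 (id_blinfun - ?R k)" for k
  proof -
    have RM: "?R k \<in> M"
      by (rule resolvent_in_M(1)[OF x aff]) simp
    let ?D = "id_blinfun - ?R k"
    have D: "?D \<in> M"
      using RM by simp
    have "\<tau> b - \<tau> (?R k o\<^sub>L b o\<^sub>L ?R k) = \<tau> (?D o\<^sub>L b) + \<tau> (?R k o\<^sub>L b o\<^sub>L ?D)"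
      using RM b by (simp add: blinfun_compose_distrib blinfun_compose_assoc)
    also have "cmod \<dots> \<le> n2 (?D o\<^sub>L b) + n2 (?R k o\<^sub>L b o\<^sub>L ?D)"
      using RM b D by (intro norm_triangle_le add_mono cmod_tau_le) auto
    also have "\<dots> \<le> norm b * n2 ?D + norm b * n2 ?D"
    proof (intro add_mono)
      show "n2 (?D o\<^sub>L b) \<le> norm b * n2 ?D"
        by (rule n2_compose_right[OF D b])
      have "n2 (?R k o\<^sub>L b o\<^sub>L ?D) \<le> norm (?R k o\<^sub>L b) * n2 ?D"
        using RM b D by (intro n2_compose_left) auto
      also have "\<dots> \<le> (1 * norm b) * n2 ?D"
      proof (rule mult_right_mono)
        show "norm (?R k o\<^sub>L b) \<le> 1 * norm b"
          by (rule order_trans[OF norm_blinfun_compose mult_right_mono[OF norm_resR[OF x] norm_ge_zero]]) simp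
      qed (use D in simp)
      finally show "n2 (?R k o\<^sub>L b o\<^sub>L ?D) \<le> norm b * n2 ?D"
        by simp
    qed
    finally show ?thesis
      by (simp add: norm_minus_commute)
  qed
  moreover have "(\<lambda>k. 2 * norm b * n2 (id_blinfun - ?R k)) \<longlonglongrightarrow> 0"
    using tendsto_mult_left[OF n2_resR_tendsto, of "2 * norm b"] by simp
  ultimately have "(\<lambda>k. \<tau> (?R k o\<^sub>L b o\<^sub>L ?R k) - \<tau> b) \<longlonglongrightarrow> 0"
    using Lim_null_comparison[of "\<lambda>k. \<tau> (?R k o\<^sub>L b o\<^sub>L ?R k) - \<tau> b" "\<lambda>k. 2 * norm b * n2 (id_blinfun - ?R k)" sequentially]
    by simp
  then show ?thesis
    by (simp add: LIM_zero_iff)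
qed

end

text \<open>The resolvent maps \<open>BV\<close> into itself, so X k R converges pointwise there to
  x R, which is the bounded operator \<open>resZ\<close>. For a limit in M,
  \<open>Cauchy2_limit\<close> upgrades this to \<open>n2\<close>.\<close>

lemma Lop_resolvent_tendsto:
  assumes X: "Cauchy2 X" and e: "e > 0"
  shows "(\<lambda>k. n2 ((X k o\<^sub>L resR (Lop X) e) - resZ (Lop X) e)) \<longlonglongrightarrow> 0"
proof (rule Cauchy2_limit)
  note x = closed_operator_Lop[OF X] and aff = affiliated_Lop[OF X]
  show "Cauchy2 (\<lambda>k. X k o\<^sub>L resR (Lop X) e)"
    by (rule Cauchy2_compose_right[OF X resolvent_in_M(1)[OF x aff e]])
  show "resZ (Lop X) e \<in> M"
    by (rule resolvent_in_M(2)[OF x aff e])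
  fix v assume "v \<in> BV"
  then show "(\<lambda>k. (X k o\<^sub>L resR (Lop X) e) \<cdot> v) \<longlonglongrightarrow> resZ (Lop X) e \<cdot> v"
    using Lop_BV_tendsto[OF X BV_M[OF resolvent_in_M(1)[OF x aff e]] resolvent_graph[OF x e]] by simp
qed

text \<open>Upper bound: for admissible b the trace is the limit of the traces of R b R, each at
  most n2 (Z)^2, and n2 Z \<le> L since Z is the limit of X j R with R a contraction. Lower bound:
  n2 (Z)^2 is at most the trace of the admissible \<open>resA\<close>, and n2 Z comes arbitrarily
  close to L.\<close>

lemma extended_trace_Lop:
  assumes X: "Cauchy2 X" and L: "(\<lambda>k. n2 (X k)) \<longlonglongrightarrow> L"
  shows "extended_trace M \<tau> (Lop X O graph_adj (Lop X)) = ennreal (L\<^sup>2)"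
proof -
  note x = closed_operator_Lop[OF X] and aff = affiliated_Lop[OF X]
  let ?R = "\<lambda>k. resR (Lop X) (1 / real (Suc k))" and ?Z = "\<lambda>k. resZ (Lop X) (1 / real (Suc k))"
  have e: "1 / real (Suc k) > 0" for k
    by simp
  note RM = resolvent_in_M(1)[OF x aff e] and ZM = resolvent_in_M(2)[OF x aff e]
  have L0: "L \<ge> 0"
    using X by (intro LIMSEQ_le_const[OF L]) auto
  have Z_le: "n2 (?Z k) \<le> L" for k
  proof (rule LIMSEQ_le)
    show "(\<lambda>j. n2 (?Z k)) \<longlonglongrightarrow> n2 (?Z k)"
      by simp
    show "(\<lambda>j. n2 (X j) + n2 ((X j o\<^sub>L ?R k) - ?Z k)) \<longlonglongrightarrow> L"
      using tendsto_add[OF L Lop_resolvent_tendsto[OF X e]] by simp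
    have "n2 (?Z k) \<le> n2 (X j) + n2 ((X j o\<^sub>L ?R k) - ?Z k)" for j
    proof -
      have "n2 (?Z k) \<le> n2 (X j o\<^sub>L ?R k) + n2 (?Z k - (X j o\<^sub>L ?R k))"
        using n2_triangle[of "X j o\<^sub>L ?R k" "?Z k - (X j o\<^sub>L ?R k)"] X RM ZM by simp
      also have "n2 (X j o\<^sub>L ?R k) \<le> norm (?R k) * n2 (X j)"
        by (rule n2_compose_right[OF Cauchy2_M[OF X] RM])
      also have "\<dots> \<le> 1 * n2 (X j)"
        using norm_resR[OF x e] X by (intro mult_right_mono) auto
      finally show ?thesis
        using n2_minus_commute[of "?Z k" "X j o\<^sub>L ?R k"] X RM ZM by simp
    qed
    then show "\<exists>N. \<forall>j\<ge>N. n2 (?Z k) \<le> n2 (X j) + n2 ((X j o\<^sub>L ?R k) - ?Z k)"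
      by blast
  qed
  show ?thesis
  proof (rule antisym)
    show "extended_trace M \<tau> (Lop X O graph_adj (Lop X)) \<le> ennreal (L\<^sup>2)"
      unfolding extended_trace_def
    proof (rule SUP_least)
      fix b assume "b \<in> {b \<in> M. positive_op b \<and> (\<forall>(u, v)\<in>Lop X O graph_adj (Lop X).
          Re (cinner (b \<cdot> u) u) \<le> Re (cinner v u))}"
      then have b: "b \<in> M" "positive_op b" "\<forall>(u, v)\<in>Lop X O graph_adj (Lop X).
          Re (cinner (b \<cdot> u) u) \<le> Re (cinner v u)"
        by auto
      have "Re (\<tau> b) \<le> L\<^sup>2"
      proof (rule LIMSEQ_le_const2[OF tendsto_Re[OF compress_tendsto[OF x aff b(1)]]])
        have "(n2 (?Z k))\<^sup>2 \<le> L\<^sup>2" for k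
          using Z_le ZM by (intro power_mono) auto
        then show "\<exists>N. \<forall>k\<ge>N. Re (\<tau> (?R k o\<^sub>L b o\<^sub>L ?R k)) \<le> L\<^sup>2"
          using order_trans[OF admissible_compress[OF x aff e b]] by blast
      qed
      then show "ennreal (Re (\<tau> b)) \<le> ennreal (L\<^sup>2)"
        by (rule ennreal_leI)
    qed
  next
    let ?E = "extended_trace M \<tau> (Lop X O graph_adj (Lop X))"
    have Z_ge: "\<exists>k. L - r \<le> n2 (?Z k)" if r: "r > 0" for r
    proof -
      obtain N where N: "\<And>i j. i \<ge> N \<Longrightarrow> j \<ge> N \<Longrightarrow> n2 (X i - X j) < r / 4"
        using Cauchy2_D[OF X, of "r / 4"] r by auto
      obtain N' where N': "\<And>j. j \<ge> N' \<Longrightarrow> \<bar>n2 (X j) - L\<bar> < r / 4"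
        using LIMSEQ_D[OF L, of "r / 4"] r by auto
      \<comment> \<open>j is fixed before k, so that \<open>norm (X j)\<close> is a constant against
        which n2 (1 - R) becomes small. The estimate of X j R - Z holds for every k, by letting i
        tend to infinity.\<close>
      define j where "j = max N N'"
      have "(\<lambda>k. norm (X j) * n2 (id_blinfun - ?R k)) \<longlonglongrightarrow> norm (X j) * 0"
        by (intro tendsto_mult_left n2_resR_tendsto[OF x aff])
      then have "\<forall>\<^sub>F k in sequentially. norm (X j) * n2 (id_blinfun - ?R k) < r / 4"
        using r by (intro order_tendstoD(2)) auto
      then obtain k where k: "norm (X j) * n2 (id_blinfun - ?R k) < r / 4"
        by (auto simp: eventually_sequentially)
      have "n2 ((X j o\<^sub>L ?R k) - ?Z k) \<le> r / 4"
      proof (rule LIMSEQ_le)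
        show "(\<lambda>i. n2 ((X j o\<^sub>L ?R k) - ?Z k)) \<longlonglongrightarrow> n2 ((X j o\<^sub>L ?R k) - ?Z k)"
          by simp
        show "(\<lambda>i. r / 4 + n2 ((X i o\<^sub>L ?R k) - ?Z k)) \<longlonglongrightarrow> r / 4"
          using tendsto_add[OF tendsto_const Lop_resolvent_tendsto[OF X e]] by simp
        have "n2 ((X j o\<^sub>L ?R k) - ?Z k) \<le> r / 4 + n2 ((X i o\<^sub>L ?R k) - ?Z k)" if "i \<ge> N" for i
        proof -
          have "n2 ((X j o\<^sub>L ?R k) - ?Z k) \<le> n2 ((X j o\<^sub>L ?R k) - (X i o\<^sub>L ?R k)) + n2 ((X i o\<^sub>L ?R k) - ?Z k)"
            using X RM ZM by (intro n2_triangle_diff) auto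
          also have "n2 ((X j o\<^sub>L ?R k) - (X i o\<^sub>L ?R k)) \<le> norm (?R k) * n2 (X j - X i)"
            using n2_compose_right[of "X j - X i" "?R k"] X RM by (simp add: blinfun_compose_distrib)
          also have "\<dots> \<le> 1 * n2 (X j - X i)"
            using norm_resR[OF x e] X by (intro mult_right_mono) auto
          also have "n2 (X j - X i) \<le> r / 4"
            using N[of j i] that by (simp add: j_def)
          finally show ?thesis
            by simp
        qed
        then show "\<exists>N. \<forall>i\<ge>N. n2 ((X j o\<^sub>L ?R k) - ?Z k) \<le> r / 4 + n2 ((X i o\<^sub>L ?R k) - ?Z k)"
          by blast
      qed
      moreover have "n2 (X j - (X j o\<^sub>L ?R k)) < r / 4"
        using n2_compose_left[of "X j" "id_blinfun - ?R k"] k X RM by (simp add: blinfun_compose_distrib)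
      moreover have "n2 (X j) \<le> n2 (X j - ?Z k) + n2 (?Z k)"
        using n2_triangle[of "X j - ?Z k" "?Z k"] X ZM by simp
      moreover have "n2 (X j - ?Z k) \<le> n2 (X j - (X j o\<^sub>L ?R k)) + n2 ((X j o\<^sub>L ?R k) - ?Z k)"
        using X RM ZM by (intro n2_triangle_diff) auto
      moreover have "\<bar>n2 (X j) - L\<bar> < r / 4"
        by (rule N') (simp add: j_def)
      ultimately have "L - r \<le> n2 (?Z k)"
        using r by linarith
      then show ?thesis
        by blast
    qed
    have ge: "ennreal ((n2 (?Z k))\<^sup>2) \<le> ?E" for k
    proof -
      have "(n2 (?Z k))\<^sup>2 \<le> Re (\<tau> (resA (Lop X) (1 / real (Suc k))))"
        unfolding tau_resZ[OF x aff e] by simp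
      then show ?thesis
        by (rule order_trans[OF ennreal_leI tau_resA_le[OF x aff e]])
    qed
    show "ennreal (L\<^sup>2) \<le> ?E"
    proof (cases "?E = \<infinity>")
      case False
      then obtain E where E: "?E = ennreal E" "E \<ge> 0"
        by (cases ?E) auto
      have "n2 (?Z k) \<le> sqrt E" for k
        using ge[of k] E by (intro real_le_rsqrt) (simp add: ennreal_le_iff)
      then have "L \<le> sqrt E + r" if "r > 0" for r
        using Z_ge[OF that] by (metis diff_le_eq order_trans)
      then have "L \<le> sqrt E"
        by (rule field_le_epsilon)
      then have "L\<^sup>2 \<le> (sqrt E)\<^sup>2"
        using L0 by (intro power_mono)
      then show ?thesis
        using E by (simp add: ennreal_leI)
    qed simp
  qed
qed

end

subsection \<open>Square roots and trace measurability\<close>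

text \<open>The iteration \<open>S \<mapsto> (A + S\<^sup>2) / 2\<close> converges to \<open>1 - \<surd>(1 - A)\<close> for
  contractions \<open>A\<close>; its scalar version for \<open>A = 1\<close> is a majorant.\<close>

primrec sqrt_iter :: "('h::complex_hilbert_space \<Rightarrow>\<^sub>L 'h) \<Rightarrow> nat \<Rightarrow> ('h \<Rightarrow>\<^sub>L 'h)" where
  "sqrt_iter A 0 = 0"
| "sqrt_iter A (Suc n) = (1/2) *\<^sub>R (A + (sqrt_iter A n o\<^sub>L sqrt_iter A n))"

primrec sqrt_majorant :: "nat \<Rightarrow> real" where
  "sqrt_majorant 0 = 0"
| "sqrt_majorant (Suc n) = (1 + (sqrt_majorant n)\<^sup>2) / 2"

lemma sqrt_majorant_bounds: "0 \<le> sqrt_majorant n" "sqrt_majorant n \<le> 1"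
proof (induction n)
  case (Suc n)
  { case 1 show ?case by simp }
  { case 2 show ?case using power_le_one[OF Suc, of 2] by simp }
qed simp_all

lemma sqrt_majorant_mono: "sqrt_majorant n \<le> sqrt_majorant (Suc n)"
proof -
  have "0 \<le> (1 - sqrt_majorant n)\<^sup>2"
    by simp
  then show ?thesis
    by (simp add: power2_eq_square algebra_simps)
qed

lemma norm_sqrt_iter:
  assumes "norm A \<le> 1"
  shows "norm (sqrt_iter A n) \<le> sqrt_majorant n"
proof (induction n)
  case (Suc n)
  have "norm (sqrt_iter A n o\<^sub>L sqrt_iter A n) \<le> norm (sqrt_iter A n) * norm (sqrt_iter A n)"
    by (rule norm_blinfun_compose)
  also have "\<dots> \<le> sqrt_majorant n * sqrt_majorant n"
    by (intro mult_mono Suc norm_ge_zero sqrt_majorant_bounds)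
  finally have "norm (A + (sqrt_iter A n o\<^sub>L sqrt_iter A n)) \<le> 1 + (sqrt_majorant n)\<^sup>2"
    using norm_triangle_ineq[of A "sqrt_iter A n o\<^sub>L sqrt_iter A n"] assms by (simp add: power2_eq_square)
  then show ?case
    by simp
qed simp

text \<open>The identity T^2 - S^2 = T (T - S) + (T - S) S bounds each increment by preceding data;
  the scalar majorant satisfies the same recursion with equality.\<close>

lemma norm_sqrt_iter_step:
  assumes "norm A \<le> 1"
  shows "norm (sqrt_iter A (Suc n) - sqrt_iter A n) \<le> sqrt_majorant (Suc n) - sqrt_majorant n"
proof (induction n)
  case 0
  then show ?case
    using assms by simp
next
  case (Suc n)
  let ?S = "sqrt_iter A n" and ?T = "sqrt_iter A (Suc n)"
  let ?s = "sqrt_majorant n" and ?t = "sqrt_majorant (Suc n)"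
  have "sqrt_iter A (Suc (Suc n)) - ?T = (1/2) *\<^sub>R (A + (?T o\<^sub>L ?T)) - (1/2) *\<^sub>R (A + (?S o\<^sub>L ?S))"
    by (simp only: sqrt_iter.simps)
  also have "\<dots> = (1/2) *\<^sub>R ((?T o\<^sub>L (?T - ?S)) + ((?T - ?S) o\<^sub>L ?S))"
    by (simp only: blinfun_compose_distrib scaleR_right_diff_distrib[symmetric]) simp
  finally have "norm (sqrt_iter A (Suc (Suc n)) - ?T) \<le> (1/2) * norm ((?T o\<^sub>L (?T - ?S)) + ((?T - ?S) o\<^sub>L ?S))"
    by simp
  also have "norm ((?T o\<^sub>L (?T - ?S)) + ((?T - ?S) o\<^sub>L ?S)) \<le> norm ?T * norm (?T - ?S) + norm (?T - ?S) * norm ?S"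
    by (rule order_trans[OF norm_triangle_ineq]) (intro add_mono norm_blinfun_compose)
  also have "\<dots> \<le> ?t * (?t - ?s) + (?t - ?s) * ?s"
    by (intro add_mono mult_mono norm_sqrt_iter assms Suc norm_ge_zero sqrt_majorant_bounds)
      (use sqrt_majorant_mono[of n] in simp)
  also have "(1/2) * (?t * (?t - ?s) + (?t - ?s) * ?s) = sqrt_majorant (Suc (Suc n)) - ?t"
  proof -
    have "(1/2) * (t * (t - s) + (t - s) * s) = (1 + t\<^sup>2) / 2 - (1 + s\<^sup>2) / 2" for s t :: real
      by (simp add: power2_eq_square field_simps)
    then show ?thesis
      unfolding sqrt_majorant.simps(2)[of "Suc n"] by (metis sqrt_majorant.simps(2))
  qed
  finally show ?case
    by simp
qed

lemma sqrt_iter_convergent: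
  assumes A: "norm A \<le> 1"
  obtains S where "(sqrt_iter A) \<longlonglongrightarrow> S" "norm S \<le> 1" "S = (1/2) *\<^sub>R (A + (S o\<^sub>L S))"
proof -
  have step: "norm (sqrt_iter A m - sqrt_iter A n) \<le> sqrt_majorant m - sqrt_majorant n" if "n \<le> m" for m n
    using that
  proof (induction m rule: dec_induct)
    case (step m)
    have "sqrt_iter A (Suc m) - sqrt_iter A n = (sqrt_iter A (Suc m) - sqrt_iter A m) + (sqrt_iter A m - sqrt_iter A n)"
      by simp
    then have "norm (sqrt_iter A (Suc m) - sqrt_iter A n)
        \<le> norm (sqrt_iter A (Suc m) - sqrt_iter A m) + norm (sqrt_iter A m - sqrt_iter A n)"
      using norm_triangle_ineq by metis
    then show ?case
      using step.IH norm_sqrt_iter_step[OF A, of m] by linarith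
  qed simp
  have "convergent sqrt_majorant"
    using incseq_convergent[OF incseq_SucI[of sqrt_majorant], OF sqrt_majorant_mono] sqrt_majorant_bounds(2)
    unfolding convergent_def by metis
  then have C: "Cauchy sqrt_majorant"
    by (rule convergent_Cauchy)
  have "Cauchy (sqrt_iter A)"
  proof (rule metric_CauchyI)
    fix e :: real assume "e > 0"
    then obtain N where N: "\<And>m n. m \<ge> N \<Longrightarrow> n \<ge> N \<Longrightarrow> dist (sqrt_majorant m) (sqrt_majorant n) < e"
      using metric_CauchyD[OF C] by metis
    have lt: "dist (sqrt_iter A m) (sqrt_iter A n) < e" if "m \<ge> N" "n \<ge> N" "n \<le> m" for m n
      using step[OF that(3)] N[OF that(1,2)] by (simp add: dist_norm)
    have "dist (sqrt_iter A m) (sqrt_iter A n) < e" if "m \<ge> N" "n \<ge> N" for m n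
      using lt[OF that] lt[OF that(2,1)] by (cases "n \<le> m") (auto simp: dist_commute)
    then show "\<exists>N. \<forall>m\<ge>N. \<forall>n\<ge>N. dist (sqrt_iter A m) (sqrt_iter A n) < e"
      by blast
  qed
  then obtain S where S: "(sqrt_iter A) \<longlonglongrightarrow> S"
    using Cauchy_convergent convergent_def by blast
  have "norm S \<le> 1"
    by (rule LIMSEQ_le_const2[OF tendsto_norm[OF S]])
      (use order_trans[OF norm_sqrt_iter[OF A] sqrt_majorant_bounds(2)] in blast)
  moreover have "(\<lambda>n. sqrt_iter A (Suc n)) \<longlonglongrightarrow> (1/2) *\<^sub>R (A + (S o\<^sub>L S))"
    unfolding sqrt_iter.simps
    by (intro tendsto_intros S bounded_bilinear.tendsto[OF bounded_bilinear_blinfun_compose])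
  then have "S = (1/2) *\<^sub>R (A + (S o\<^sub>L S))"
    using LIMSEQ_unique[OF LIMSEQ_Suc[OF S]] by blast
  ultimately show thesis
    using that S by blast
qed

lemma tendsto_zero_dense:
  fixes X :: "nat \<Rightarrow> 'a::real_normed_vector \<Rightarrow>\<^sub>L 'b::real_normed_vector"
  assumes bound: "\<And>k. norm (X k) \<le> C" and D: "closure D = UNIV"
    and lim: "\<And>w. w \<in> D \<Longrightarrow> (\<lambda>k. X k \<cdot> w) \<longlonglongrightarrow> 0"
  shows "(\<lambda>k. X k \<cdot> v) \<longlonglongrightarrow> 0"
proof (rule metric_LIMSEQ_I)
  fix r :: real assume r: "r > 0"
  have C: "C \<ge> 0"
    using order_trans[OF norm_ge_zero bound[of 0]] .
  have "v \<in> closure D"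
    using D by simp
  moreover have "r / (2 * (C + 1)) > 0"
    using r C by simp
  ultimately obtain w where w: "w \<in> D" "dist w v < r / (2 * (C + 1))"
    using closure_approachable by metis
  obtain K where K: "\<And>k. k \<ge> K \<Longrightarrow> norm (X k \<cdot> w) < r / 2"
    using metric_LIMSEQ_D[OF lim[OF w(1)], of "r / 2"] r by auto
  have "norm (X k \<cdot> v) < r" if "k \<ge> K" for k
  proof -
    have "norm (X k \<cdot> (v - w)) \<le> norm (X k) * norm (v - w)"
      by (rule norm_blinfun)
    also have "\<dots> \<le> (C + 1) * (r / (2 * (C + 1)))"
      using bound[of k] w(2) C by (intro mult_mono) (auto simp: dist_norm norm_minus_commute)
    also have "\<dots> = r / 2"
      using C by (simp add: field_simps)
    finally have "norm (X k \<cdot> v - X k \<cdot> w) \<le> r / 2"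
      by (simp add: blinfun.diff_right)
    then show ?thesis
      using K[OF that] norm_triangle_sub[of "X k \<cdot> v" "X k \<cdot> w"] by simp
  qed
  then show "\<exists>K. \<forall>k\<ge>K. dist (X k \<cdot> v) 0 < r"
    by auto
qed

lemma csubspace_imp_subspace: "csubspace S \<Longrightarrow> subspace S"
  by (rule subspaceI) (auto simp: csubspace_def scaleR_scaleC)

context tracial_vna
begin

lemma M_cinner_real:
  assumes "x \<in> M" "adj x = x"
  shows "Im (cinner (x \<cdot> v) v) = 0"
proof -
  have "cinner (x \<cdot> v) v = cnj (cinner (x \<cdot> v) v)"
    using cinner_adj[OF M_clinear[OF assms(1)], of v v] unfolding assms(2) by (metis cinner_commute)
  then show ?thesis
    by (metis Reals_cnj_iff complex_is_Real_iff)
qed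

text \<open>Here A = 1 - B^2, and the fixed point equation 2 S = A + S^2 says exactly (1 - S)^2 =
  B^2. The result is 1 - S, positive because S is a self-adjoint contraction. Membership in M,
  self-adjointness and commutation with B pass from the iterates to S.\<close>

lemma absolute_value_exists:
  assumes B: "B \<in> M" "adj B = B" "norm B \<le> 1"
  obtains s where "s \<in> M" "adj s = s" "positive_op s" "s o\<^sub>L s = B o\<^sub>L B" "s o\<^sub>L B = B o\<^sub>L s"
proof -
  define A where "A = id_blinfun - (B o\<^sub>L B)"
  have AM: "A \<in> M" and adjA: "adj A = A" and AB: "A o\<^sub>L B = B o\<^sub>L A"
    using B by (simp_all add: A_def blinfun_compose_distrib blinfun_compose_assoc)
  have "norm A \<le> 1"
  proof (rule norm_blinfun_bound)
    fix v
    have "Re (cinner v (B \<cdot> (B \<cdot> v))) = (norm (B \<cdot> v))\<^sup>2"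
      using cinner_adj[OF M_clinear[OF B(1)], of v "B \<cdot> v"] B(2)
      by (metis Re_complex_of_real cinner_self)
    then have eq: "(norm (A \<cdot> v))\<^sup>2
        = (norm v)\<^sup>2 + (norm (B \<cdot> (B \<cdot> v)))\<^sup>2 - 2 * (norm (B \<cdot> v))\<^sup>2"
      by (simp add: A_def norm_diff_cinner)
    have "norm (B \<cdot> (B \<cdot> v)) \<le> 1 * norm (B \<cdot> v)"
      by (rule order_trans[OF norm_blinfun mult_right_mono[OF B(3)]]) simp
    then have "(norm (B \<cdot> (B \<cdot> v)))\<^sup>2 \<le> (norm (B \<cdot> v))\<^sup>2"
      by (simp add: power_mono)
    then have "(norm (A \<cdot> v))\<^sup>2 \<le> (norm v)\<^sup>2"
      unfolding eq using zero_le_power2[of "norm (B \<cdot> v)"] by linarith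
    then have "norm (A \<cdot> v) \<le> norm v"
      by (rule power2_le_imp_le) simp
    then show "norm (A \<cdot> v) \<le> 1 * norm v"
      by simp
  qed simp
  then obtain S where S: "sqrt_iter A \<longlonglongrightarrow> S" "norm S \<le> 1" "S = (1/2) *\<^sub>R (A + (S o\<^sub>L S))"
    by (rule sqrt_iter_convergent)
  have iter: "sqrt_iter A n \<in> M \<and> adj (sqrt_iter A n) = sqrt_iter A n \<and> sqrt_iter A n o\<^sub>L B = B o\<^sub>L sqrt_iter A n" for n
  proof (induction n)
    case (Suc n)
    let ?T = "sqrt_iter A n"
    have T: "?T \<in> M" "adj ?T = ?T" "?T o\<^sub>L B = B o\<^sub>L ?T"
      using Suc by auto
    have "(?T o\<^sub>L ?T) o\<^sub>L B = B o\<^sub>L (?T o\<^sub>L ?T)"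
      by (metis T(3) blinfun_compose_assoc)
    then show ?case
      using T AM adjA AB B(1) by (simp add: scaleR_scale_op blinfun_compose_distrib)
  qed simp
  have SM: "S \<in> M"
    using M_limit[OF _ S(1)] iter by blast
  have adjS: "adj S = S"
  proof (rule adj_eqI[OF M_clinear[OF SM]])
    fix u v
    have lim: "(\<lambda>n. sqrt_iter A n \<cdot> w) \<longlonglongrightarrow> S \<cdot> w" for w
      by (intro blinfun.tendsto S tendsto_const)
    have "cinner (sqrt_iter A n \<cdot> u) v = cinner u (sqrt_iter A n \<cdot> v)" for n
      using cinner_adj[OF M_clinear, of "sqrt_iter A n" u v] iter[of n] by simp
    then show "cinner (S \<cdot> u) v = cinner u (S \<cdot> v)"
      using LIMSEQ_unique[OF cinner.tendsto[OF lim[of u] tendsto_const[of v]]]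
        cinner.tendsto[OF tendsto_const[of u] lim[of v]] by simp
  qed
  have SB: "S o\<^sub>L B = B o\<^sub>L S"
  proof (rule LIMSEQ_unique)
    show "(\<lambda>n. sqrt_iter A n o\<^sub>L B) \<longlonglongrightarrow> (S o\<^sub>L B)"
      by (intro bounded_bilinear.tendsto[OF bounded_bilinear_blinfun_compose] S tendsto_const)
    have "(\<lambda>n. B o\<^sub>L sqrt_iter A n) \<longlonglongrightarrow> (B o\<^sub>L S)"
      by (intro bounded_bilinear.tendsto[OF bounded_bilinear_blinfun_compose] S tendsto_const)
    then show "(\<lambda>n. sqrt_iter A n o\<^sub>L B) \<longlonglongrightarrow> (B o\<^sub>L S)"
      using iter by simp
  qed
  let ?s = "id_blinfun - S"
  show thesis
  proof
    show "?s \<in> M" "adj ?s = ?s" "?s o\<^sub>L B = B o\<^sub>L ?s"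
      using SM adjS SB by (simp_all add: blinfun_compose_distrib)
    have "2 *\<^sub>R S = A + (S o\<^sub>L S)"
      using arg_cong[OF S(3), of "scaleR 2"] by simp
    then have "S + S = A + (S o\<^sub>L S)"
      by (simp add: scaleR_2)
    then have "S o\<^sub>L S = S + S - A"
      by simp
    then show "?s o\<^sub>L ?s = B o\<^sub>L B"
      by (simp add: blinfun_compose_distrib A_def)
    show "positive_op ?s"
      unfolding positive_op_iff
    proof (intro allI conjI)
      fix v
      show "Im (cinner (?s \<cdot> v) v) = 0"
        using SM adjS by (intro M_cinner_real) auto
      have "Re (cinner (S \<cdot> v) v) \<le> norm (S \<cdot> v) * norm v"
        by (rule order_trans[OF complex_Re_le_cmod cinner_norm_le])
      also have "\<dots> \<le> (1 * norm v) * norm v"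
        by (intro mult_right_mono order_trans[OF norm_blinfun mult_right_mono[OF S(2)]]) auto
      finally show "0 \<le> Re (cinner (?s \<cdot> v) v)"
        by (simp add: cinner_diff_left cinner_self power2_eq_square)
    qed
  qed
qed

text \<open>The spectral subspace of \<open>R\<close> for \<open>[\<delta>, \<infinity>)\<close> is the kernel of \<open>|B| - B\<close>, where
  \<open>B = (R - \<delta>) / 2\<close>.\<close>

lemma spectral_subspace:
  assumes R: "R \<in> M" "adj R = R" "norm R \<le> 1" and d: "0 < \<delta>" "\<delta> < 1"
  obtains K where "csubspace K" "closed K" "orth_proj K \<in> M"
    "\<And>v. v \<in> K \<Longrightarrow> R \<cdot> v \<in> K"
    "\<And>v. v \<in> K \<Longrightarrow> \<delta> * (norm v)\<^sup>2 \<le> Re (cinner (R \<cdot> v) v)"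
    "\<And>v. (\<And>u. u \<in> K \<Longrightarrow> cinner v u = 0) \<Longrightarrow> Re (cinner (R \<cdot> v) v) \<le> \<delta> * (norm v)\<^sup>2"
proof -
  \<comment> \<open>The factor 1/2 ensures \<open>norm B \<le> 1\<close>, as \<delta> < 1 and R is a
    contraction.\<close>
  define B where "B = (1/2) *\<^sub>R (R - \<delta> *\<^sub>R id_blinfun)"
  have BM: "B \<in> M" "adj B = B"
    using R by (simp_all add: B_def scaleR_scale_op)
  have "norm (R - \<delta> *\<^sub>R id_blinfun) \<le> norm R + norm (\<delta> *\<^sub>R (id_blinfun :: 'h \<Rightarrow>\<^sub>L 'h))"
    by (rule norm_triangle_ineq4)
  also have "\<dots> \<le> 1 + \<delta> * 1"
    using R(3) d norm_blinfun_id_le[where 'a='h] by (intro add_mono) (auto simp: mult_left_le)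
  finally have "norm B \<le> 1"
    using d by (simp add: B_def)
  then obtain s where s: "s \<in> M" "adj s = s" "positive_op s" "s o\<^sub>L s = B o\<^sub>L B" "s o\<^sub>L B = B o\<^sub>L s"
    using absolute_value_exists[OF BM] by blast
  have RB: "R \<cdot> v = 2 *\<^sub>R B \<cdot> v + \<delta> *\<^sub>R v" for v
    by (simp add: B_def blinfun.scaleR_left)
  have sB: "s \<cdot> (B \<cdot> v) = B \<cdot> (s \<cdot> v)" for v
    using arg_cong[OF s(5), of "\<lambda>z. z \<cdot> v"] by simp
  have ss: "s \<cdot> (s \<cdot> v) = B \<cdot> (B \<cdot> v)" for v
    using arg_cong[OF s(4), of "\<lambda>z. z \<cdot> v"] by simp
  define K where "K = {v. s \<cdot> v = B \<cdot> v}"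
  have K: "csubspace K" "closed K"
  proof -
    show "csubspace K"
      using s(1) BM by (simp add: csubspace_def K_def blinfun.add_right clinear_opD)
    show "closed K"
      unfolding K_def by (intro closed_Collect_eq blinfun.continuous_on continuous_intros)
  qed
  show thesis
  proof
    show "csubspace K" "closed K"
      by fact+
    show "orth_proj K \<in> M"
    proof (rule orth_proj_in_M[OF K])
      fix a v assume a: "a \<in> commutant M" and "v \<in> K"
      then show "a \<cdot> v \<in> K"
        unfolding K_def by (simp add: commutant_apply[OF a s(1), symmetric] commutant_apply[OF a BM(1), symmetric])
    qed
    show "R \<cdot> v \<in> K" if "v \<in> K" for v
      using that unfolding K_def RB by (simp add: blinfun.add_right blinfun.scaleR_right sB)
    show "\<delta> * (norm v)\<^sup>2 \<le> Re (cinner (R \<cdot> v) v)" if "v \<in> K" for v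
    proof -
      have "0 \<le> Re (cinner (B \<cdot> v) v)"
        using s(3)[unfolded positive_op_iff, rule_format, of v] that by (simp add: K_def)
      then show ?thesis
        unfolding RB by (simp add: cinner_lin cinner_self del: of_real_power)
    qed
    show "Re (cinner (R \<cdot> v) v) \<le> \<delta> * (norm v)\<^sup>2" if v: "\<And>u. u \<in> K \<Longrightarrow> cinner v u = 0" for v
    proof -
      have "s \<cdot> v + B \<cdot> v = 0"
      proof (rule cinner_eqI_left)
        fix z
        \<comment> \<open>(s - B)(s + B) = 0, because s and B commute and have the same
          square.\<close>
        have "s \<cdot> z + B \<cdot> z \<in> K"
          by (simp add: K_def blinfun.add_right sB ss)
        then have "cinner v (s \<cdot> z + B \<cdot> z) = 0"
          by (rule v)
        then show "cinner (s \<cdot> v + B \<cdot> v) z = cinner 0 z"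
          using s(1,2) BM by (simp add: cinner_add_left cinner_add_right cinner_adj)
      qed
      then have "B \<cdot> v = - s \<cdot> v"
        by (simp add: eq_neg_iff_add_eq_0 add.commute)
      moreover have "0 \<le> Re (cinner (s \<cdot> v) v)"
        using s(3) by (simp add: positive_op_iff)
      ultimately have "Re (cinner (B \<cdot> v) v) \<le> 0"
        by (simp add: cinner_minus)
      then show ?thesis
        unfolding RB by (simp add: cinner_lin cinner_self del: of_real_power)
    qed
  qed
qed

text \<open>A Lax-Milgram argument: coercivity bounds R from below on K, so R maps K onto a closed
  subspace, and a vector of K orthogonal to that image must vanish.\<close>

lemma spectral_subspace_range:
  assumes K: "csubspace K" "closed K" "\<And>v. v \<in> K \<Longrightarrow> R \<cdot> v \<in> K"
    and R: "clinear_op R" and d: "0 < \<delta>" "\<And>v. v \<in> K \<Longrightarrow> \<delta> * (norm v)\<^sup>2 \<le> Re (cinner (R \<cdot> v) v)"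
    and w: "w \<in> K"
  shows "w \<in> range (blinfun_apply R)"
proof -
  have bound: "\<delta> * norm v \<le> norm (R \<cdot> v)" if "v \<in> K" for v
  proof (cases "v = 0")
    case False
    have "\<delta> * (norm v)\<^sup>2 \<le> norm (R \<cdot> v) * norm v"
      by (rule order_trans[OF d(2)[OF that] order_trans[OF complex_Re_le_cmod cinner_norm_le]])
    then show ?thesis
      using False by (simp add: power2_eq_square)
  qed simp
  have "complete (blinfun_apply R ` K)"
    by (rule complete_isometric_image[OF d(1) csubspace_imp_subspace[OF K(1)] blinfun.bounded_linear_right])
      (use bound K(2) in \<open>auto simp: complete_eq_closed\<close>)
  then have closed: "closed (blinfun_apply R ` K)"
    by (rule complete_imp_closed)
  have sub: "csubspace (blinfun_apply R ` K)"
    by (rule csubspace_image[OF K(1)]) (auto simp: blinfun.add_right clinear_opD[OF R])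
  obtain p where p: "p \<in> blinfun_apply R ` K" "\<And>s. s \<in> blinfun_apply R ` K \<Longrightarrow> cinner (w - p) s = 0"
    using projection_exists[OF sub closed] by metis
  have "p \<in> K"
    using p(1) K(3) by blast
  then have wp: "w - p \<in> K"
    by (intro csubspaceD(4)[OF K(1) w])
  then have "cinner (R \<cdot> (w - p)) (w - p) = 0"
    using p(2)[OF imageI[OF wp]] by (metis cinner_commute complex_cnj_zero)
  then have "\<delta> * (norm (w - p))\<^sup>2 \<le> 0"
    using d(2)[OF wp] by simp
  then have "w = p"
    using d(1) by (simp add: mult_le_0_iff)
  then show ?thesis
    using p(1) by blast
qed

text \<open>The projections required belong to spectral subspaces of R = \<open>resR x 1\<close> on
  which R is at least \<delta>; such a subspace lies in the range of R, hence in the domain of x. As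
  \<delta> tends to 0 the complementary projections tend strongly to 0, since R has dense range, and
  their traces follow by \<open>n2_strong_null\<close>.\<close>

lemma trace_measurable_affiliated:
  assumes x: "closed_operator x" and aff: "affiliated M x"
  shows "trace_measurable M \<tau> x"
proof -
  define R where "R = resR x 1"
  have R: "R \<in> M" "adj R = R" "norm R \<le> 1"
    unfolding R_def by (simp_all add: resolvent_in_M[OF x aff] adj_resR[OF x] norm_resR[OF x])
  \<comment> \<open>The shift by 2 keeps \<delta> below 1 already at n = 0, as
    \<open>spectral_subspace\<close> demands.\<close>
  define \<delta> where "\<delta> n = 1 / real (n + 2)" for n
  have \<delta>: "0 < \<delta> n" "\<delta> n < 1" for n
    by (simp_all add: \<delta>_def)
  have "\<forall>n. \<exists>K. csubspace K \<and> closed K \<and> orth_proj K \<in> M \<and>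
      (\<forall>v\<in>K. R \<cdot> v \<in> K) \<and>
      (\<forall>v\<in>K. \<delta> n * (norm v)\<^sup>2 \<le> Re (cinner (R \<cdot> v) v)) \<and>
      (\<forall>v. (\<forall>u\<in>K. cinner v u = 0) \<longrightarrow> Re (cinner (R \<cdot> v) v) \<le> \<delta> n * (norm v)\<^sup>2)"
  proof
    fix n
    obtain K where "csubspace K" "closed K" "orth_proj K \<in> M"
      "\<And>v. v \<in> K \<Longrightarrow> R \<cdot> v \<in> K"
      "\<And>v. v \<in> K \<Longrightarrow> \<delta> n * (norm v)\<^sup>2 \<le> Re (cinner (R \<cdot> v) v)"
      "\<And>v. (\<And>u. u \<in> K \<Longrightarrow> cinner v u = 0) \<Longrightarrow> Re (cinner (R \<cdot> v) v) \<le> \<delta> n * (norm v)\<^sup>2"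
      using spectral_subspace[OF R \<delta>] by metis
    then show "\<exists>K. csubspace K \<and> closed K \<and> orth_proj K \<in> M \<and>
      (\<forall>v\<in>K. R \<cdot> v \<in> K) \<and>
      (\<forall>v\<in>K. \<delta> n * (norm v)\<^sup>2 \<le> Re (cinner (R \<cdot> v) v)) \<and>
      (\<forall>v. (\<forall>u\<in>K. cinner v u = 0) \<longrightarrow> Re (cinner (R \<cdot> v) v) \<le> \<delta> n * (norm v)\<^sup>2)"
      by (intro exI[of _ K] conjI ballI allI impI) simp_all
  qed
  then obtain K where KK: "\<forall>n. csubspace (K n) \<and> closed (K n) \<and> orth_proj (K n) \<in> M \<and>
      (\<forall>v\<in>K n. R \<cdot> v \<in> K n) \<and>
      (\<forall>v\<in>K n. \<delta> n * (norm v)\<^sup>2 \<le> Re (cinner (R \<cdot> v) v)) \<and>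
      (\<forall>v. (\<forall>u\<in>K n. cinner v u = 0) \<longrightarrow> Re (cinner (R \<cdot> v) v) \<le> \<delta> n * (norm v)\<^sup>2)"
    by (rule choice[THEN exE])
  have K: "csubspace (K n)" "closed (K n)" "orth_proj (K n) \<in> M"
    "\<And>v. v \<in> K n \<Longrightarrow> R \<cdot> v \<in> K n"
    "\<And>v. v \<in> K n \<Longrightarrow> \<delta> n * (norm v)\<^sup>2 \<le> Re (cinner (R \<cdot> v) v)"
    "\<And>v. (\<forall>u\<in>K n. cinner v u = 0) \<Longrightarrow> Re (cinner (R \<cdot> v) v) \<le> \<delta> n * (norm v)\<^sup>2" for n
    using KK[rule_format, of n] by simp_all
  define Q where "Q n = id_blinfun - orth_proj (K n)" for n
  have QM: "Q n \<in> M" for n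
    using K(3) by (simp add: Q_def)
  have Q: "adj (Q n) = Q n" "Q n o\<^sub>L Q n = Q n" for n
    using K(3)[of n] adj_orth_proj[OF K(1,2)] orth_proj_idem[OF K(1,2)]
    by (simp_all add: Q_def blinfun_compose_distrib)
  have Qsq: "(norm (Q n \<cdot> v))\<^sup>2 = Re (cinner (Q n \<cdot> v) v)" for n v
  proof -
    have "cinner (Q n \<cdot> v) v = cinner ((Q n o\<^sub>L Q n) \<cdot> v) v"
      unfolding Q(2) ..
    also have "\<dots> = cinner (Q n \<cdot> v) (Q n \<cdot> v)"
      using cinner_adj[OF M_clinear[OF QM], of n "Q n \<cdot> v" v] unfolding Q(1) by simp
    finally show ?thesis
      by (simp add: cinner_self del: of_real_power)
  qed
  have Q_le: "norm (Q n \<cdot> v) \<le> norm v" for n v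
  proof (cases "Q n \<cdot> v = 0")
    case False
    have "(norm (Q n \<cdot> v))\<^sup>2 \<le> norm (Q n \<cdot> v) * norm v"
      unfolding Qsq by (rule order_trans[OF complex_Re_le_cmod cinner_norm_le])
    then show ?thesis
      using False by (simp add: power2_eq_square)
  qed simp
  have Q_norm: "norm (Q n) \<le> 1" for n
    by (rule norm_blinfun_bound) (simp_all add: Q_le)
  have RQ: "(norm (R \<cdot> (Q n \<cdot> v)))\<^sup>2 \<le> \<delta> n * (norm v)\<^sup>2" for n v
  proof -
    let ?w = "Q n \<cdot> v"
    have "0 \<le> 1 * (norm (resZ x 1 \<cdot> ?w))\<^sup>2"
      by simp
    then have "(norm (R \<cdot> ?w))\<^sup>2 \<le> Re (cinner ?w (R \<cdot> ?w))"
      unfolding resZ_norm[OF x zero_less_one] R_def by simp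
    also have "\<dots> = Re (cinner (R \<cdot> ?w) ?w)"
      by (rule cinner_Re_commute)
    also have "\<dots> \<le> \<delta> n * (norm ?w)\<^sup>2"
      by (intro K(6) ballI) (simp add: Q_def orth_proj_orth[OF K(1,2)])
    also have "\<dots> \<le> \<delta> n * (norm v)\<^sup>2"
      using \<delta>(1)[of n] Q_le by (intro mult_left_mono power_mono) auto
    finally show ?thesis .
  qed
  have "closure (range (blinfun_apply R)) = UNIV"
  proof -
    have sub: "csubspace (range (blinfun_apply R))"
      using R(1) by (intro csubspace_image) (auto simp: csubspace_def blinfun.add_right clinear_opD)
    have "w \<in> closure (range (blinfun_apply R))" for w
    proof (rule in_closed_csubspace[OF csubspace_closure[OF sub] closed_closure])
      fix z assume z: "\<And>s. s \<in> closure (range (blinfun_apply R)) \<Longrightarrow> cinner z s = 0"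
      have "cinner (R \<cdot> z) s = cinner 0 s" for s
        using z[OF closure_subset[THEN subsetD, OF rangeI[of _ s]]] cinner_adj[OF M_clinear[OF R(1)], of z s] R(2) by simp
      then have "R \<cdot> z = 0"
        by (rule cinner_eqI_left)
      then have "z = 0"
        unfolding R_def by (rule resR_inj[OF x zero_less_one])
      then show "cinner w z = 0"
        by simp
    qed
    then show ?thesis
      by blast
  qed
  then have "(\<lambda>n. Q n \<cdot> v) \<longlonglongrightarrow> 0" for v
  proof (rule tendsto_zero_dense[rotated])
    show "norm (Q n) \<le> 1" for n
      by (rule Q_norm)
    fix w assume "w \<in> range (blinfun_apply R)"
    then obtain z where z: "w = R \<cdot> z"
      by blast
    have "(norm (Q n \<cdot> w))\<^sup>2 \<le> sqrt (\<delta> n) * (norm w * norm z)" for n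
    proof -
      \<comment> \<open>Since w = R z, self-adjointness moves R onto Q n w, where \<open>RQ\<close>
        supplies the factor sqrt (\<delta> n).\<close>
      have "(norm (Q n \<cdot> w))\<^sup>2 = Re (cinner (R \<cdot> (Q n \<cdot> w)) z)"
        unfolding Qsq z using cinner_adj[OF M_clinear[OF R(1)]] R(2) by simp
      also have "\<dots> \<le> norm (R \<cdot> (Q n \<cdot> w)) * norm z"
        by (rule order_trans[OF complex_Re_le_cmod cinner_norm_le])
      also have "norm (R \<cdot> (Q n \<cdot> w)) \<le> sqrt (\<delta> n) * norm w"
        using real_le_rsqrt[OF RQ[of n w]] by (simp add: real_sqrt_mult)
      finally show ?thesis
        by (simp add: mult_right_mono mult.assoc)
    qed
    moreover have "(\<lambda>n. sqrt (\<delta> n) * (norm w * norm z)) \<longlonglongrightarrow> sqrt 0 * (norm w * norm z)"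
    proof (intro tendsto_mult tendsto_real_sqrt tendsto_const)
      show "\<delta> \<longlonglongrightarrow> 0"
        unfolding \<delta>_def using LIMSEQ_Suc[OF LIMSEQ_inverse_real_of_nat] by (simp add: inverse_eq_divide add.commute)
    qed
    ultimately have "(\<lambda>n. (norm (Q n \<cdot> w))\<^sup>2) \<longlonglongrightarrow> 0"
      using Lim_null_comparison[of "\<lambda>n. (norm (Q n \<cdot> w))\<^sup>2"
          "\<lambda>n. sqrt (\<delta> n) * (norm w * norm z)" sequentially] by simp
    then have "(\<lambda>n. sqrt ((norm (Q n \<cdot> w))\<^sup>2)) \<longlonglongrightarrow> sqrt 0"
      by (rule tendsto_real_sqrt)
    then show "(\<lambda>n. Q n \<cdot> w) \<longlonglongrightarrow> 0"
      by (simp add: tendsto_norm_zero_iff)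
  qed
  then have Q0: "(\<lambda>n. n2 (Q n)) \<longlonglongrightarrow> 0"
    by (rule n2_strong_null[OF QM Q_norm])
  show ?thesis
    unfolding trace_measurable_def
  proof (intro conjI allI impI x aff)
    fix \<epsilon> :: real assume "\<epsilon> > 0"
    then have "\<forall>\<^sub>F n in sequentially. n2 (Q n) < \<epsilon>"
      by (rule order_tendstoD(2)[OF Q0])
    then obtain n where n: "n2 (Q n) < \<epsilon>"
      by (auto simp: eventually_sequentially)
    show "\<exists>e\<in>M. projection_op e \<and> range (blinfun_apply e) \<subseteq> Domain x \<and> Re (\<tau> (id_blinfun - e)) \<le> \<epsilon>"
    proof (intro bexI[OF _ K(3)[of n]] conjI)
      show "projection_op (orth_proj (K n))"
        by (rule projection_op_orth_proj[OF K(1,2)])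
      show "range (blinfun_apply (orth_proj (K n))) \<subseteq> Domain x"
      proof
        fix w assume "w \<in> range (blinfun_apply (orth_proj (K n)))"
        then have "w \<in> K n"
          using orth_proj_in[OF K(1,2)] by blast
        then have "w \<in> range (blinfun_apply R)"
          by (rule spectral_subspace_range[OF K(1,2) _ M_clinear[OF R(1)] \<delta>(1)[of n], rotated -1])
            (fact K(4), fact K(5))
        then show "w \<in> Domain x"
          using resolvent_graph[OF x zero_less_one] unfolding R_def by blast
      qed
      show "Re (\<tau> (id_blinfun - orth_proj (K n))) \<le> \<epsilon>"
        using order_trans[OF complex_Re_le_cmod cmod_tau_le[OF QM]] n unfolding Q_def[symmetric]
        by (meson less_imp_le order_trans)
    qed
  qed
qed

section \<open>Identification of L2 with Cauchy sequences in M\<close>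

lemma Lop_L2:
  assumes "Cauchy2 X"
  shows "Lop X \<in> L2 M \<tau>"
proof -
  obtain L where "(\<lambda>k. n2 (X k)) \<longlonglongrightarrow> L"
    using Cauchy2_n2[OF assms] convergent_def by blast
  then show ?thesis
    using trace_measurable_affiliated[OF closed_operator_Lop[OF assms] affiliated_Lop[OF assms]]
    by (simp add: L2_def extended_trace_Lop[OF assms])
qed

lemma L2_E:
  assumes "x \<in> L2 M \<tau>"
  obtains X where "Cauchy2 X" "x = Lop X"
proof -
  have "closed_operator x" "affiliated M x" "extended_trace M \<tau> (x O graph_adj x) < \<infinity>"
    using assms by (simp_all add: L2_def trace_measurable_def)
  then show thesis
    by (rule affiliated_eq_Lop) (rule that)
qed

lemma L2_norm_Lop:
  assumes "Cauchy2 X"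
  shows "(\<lambda>k. n2 (X k)) \<longlonglongrightarrow> L2_norm M \<tau> (Lop X)"
proof -
  obtain L where L: "(\<lambda>k. n2 (X k)) \<longlonglongrightarrow> L"
    using Cauchy2_n2[OF assms] convergent_def by blast
  moreover have "L \<ge> 0"
    using assms by (intro LIMSEQ_le_const[OF L]) auto
  ultimately show ?thesis
    by (simp add: L2_norm_def extended_trace_Lop[OF assms L])
qed

lemma L2_dist_Lop:
  assumes "Cauchy2 X" "Cauchy2 Y"
  shows "(\<lambda>k. n2 (X k - Y k)) \<longlonglongrightarrow> L2_dist M \<tau> (Lop X) (Lop Y)"
proof -
  have "strong_sum (Lop X) (strong_scale (-1) (Lop Y)) = Lop (\<lambda>k. X k - Y k)"
    using strong_sum_Lop[OF assms(1) Cauchy2_scale[OF assms(2), of "-1"]] strong_scale_Lop[OF assms(2), of "-1"] by simp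
  then show ?thesis
    using L2_norm_Lop[OF Cauchy2_diff[OF assms]] by (simp add: L2_dist_def)
qed

end

subsection \<open>Subdiagonal algebras and the conjugation\<close>

locale subdiagonal_algebra = tracial_vna M \<tau>
  for M :: "('h::complex_hilbert_space \<Rightarrow>\<^sub>L 'h) set" and \<tau> :: "('h \<Rightarrow>\<^sub>L 'h) \<Rightarrow> complex" +
  fixes H :: "('h \<Rightarrow>\<^sub>L 'h) set" and \<Phi> :: "('h \<Rightarrow>\<^sub>L 'h) \<Rightarrow> ('h \<Rightarrow>\<^sub>L 'h)"
  assumes fms: "finite_maximal_subdiagonal M \<tau> \<Phi> H"
begin

lemma H_subalgebra: "unital_subalgebra M H"
  using fms by (simp add: finite_maximal_subdiagonal_def subdiagonal_def)

lemma H_M [simp]: "x \<in> H \<Longrightarrow> x \<in> M"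
  using H_subalgebra unfolding unital_subalgebra_def by (meson subsetD)

lemma H_closed [simp]:
  "id_blinfun \<in> H" "x \<in> H \<Longrightarrow> y \<in> H \<Longrightarrow> x + y \<in> H" "x \<in> H \<Longrightarrow> y \<in> H \<Longrightarrow> x o\<^sub>L y \<in> H" "x \<in> H \<Longrightarrow> c *\<^sub>O x \<in> H"
  using H_subalgebra by (simp_all add: unital_subalgebra_def)

lemma H_zero [simp]: "0 \<in> H"
  using H_closed(4)[of id_blinfun 0] by simp

lemma H_diff [simp]: "x \<in> H \<Longrightarrow> y \<in> H \<Longrightarrow> x - y \<in> H"
  using H_closed(2)[of x "(-1) *\<^sub>O y"] H_closed(4)[of y "-1"] by simp

lemma expectation: "faithful_normal_expectation M (diagonal H) \<Phi>"
  using fms by (simp add: finite_maximal_subdiagonal_def)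

lemma Phi_diagonal: "x \<in> M \<Longrightarrow> \<Phi> x \<in> diagonal H"
  and Phi_fixes: "d \<in> diagonal H \<Longrightarrow> \<Phi> d = d"
  and Phi_add: "x \<in> M \<Longrightarrow> y \<in> M \<Longrightarrow> \<Phi> (x + y) = \<Phi> x + \<Phi> y"
  and Phi_scale: "x \<in> M \<Longrightarrow> \<Phi> (c *\<^sub>O x) = c *\<^sub>O \<Phi> x"
  using expectation by (simp_all add: faithful_normal_expectation_def)

lemma Phi_mult: "x \<in> H \<Longrightarrow> y \<in> H \<Longrightarrow> \<Phi> (x o\<^sub>L y) = \<Phi> x o\<^sub>L \<Phi> y"
  using fms by (simp add: finite_maximal_subdiagonal_def subdiagonal_def)

lemma tau_Phi: "x \<in> M \<Longrightarrow> \<tau> (\<Phi> x) = \<tau> x"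
  using fms by (simp add: finite_maximal_subdiagonal_def)

lemma diagonal_iff: "d \<in> diagonal H \<longleftrightarrow> d \<in> H \<and> adj d \<in> H"
proof
  assume "d \<in> diagonal H"
  then obtain b where "d \<in> H" "b \<in> H" "d = adj b"
    by (auto simp: diagonal_def)
  then show "d \<in> H \<and> adj d \<in> H"
    by simp
next
  assume d: "d \<in> H \<and> adj d \<in> H"
  then have "d = adj (adj d)"
    by simp
  then show "d \<in> diagonal H"
    unfolding diagonal_def using d by blast
qed

abbreviation "H0 \<equiv> ker_expectation \<Phi> H"

lemma H0_iff: "x \<in> H0 \<longleftrightarrow> x \<in> H \<and> \<Phi> x = 0"
  by (simp add: ker_expectation_def)

lemma Phi_zero [simp]: "\<Phi> 0 = 0"
  by (rule Phi_fixes) (simp add: diagonal_iff)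

lemma H0_closed:
  "0 \<in> H0" "x \<in> H0 \<Longrightarrow> y \<in> H0 \<Longrightarrow> x + y \<in> H0" "x \<in> H0 \<Longrightarrow> c *\<^sub>O x \<in> H0"
  by (simp_all add: H0_iff Phi_add Phi_scale)

lemma diagonal_closed:
  "0 \<in> diagonal H" "x \<in> diagonal H \<Longrightarrow> y \<in> diagonal H \<Longrightarrow> x + y \<in> diagonal H"
  "x \<in> diagonal H \<Longrightarrow> c *\<^sub>O x \<in> diagonal H"
  by (simp_all add: diagonal_iff)

lemma tau_mult_H0:
  assumes "x \<in> H" "y \<in> H" "x \<in> H0 \<or> y \<in> H0"
  shows "\<tau> (x o\<^sub>L y) = 0"
proof -
  have "\<tau> (x o\<^sub>L y) = \<tau> (\<Phi> x o\<^sub>L \<Phi> y)"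
    using tau_Phi[of "x o\<^sub>L y"] Phi_mult[OF assms(1,2)] assms by simp
  also have "\<dots> = 0"
    using assms(3) by (auto simp: H0_iff)
  finally show ?thesis .
qed

lemma n2_orthogonal:
  assumes "x \<in> M" "y \<in> M" "\<tau> (adj x o\<^sub>L y) = 0"
  shows "(n2 (x + y))\<^sup>2 = (n2 x)\<^sup>2 + (n2 y)\<^sup>2"
  using n2_add_scale[OF assms(1,2), of 1] assms(3) by simp

text \<open>Each cross term is, up to an adjoint, the trace of a product of two elements of H with
  one factor in \<open>H0\<close>: \<open>u2 o\<^sub>L u1\<close>, \<open>adj d o\<^sub>L u1\<close>
  and \<open>u2 o\<^sub>L d\<close>.\<close>

lemma n2_decomposition:
  assumes "u1 \<in> H0" "u2 \<in> H0" "d \<in> diagonal H"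
  shows "(n2 (u1 + adj u2 + d))\<^sup>2 = (n2 u1)\<^sup>2 + (n2 u2)\<^sup>2 + (n2 d)\<^sup>2"
    and "(n2 (\<i> *\<^sub>O adj u2 - \<i> *\<^sub>O u1))\<^sup>2 = (n2 u1)\<^sup>2 + (n2 u2)\<^sup>2"
proof -
  have H: "u1 \<in> H" "u2 \<in> H" "d \<in> H" "adj d \<in> H"
    using assms by (simp_all add: H0_iff diagonal_iff)
  have 1: "\<tau> (adj u1 o\<^sub>L adj u2) = 0"
    using tau_mult_H0[of u2 u1] tau_adj[of "u2 o\<^sub>L u1"] H assms by simp
  have 2: "\<tau> (adj u1 o\<^sub>L d) = 0"
    using tau_mult_H0[of "adj d" u1] tau_adj[of "adj d o\<^sub>L u1"] H assms by simp
  have 3: "\<tau> (u2 o\<^sub>L d) = 0"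
    using tau_mult_H0[of u2 d] H assms by simp
  have "\<tau> (adj (u1 + adj u2) o\<^sub>L d) = 0"
    using H 2 3 by (simp add: blinfun_compose_distrib)
  then show "(n2 (u1 + adj u2 + d))\<^sup>2 = (n2 u1)\<^sup>2 + (n2 u2)\<^sup>2 + (n2 d)\<^sup>2"
    using n2_orthogonal[of "u1 + adj u2" d] n2_orthogonal[of u1 "adj u2"] H 1 by simp
  have "\<tau> (adj ((- \<i>) *\<^sub>O u1) o\<^sub>L (\<i> *\<^sub>O adj u2)) = 0"
    using H 1 by simp
  then have "(n2 ((- \<i>) *\<^sub>O u1 + \<i> *\<^sub>O adj u2))\<^sup>2 = (n2 u1)\<^sup>2 + (n2 u2)\<^sup>2"
    using n2_orthogonal[of "(- \<i>) *\<^sub>O u1" "\<i> *\<^sub>O adj u2"] H by simp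
  moreover have "(- \<i>) *\<^sub>O u1 + \<i> *\<^sub>O adj u2 = \<i> *\<^sub>O adj u2 - \<i> *\<^sub>O u1"
    by (rule blinfun_eqI) (simp add: scaleC.minus_left)
  ultimately show "(n2 (\<i> *\<^sub>O adj u2 - \<i> *\<^sub>O u1))\<^sup>2 = (n2 u1)\<^sup>2 + (n2 u2)\<^sup>2"
    by simp
qed

lemma star_sum_E:
  assumes "u \<in> star_sum H"
  obtains u1 u2 d where "u1 \<in> H0" "u2 \<in> H0" "d \<in> diagonal H" "u = u1 + adj u2 + d"
proof -
  obtain a b where ab: "u = a + adj b" "a \<in> H" "b \<in> H"
    using assms by (auto simp: star_sum_def)
  have D: "\<Phi> a \<in> diagonal H" "\<Phi> b \<in> diagonal H"
    using ab by (auto intro: Phi_diagonal)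
  have H0: "x - \<Phi> x \<in> H0" if "x \<in> H" for x
  proof -
    have Phi: "\<Phi> x \<in> diagonal H" "\<Phi> x \<in> H"
      using Phi_diagonal[of x] that by (auto simp: diagonal_iff)
    have "\<Phi> (x - \<Phi> x) = \<Phi> (x + (-1) *\<^sub>O \<Phi> x)"
      by simp
    also have "\<dots> = \<Phi> x + (-1) *\<^sub>O \<Phi> (\<Phi> x)"
      using Phi that by (simp only: Phi_add Phi_scale H_M H_closed)
    also have "\<dots> = 0"
      by (simp add: Phi_fixes[OF Phi(1)])
    finally show ?thesis
      using that Phi by (simp add: H0_iff)
  qed
  show thesis
  proof
    show "a - \<Phi> a \<in> H0" "b - \<Phi> b \<in> H0"
      using H0 ab by auto
    show "\<Phi> a + adj (\<Phi> b) \<in> diagonal H"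
      using D by (simp add: diagonal_iff)
    show "u = (a - \<Phi> a) + adj (b - \<Phi> b) + (\<Phi> a + adj (\<Phi> b))"
      using ab D by (simp add: diagonal_iff)
  qed
qed

lemma star_sum_I:
  assumes "u1 \<in> H0" "u2 \<in> H0" "d \<in> diagonal H"
  shows "u1 + adj u2 + d \<in> star_sum H"
proof -
  have "u1 + adj u2 + d = (u1 + d) + adj u2" "u1 + d \<in> H" "u2 \<in> H"
    using assms by (simp_all add: H0_iff diagonal_iff)
  then show ?thesis
    unfolding star_sum_def by blast
qed

lemma star_sum_M [simp]: "u \<in> star_sum H \<Longrightarrow> u \<in> M"
  by (auto simp: star_sum_def)

abbreviation "cj \<equiv> conjugation \<Phi> H"

text \<open>Subtracting two decompositions represents 0, and Pythagoras makes every summand of the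
  difference vanish in \<open>n2\<close>; hence the description in \<open>conjugation\<close>
  denotes a unique operator.\<close>

lemma conjugation_eq:
  assumes "u1 \<in> H0" "u2 \<in> H0" "d \<in> diagonal H"
  shows "cj (u1 + adj u2 + d) = \<i> *\<^sub>O adj u2 - \<i> *\<^sub>O u1"
  unfolding conjugation_def
proof (rule the_equality)
  show "\<exists>v1\<in>H0. \<exists>v2\<in>H0. \<exists>e\<in>diagonal H.
      u1 + adj u2 + d = v1 + adj v2 + e \<and> \<i> *\<^sub>O adj u2 - \<i> *\<^sub>O u1 = \<i> *\<^sub>O adj v2 - \<i> *\<^sub>O v1"
    using assms by blast
next
  fix v
  assume "\<exists>v1\<in>H0. \<exists>v2\<in>H0. \<exists>e\<in>diagonal H. u1 + adj u2 + d = v1 + adj v2 + e \<and> v = \<i> *\<^sub>O adj v2 - \<i> *\<^sub>O v1"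
  then obtain v1 v2 e where v: "v1 \<in> H0" "v2 \<in> H0" "e \<in> diagonal H"
    "u1 + adj u2 + d = v1 + adj v2 + e" "v = \<i> *\<^sub>O adj v2 - \<i> *\<^sub>O v1"
    by blast
  have mem: "x + (-1) *\<^sub>O y \<in> H0" if "x \<in> H0" "y \<in> H0" for x y
    using that by (intro H0_closed)
  have memD: "d + (-1) *\<^sub>O e \<in> diagonal H"
    using assms v by (intro diagonal_closed)
  note M = H_M[OF conjunct1[OF H0_iff[THEN iffD1]]]
  have "(u1 - v1) + adj (u2 - v2) + (d - e) = 0"
    using v(4) assms(1,2) v(1,2) by (simp add: H0_iff algebra_simps)
  then have "(n2 (u1 - v1))\<^sup>2 + (n2 (u2 - v2))\<^sup>2 + (n2 (d - e))\<^sup>2 = 0"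
    using n2_decomposition(1)[OF mem[OF assms(1) v(1)] mem[OF assms(2) v(2)] memD] by simp
  then have "n2 (u1 - v1) = 0" "n2 (u2 - v2) = 0"
    by (simp_all add: add_nonneg_eq_0_iff)
  then have "u1 = v1" "u2 = v2"
    using n2_eq_0[of "u1 - v1"] n2_eq_0[of "u2 - v2"] M[OF assms(1)] M[OF assms(2)] M[OF v(1)] M[OF v(2)] by simp_all
  then show "v = \<i> *\<^sub>O adj u2 - \<i> *\<^sub>O u1"
    using v(5) by simp
qed

lemma star_sum_add:
  assumes "u \<in> star_sum H" "v \<in> star_sum H"
  shows "u + v \<in> star_sum H" "cj (u + v) = cj u + cj v"
proof -
  obtain u1 u2 d where u: "u1 \<in> H0" "u2 \<in> H0" "d \<in> diagonal H" "u = u1 + adj u2 + d"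
    using star_sum_E[OF assms(1)] by metis
  obtain v1 v2 e where v: "v1 \<in> H0" "v2 \<in> H0" "e \<in> diagonal H" "v = v1 + adj v2 + e"
    using star_sum_E[OF assms(2)] by metis
  have uv: "u1 + v1 \<in> H0" "u2 + v2 \<in> H0" "d + e \<in> diagonal H"
    using u v by (simp_all add: H0_closed diagonal_closed)
  have eq: "u + v = (u1 + v1) + adj (u2 + v2) + (d + e)"
    using u v by (simp add: H0_iff algebra_simps)
  show "u + v \<in> star_sum H"
    unfolding eq by (rule star_sum_I[OF uv])
  show "cj (u + v) = cj u + cj v"
    unfolding eq conjugation_eq[OF uv] unfolding u(4) v(4) conjugation_eq[OF u(1-3)] conjugation_eq[OF v(1-3)]
    using u v by (simp add: H0_iff algebra_simps)
qed

lemma star_sum_scale: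
  assumes "u \<in> star_sum H"
  shows "c *\<^sub>O u \<in> star_sum H" "cj (c *\<^sub>O u) = c *\<^sub>O cj u"
proof -
  obtain u1 u2 d where u: "u1 \<in> H0" "u2 \<in> H0" "d \<in> diagonal H" "u = u1 + adj u2 + d"
    using star_sum_E[OF assms(1)] by metis
  have cu: "c *\<^sub>O u1 \<in> H0" "cnj c *\<^sub>O u2 \<in> H0" "c *\<^sub>O d \<in> diagonal H"
    using u by (simp_all add: H0_closed diagonal_closed)
  have eq: "c *\<^sub>O u = c *\<^sub>O u1 + adj (cnj c *\<^sub>O u2) + c *\<^sub>O d"
    using u by (simp add: H0_iff)
  show "c *\<^sub>O u \<in> star_sum H"
    unfolding eq by (rule star_sum_I[OF cu])
  show "cj (c *\<^sub>O u) = c *\<^sub>O cj u"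
    unfolding eq conjugation_eq[OF cu] unfolding u(4) conjugation_eq[OF u(1-3)]
    using u by (simp add: H0_iff mult.commute)
qed

lemma star_sum_diff:
  assumes "u \<in> star_sum H" "v \<in> star_sum H"
  shows "u - v \<in> star_sum H" "cj (u - v) = cj u - cj v"
  using star_sum_add[OF assms(1) star_sum_scale(1)[OF assms(2), of "-1"]] star_sum_scale(2)[OF assms(2), of "-1"]
  by simp_all

lemma conjugation_props:
  assumes "u \<in> star_sum H"
  shows conjugation_M: "cj u \<in> M" and n2_conjugation: "n2 (cj u) \<le> n2 u"
    and conjugation_H: "u + \<i> *\<^sub>O cj u \<in> H"
proof -
  obtain u1 u2 d where u: "u1 \<in> H0" "u2 \<in> H0" "d \<in> diagonal H" "u = u1 + adj u2 + d"
    using star_sum_E[OF assms(1)] by metis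
  have cu: "cj u = \<i> *\<^sub>O adj u2 - \<i> *\<^sub>O u1"
    unfolding u(4) by (rule conjugation_eq[OF u(1-3)])
  show "cj u \<in> M"
    unfolding cu using u by (simp add: H0_iff)
  have "(n2 (cj u))\<^sup>2 \<le> (n2 u)\<^sup>2"
    unfolding cu n2_decomposition(2)[OF u(1-3)] unfolding u(4) n2_decomposition(1)[OF u(1-3)] by simp
  then show "n2 (cj u) \<le> n2 u"
    by (rule power2_le_imp_le) (use assms in simp)
  have eq: "u + \<i> *\<^sub>O cj u = u1 + u1 + d"
    unfolding cu unfolding u(4) by simp
  show "u + \<i> *\<^sub>O cj u \<in> H"
    unfolding eq using u(1,3) by (simp add: H0_iff diagonal_iff)
qed

text \<open>Weak-star density yields density in \<open>M \<zeta>\<close>, hence in the weaker trace norm: a vector of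
  square-summable sequences that is orthogonal to \<open>x \<zeta>\<close> for all \<open>x\<close> in \<open>H + H\<^sup>*\<close> defines a
  weak-star continuous functional vanishing there.\<close>

lemma star_sum_dense:
  assumes x: "x \<in> M" and e: "e > 0"
  obtains a where "a \<in> star_sum H" "n2 (x - a) < e"
proof -
  let ?S = "(\<lambda>x. amp x \<zeta>) ` star_sum H"
  have "0 \<in> star_sum H"
    using star_sum_I[OF H0_closed(1) H0_closed(1) diagonal_closed(1)] by simp
  then have S: "csubspace ?S"
    by (rule csubspace_amp_zeta) (simp_all add: star_sum_add star_sum_scale)
  have clo: "x \<in> weak_star M closure_of star_sum H"
    using fms x by (simp add: finite_maximal_subdiagonal_def subdiagonal_def)
  have "amp x \<zeta> \<in> closure ?S"
  proof (rule in_closed_csubspace[OF csubspace_closure[OF S] closed_closure])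
    fix z assume z: "\<And>s. s \<in> closure ?S \<Longrightarrow> cinner z s = 0"
    show "cinner (amp x \<zeta>) z = 0"
    proof (rule ccontr)
      assume "cinner (amp x \<zeta>) z \<noteq> 0"
      then have "x \<in> M \<inter> {y. cinner (amp y \<zeta>) z \<in> - {0}}"
        using x by simp
      moreover have "openin (weak_star M) (M \<inter> {y. cinner (amp y \<zeta>) z \<in> - {0}})"
        by (intro openin_subtopology_Int2 openin_ultraweak_cinner_amp) auto
      ultimately have "\<exists>a. a \<in> star_sum H \<and> a \<in> M \<inter> {y. cinner (amp y \<zeta>) z \<in> - {0}}"
        by (intro clo[unfolded in_closure_of, THEN conjunct2, rule_format] conjI)
      then obtain a where a: "a \<in> star_sum H" "cinner (amp a \<zeta>) z \<noteq> 0"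
        by auto
      have "cinner z (amp a \<zeta>) = 0"
        by (rule z[OF closure_subset[THEN subsetD, OF imageI[OF a(1)]]])
      then show False
        using a(2) by (metis cinner_commute complex_cnj_zero)
    qed
  qed
  then obtain s where "s \<in> ?S" "dist s (amp x \<zeta>) < e"
    using e closure_approachable by metis
  then obtain a where a: "a \<in> star_sum H" "dist (amp a \<zeta>) (amp x \<zeta>) < e"
    by blast
  have "n2 (x - a) \<le> norm (amp (x - a) \<zeta>)"
    using x a by (intro n2_le_amp) simp
  also have "\<dots> < e"
    using a(2) by (simp add: dist_norm norm_minus_commute)
  finally show thesis
    using that a(1) by blast
qed

section \<open>Extension of the conjugation by approximation from \<open>star_sum H\<close>\<close>

lemma L2_star_sum:
  assumes "x \<in> L2 M \<tau>"
  obtains U where "Cauchy2 U" "\<And>k. U k \<in> star_sum H" "x = Lop U"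
proof -
  obtain X where X: "Cauchy2 X" "x = Lop X"
    using L2_E[OF assms] by metis
  have "\<exists>a\<in>star_sum H. n2 (X k - a) < inverse (real (Suc k))" for k
    using star_sum_dense[OF Cauchy2_M[OF X(1)], of "inverse (real (Suc k))" k] by auto
  then obtain U where U: "\<And>k. U k \<in> star_sum H" "\<And>k. n2 (X k - U k) < inverse (real (Suc k))"
    by metis
  have lim: "(\<lambda>k. n2 (X k - U k)) \<longlonglongrightarrow> 0"
  proof (rule tendsto_sandwich[OF _ _ tendsto_const LIMSEQ_inverse_real_of_nat])
    show "\<forall>\<^sub>F k in sequentially. 0 \<le> n2 (X k - U k)"
      using X(1) U(1) by simp
    show "\<forall>\<^sub>F k in sequentially. n2 (X k - U k) \<le> inverse (real (Suc k))"
      using U(2) by (intro always_eventually allI less_imp_le)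
  qed
  have C: "Cauchy2 U"
    by (rule Cauchy2_close[OF X(1) _ lim]) (use U(1) in simp)
  moreover have "x = Lop U"
    using Lop_eq_iff[OF X(1) C] lim X(2) by simp
  ultimately show thesis
    using that U(1) by blast
qed

lemma Cauchy2_conjugation:
  assumes "Cauchy2 U" "\<And>k. U k \<in> star_sum H"
  shows "Cauchy2 (\<lambda>k. cj (U k))"
  by (rule Cauchy2_dominated[OF assms(1), of _ 1])
    (use assms(2) conjugation_M n2_conjugation star_sum_diff in \<open>simp_all flip: star_sum_diff(2)\<close>)

lemma Lop_conjugation_cong:
  assumes U: "Cauchy2 U" "\<And>k. U k \<in> star_sum H" and V: "Cauchy2 V" "\<And>k. V k \<in> star_sum H"
    and eq: "Lop U = Lop V"
  shows "Lop (\<lambda>k. cj (U k)) = Lop (\<lambda>k. cj (V k))"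
proof -
  have le: "n2 (cj (U k) - cj (V k)) \<le> n2 (U k - V k)" for k
    using n2_conjugation[OF star_sum_diff(1)[OF U(2) V(2)], of k k] star_sum_diff(2)[OF U(2) V(2), of k k] by simp
  have "(\<lambda>k. n2 (U k - V k)) \<longlonglongrightarrow> 0"
    using Lop_eq_iff[OF U(1) V(1)] eq by simp
  moreover have "0 \<le> n2 (cj (U k) - cj (V k))" for k
    using conjugation_M[OF U(2)] conjugation_M[OF V(2)] by simp
  ultimately have "(\<lambda>k. n2 (cj (U k) - cj (V k))) \<longlonglongrightarrow> 0"
    using le tendsto_sandwich[of "\<lambda>_. 0" "\<lambda>k. n2 (cj (U k) - cj (V k))" sequentially "\<lambda>k. n2 (U k - V k)" 0] by simp
  then show ?thesis
    using Lop_eq_iff[OF Cauchy2_conjugation[OF U] Cauchy2_conjugation[OF V]] by simp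
qed

text \<open>The chosen sequence is immaterial: the conjugation is linear and contractive, so by
  \<open>Lop_conjugation_cong\<close> equivalent sequences have equivalent images. Restriction to
  \<open>L2\<close> provides the extensionality that uniqueness of the map requires.\<close>

definition L2_conj :: "'h unbounded_op \<Rightarrow> 'h unbounded_op" where
  "L2_conj = (\<lambda>x\<in>L2 M \<tau>. Lop (\<lambda>k. cj ((SOME U. Cauchy2 U \<and> (\<forall>k. U k \<in> star_sum H) \<and> x = Lop U) k)))"

lemma L2_conj_Lop:
  assumes U: "Cauchy2 U" "\<And>k. U k \<in> star_sum H"
  shows "L2_conj (Lop U) = Lop (\<lambda>k. cj (U k))"
proof -
  define V where "V = (SOME V. Cauchy2 V \<and> (\<forall>k. V k \<in> star_sum H) \<and> Lop U = Lop V)"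
  have "Cauchy2 V \<and> (\<forall>k. V k \<in> star_sum H) \<and> Lop U = Lop V"
    unfolding V_def by (rule someI[of _ U]) (use U in simp)
  then have "Lop (\<lambda>k. cj (V k)) = Lop (\<lambda>k. cj (U k))"
    using Lop_conjugation_cong[of V U] U by simp
  then show ?thesis
    using Lop_L2[OF U(1)] by (simp add: L2_conj_def V_def)
qed

lemma L2_norm_mono:
  assumes "Cauchy2 U" "Cauchy2 V" "\<And>k. n2 (U k) \<le> n2 (V k)"
  shows "L2_norm M \<tau> (Lop U) \<le> L2_norm M \<tau> (Lop V)"
  by (rule LIMSEQ_le[OF L2_norm_Lop[OF assms(1)] L2_norm_Lop[OF assms(2)]]) (use assms(3) in blast)

lemma L2_norm_graph_of: "x \<in> M \<Longrightarrow> L2_norm M \<tau> (graph_of x) = n2 x"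
  using LIMSEQ_unique[OF L2_norm_Lop[of "\<lambda>_. x"] tendsto_const] by (simp add: graph_of_eq_Lop)

lemma graph_of_L2: "x \<in> M \<Longrightarrow> graph_of x \<in> L2 M \<tau>"
  by (simp add: graph_of_eq_Lop Lop_L2)

lemma L2_dist_graph_of:
  assumes U: "Cauchy2 U" and e: "e > 0"
  obtains N where "\<And>k. k \<ge> N \<Longrightarrow> L2_dist M \<tau> (graph_of (U k)) (Lop U) < e"
    "\<And>k. k \<ge> N \<Longrightarrow> L2_dist M \<tau> (Lop U) (graph_of (U k)) < e"
proof -
  \<comment> \<open>Halving restores strictness: a limit of values below e / 2 is only known to be
    at most e / 2.\<close>
  obtain N where N: "\<And>j k. j \<ge> N \<Longrightarrow> k \<ge> N \<Longrightarrow> n2 (U j - U k) < e / 2"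
    using Cauchy2_D[OF U, of "e / 2"] e by auto
  have "L2_dist M \<tau> (graph_of (U k)) (Lop U) \<le> e / 2 \<and> L2_dist M \<tau> (Lop U) (graph_of (U k)) \<le> e / 2"
    if k: "k \<ge> N" for k
  proof
    note c = Cauchy2_const[OF Cauchy2_M[OF U, of k]]
    show "L2_dist M \<tau> (graph_of (U k)) (Lop U) \<le> e / 2"
      unfolding graph_of_eq_Lop[OF Cauchy2_M[OF U]]
      by (rule LIMSEQ_le_const2[OF L2_dist_Lop[OF c U]]) (use N k less_imp_le in blast)
    show "L2_dist M \<tau> (Lop U) (graph_of (U k)) \<le> e / 2"
      unfolding graph_of_eq_Lop[OF Cauchy2_M[OF U]]
      by (rule LIMSEQ_le_const2[OF L2_dist_Lop[OF U c]]) (use N k less_imp_le in blast)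
  qed
  then show thesis
    using that[of N] e by force
qed

lemma extends_conjugation_L2_conj: "extends_conjugation M \<tau> \<Phi> H L2_conj"
  unfolding extends_conjugation_def L2_continuous_linear_def
proof (intro conjI ballI allI impI)
  show "L2_conj \<in> L2 M \<tau> \<rightarrow>\<^sub>E L2 M \<tau>"
  proof
    fix x assume "x \<in> L2 M \<tau>"
    then obtain U where U: "Cauchy2 U" "\<And>k. U k \<in> star_sum H" "x = Lop U"
      using L2_star_sum by metis
    show "L2_conj x \<in> L2 M \<tau>"
      unfolding U(3) L2_conj_Lop[OF U(1,2)] by (rule Lop_L2[OF Cauchy2_conjugation[OF U(1,2)]])
  qed (simp add: L2_conj_def)
next
  fix x y assume "x \<in> L2 M \<tau>" "y \<in> L2 M \<tau>"
  then obtain U V where U: "Cauchy2 U" "\<And>k. U k \<in> star_sum H" "x = Lop U"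
    and V: "Cauchy2 V" "\<And>k. V k \<in> star_sum H" "y = Lop V"
    using L2_star_sum by metis
  have "L2_conj (strong_sum x y) = Lop (\<lambda>k. cj (U k + V k))"
    unfolding U(3) V(3) strong_sum_Lop[OF U(1) V(1)]
    by (rule L2_conj_Lop[OF Cauchy2_add[OF U(1) V(1)] star_sum_add(1)[OF U(2) V(2)]])
  then show "L2_conj (strong_sum x y) = strong_sum (L2_conj x) (L2_conj y)"
    unfolding U(3) V(3) L2_conj_Lop[OF U(1,2)] L2_conj_Lop[OF V(1,2)]
      strong_sum_Lop[OF Cauchy2_conjugation[OF U(1,2)] Cauchy2_conjugation[OF V(1,2)]]
      star_sum_add(2)[OF U(2) V(2)] .
next
  fix c x assume "x \<in> L2 M \<tau>"
  then obtain U where U: "Cauchy2 U" "\<And>k. U k \<in> star_sum H" "x = Lop U"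
    using L2_star_sum by metis
  have "L2_conj (strong_scale c x) = Lop (\<lambda>k. cj (c *\<^sub>O U k))"
    unfolding U(3) strong_scale_Lop[OF U(1)]
    by (rule L2_conj_Lop[OF Cauchy2_scale[OF U(1)] star_sum_scale(1)[OF U(2)]])
  then show "L2_conj (strong_scale c x) = strong_scale c (L2_conj x)"
    unfolding U(3) L2_conj_Lop[OF U(1,2)] strong_scale_Lop[OF Cauchy2_conjugation[OF U(1,2)]]
      star_sum_scale(2)[OF U(2)] .
next
  fix x and e :: real assume x: "x \<in> L2 M \<tau>" and e: "e > 0"
  have "L2_dist M \<tau> (L2_conj y) (L2_conj x) < e" if y: "y \<in> L2 M \<tau>" "L2_dist M \<tau> y x < e" for y
  proof -
    obtain U where U: "Cauchy2 U" "\<And>k. U k \<in> star_sum H" "x = Lop U"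
      using L2_star_sum[OF x] by metis
    obtain V where V: "Cauchy2 V" "\<And>k. V k \<in> star_sum H" "y = Lop V"
      using L2_star_sum[OF y(1)] by metis
    have "n2 (cj (V k) - cj (U k)) \<le> n2 (V k - U k)" for k
      using n2_conjugation[OF star_sum_diff(1)[OF V(2) U(2)], of k k] star_sum_diff(2)[OF V(2) U(2), of k k] by simp
    then have "L2_dist M \<tau> (Lop (\<lambda>k. cj (V k))) (Lop (\<lambda>k. cj (U k))) \<le> L2_dist M \<tau> (Lop V) (Lop U)"
      by (intro LIMSEQ_le[OF L2_dist_Lop[OF Cauchy2_conjugation[OF V(1,2)] Cauchy2_conjugation[OF U(1,2)]]
            L2_dist_Lop[OF V(1) U(1)]]) blast
    then show ?thesis
      using y(2) unfolding U(3) V(3) L2_conj_Lop[OF U(1,2)] L2_conj_Lop[OF V(1,2)] by simp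
  qed
  then show "\<exists>d>0. \<forall>y\<in>L2 M \<tau>. L2_dist M \<tau> y x < d \<longrightarrow> L2_dist M \<tau> (L2_conj y) (L2_conj x) < e"
    using e by blast
next
  fix u assume u: "u \<in> star_sum H"
  show "L2_conj (graph_of u) = graph_of (cj u)"
    using L2_conj_Lop[of "\<lambda>_. u"] u conjugation_M[OF u] by (simp add: graph_of_eq_Lop)
qed

text \<open>If x = \<open>Lop U\<close> and T x = \<open>Lop Y\<close>, continuity of T at x brings
  the graph of \<open>cj (U k)\<close> close to T x for large k. The sequences
  \<open>cj (U k)\<close> and Y k are therefore equivalent, and \<open>Lop_eq_iff\<close> identifies
  T x with \<open>L2_conj x\<close>.\<close>

lemma extends_conjugation_unique:
  assumes T: "extends_conjugation M \<tau> \<Phi> H T"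
  shows "T = L2_conj"
proof
  fix x
  have mem: "T \<in> L2 M \<tau> \<rightarrow>\<^sub>E L2 M \<tau>"
    and cont: "\<forall>x\<in>L2 M \<tau>. \<forall>\<epsilon>>0. \<exists>\<delta>>0. \<forall>y\<in>L2 M \<tau>. L2_dist M \<tau> y x < \<delta> \<longrightarrow> L2_dist M \<tau> (T y) (T x) < \<epsilon>"
    and ext: "\<And>u. u \<in> star_sum H \<Longrightarrow> T (graph_of u) = graph_of (cj u)"
    using T unfolding extends_conjugation_def L2_continuous_linear_def by blast+
  show "T x = L2_conj x"
  proof (cases "x \<in> L2 M \<tau>")
    case False
    then show ?thesis
      using PiE_arb[OF mem] by (simp add: L2_conj_def)
  next
    case True
    then obtain U where U: "Cauchy2 U" "\<And>k. U k \<in> star_sum H" "x = Lop U"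
      using L2_star_sum by metis
    obtain Y where Y: "Cauchy2 Y" "T x = Lop Y"
      using L2_E[OF PiE_mem[OF mem True]] by metis
    define V where "V k = cj (U k)" for k
    have V: "Cauchy2 V"
      unfolding V_def by (rule Cauchy2_conjugation[OF U(1,2)])
    have "(\<lambda>k. n2 (V k - Y k)) \<longlonglongrightarrow> 0"
    proof (rule LIMSEQ_I)
      fix r :: real assume "r > 0"
      then have r: "r / 2 > 0"
        by simp
      then obtain \<delta> where \<delta>: "\<delta> > 0" "\<And>y. y \<in> L2 M \<tau> \<Longrightarrow> L2_dist M \<tau> y x < \<delta> \<Longrightarrow> L2_dist M \<tau> (T y) (T x) < r / 2"
        using cont True by meson
      obtain N where N: "\<And>k. k \<ge> N \<Longrightarrow> L2_dist M \<tau> (graph_of (U k)) (Lop U) < \<delta>"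
        using L2_dist_graph_of[OF U(1) \<delta>(1)] by metis
      obtain N' where N': "\<And>j k. j \<ge> N' \<Longrightarrow> k \<ge> N' \<Longrightarrow> n2 (V j - V k) < r / 2"
        using Cauchy2_D[OF V r] by metis
      define k where "k = max N N'"
      have "L2_dist M \<tau> (T (graph_of (U k))) (T x) < r / 2"
        using \<delta>(2)[OF graph_of_L2[OF Cauchy2_M[OF U(1)]]] N[of k] U(3) by (simp add: k_def)
      then have "L2_dist M \<tau> (Lop (\<lambda>_. V k)) (Lop Y) < r / 2"
        using graph_of_eq_Lop[OF Cauchy2_M[OF V], of k] ext[OF U(2)] Y(2) by (simp add: V_def)
      then have "\<forall>\<^sub>F j in sequentially. n2 (V k - Y j) < r / 2"
        using order_tendstoD(2)[OF L2_dist_Lop[OF Cauchy2_const[OF Cauchy2_M[OF V]] Y(1)]] by blast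
      then obtain J where J: "\<And>j. j \<ge> J \<Longrightarrow> n2 (V k - Y j) < r / 2"
        by (auto simp: eventually_sequentially)
      have "norm (n2 (V j - Y j) - 0) < r" if j: "j \<ge> max J N'" for j
      proof -
        have "n2 (V j - Y j) \<le> n2 (V j - V k) + n2 (V k - Y j)"
          using V Y(1) by (intro n2_triangle_diff) auto
        also have "\<dots> < r / 2 + r / 2"
          using j by (intro add_strict_mono J N') (simp_all add: k_def)
        finally show ?thesis
          using V Y(1) by simp
      qed
      then show "\<exists>N. \<forall>j\<ge>N. norm (n2 (V j - Y j) - 0) < r"
        by blast
    qed
    then have "Lop V = Lop Y"
      using Lop_eq_iff[OF V Y(1)] by simp
    then show ?thesis
      unfolding Y(2) unfolding U(3) L2_conj_Lop[OF U(1,2)] V_def by simp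
  qed
qed

lemma L2_norm_L2_conj:
  assumes "x \<in> L2 M \<tau>"
  shows "L2_norm M \<tau> (L2_conj x) \<le> L2_norm M \<tau> x"
proof -
  obtain U where U: "Cauchy2 U" "\<And>k. U k \<in> star_sum H" "x = Lop U"
    using L2_star_sum[OF assms] by metis
  show ?thesis
    unfolding U(3) L2_conj_Lop[OF U(1,2)]
    by (rule L2_norm_mono[OF Cauchy2_conjugation[OF U(1,2)] U(1) n2_conjugation[OF U(2)]])
qed

lemma L2_opnorm_le: "L2_opnorm M \<tau> L2_conj \<le> 1"
  unfolding L2_opnorm_def
proof (rule cSUP_least)
  have "graph_of 0 \<in> {x \<in> L2 M \<tau>. L2_norm M \<tau> x \<le> 1}"
    by (simp add: graph_of_L2 L2_norm_graph_of)
  then show "{x \<in> L2 M \<tau>. L2_norm M \<tau> x \<le> 1} \<noteq> {}"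
    by blast
  show "L2_norm M \<tau> (L2_conj x) \<le> 1" if "x \<in> {x \<in> L2 M \<tau>. L2_norm M \<tau> x \<le> 1}" for x
    using that order_trans[OF L2_norm_L2_conj] by blast
qed

text \<open>The conjugation multiplies elements of \<open>H0\<close> by - \<i>, so a normalised
  nonzero one attains the norm. If \<open>H0\<close> were {0}, every element of
  \<open>star_sum H\<close> would be diagonal and the conjugation would be zero, whence the
  hypothesis.\<close>

lemma L2_opnorm_ge:
  assumes "H0 \<noteq> {0}"
  shows "1 \<le> L2_opnorm M \<tau> L2_conj"
proof -
  obtain w where w: "w \<in> H0" "w \<noteq> 0"
    using assms H0_closed(1) by blast
  have wM: "w \<in> M"
    using w by (simp add: H0_iff)
  have pos: "n2 w > 0"
    using n2_eq_0[OF wM] w(2) n2_nonneg[OF wM] by (metis order_le_imp_less_or_eq)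
  define v where "v = of_real (1 / n2 w) *\<^sub>O w"
  have v: "v \<in> H0"
    unfolding v_def by (rule H0_closed(3)[OF w(1)])
  have vM: "v \<in> M"
    using v by (simp add: H0_iff)
  have nv: "n2 v = 1"
    unfolding v_def using wM pos by (simp add: norm_divide)
  have vS: "v \<in> star_sum H" and "cj v = - (\<i> *\<^sub>O v)"
    using star_sum_I[OF v H0_closed(1) diagonal_closed(1)] conjugation_eq[OF v H0_closed(1) diagonal_closed(1)] by simp_all
  then have ncv: "n2 (cj v) = 1"
    using vM nv by simp
  have "L2_conj (graph_of v) = graph_of (cj v)"
    using extends_conjugation_L2_conj vS unfolding extends_conjugation_def by blast
  then have "1 = L2_norm M \<tau> (L2_conj (graph_of v))"
    using ncv conjugation_M[OF vS] by (simp add: L2_norm_graph_of)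
  also have "\<dots> \<le> L2_opnorm M \<tau> L2_conj"
    unfolding L2_opnorm_def
  proof (rule cSUP_upper)
    show "graph_of v \<in> {x \<in> L2 M \<tau>. L2_norm M \<tau> x \<le> 1}"
      by (simp add: graph_of_L2 L2_norm_graph_of vM nv)
    show "bdd_above ((\<lambda>x. L2_norm M \<tau> (L2_conj x)) ` {x \<in> L2 M \<tau>. L2_norm M \<tau> x \<le> 1})"
      by (rule bdd_aboveI2[of _ _ 1]) (use order_trans[OF L2_norm_L2_conj] in blast)
  qed
  finally show ?thesis .
qed

text \<open>Along an approximating sequence in \<open>star_sum H\<close> the coanalytic part
  cancels, so the operator is represented by a sequence in H, which also approximates it in
  \<open>L2_dist\<close>.\<close>

lemma L2_conj_H2:
  assumes "u \<in> L2 M \<tau>"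
  shows "strong_sum u (strong_scale \<i> (L2_conj u)) \<in> H2 M \<tau> H"
proof -
  obtain U where U: "Cauchy2 U" "\<And>k. U k \<in> star_sum H" "u = Lop U"
    using L2_star_sum[OF assms] by metis
  define W where "W k = U k + \<i> *\<^sub>O cj (U k)" for k
  note cU = Cauchy2_conjugation[OF U(1,2)]
  have W: "Cauchy2 W"
    unfolding W_def by (rule Cauchy2_add[OF U(1) Cauchy2_scale[OF cU]])
  have WH: "W k \<in> H" for k
    unfolding W_def by (rule conjugation_H[OF U(2)])
  have eq: "strong_sum u (strong_scale \<i> (L2_conj u)) = Lop W"
    unfolding U(3) L2_conj_Lop[OF U(1,2)] strong_scale_Lop[OF cU] strong_sum_Lop[OF U(1) Cauchy2_scale[OF cU]] W_def ..
  have "\<exists>h\<in>H. L2_dist M \<tau> (Lop W) (graph_of h) < e" if "e > 0" for e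
    using L2_dist_graph_of[OF W that] WH by (metis order_refl)
  then show ?thesis
    unfolding eq H2_def using Lop_L2[OF W] by simp
qed

end

theorem theorem1:
  fixes M H :: "('h::complex_hilbert_space \<Rightarrow>\<^sub>L 'h) set"
    and \<tau> :: "('h \<Rightarrow>\<^sub>L 'h) \<Rightarrow> complex"
    and \<Phi> :: "('h \<Rightarrow>\<^sub>L 'h) \<Rightarrow> ('h \<Rightarrow>\<^sub>L 'h)"
  assumes "von_neumann_algebra M"
    and "faithful_normal_tracial_state M \<tau>"
    and "finite_maximal_subdiagonal M \<tau> \<Phi> H"
  shows "(\<exists>!T. extends_conjugation M \<tau> \<Phi> H T) \<and>
    (\<forall>T. extends_conjugation M \<tau> \<Phi> H T \<longrightarrow>
       L2_opnorm M \<tau> T \<le> 1 \<and>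
       (ker_expectation \<Phi> H \<noteq> {0} \<longrightarrow> L2_opnorm M \<tau> T = 1) \<and>
       (\<forall>u\<in>L2 M \<tau>. strong_sum u (strong_scale \<i> (T u)) \<in> H2 M \<tau> H))"
proof -
  interpret subdiagonal_algebra M \<tau> H \<Phi>
    using assms by unfold_locales
  show ?thesis
  proof (intro conjI allI impI)
    show "\<exists>!T. extends_conjugation M \<tau> \<Phi> H T"
      using extends_conjugation_L2_conj extends_conjugation_unique by blast
  next
    fix T assume "extends_conjugation M \<tau> \<Phi> H T"
    then have T: "T = L2_conj"
      by (rule extends_conjugation_unique)
    show "L2_opnorm M \<tau> T \<le> 1"
      unfolding T by (rule L2_opnorm_le)
    show "L2_opnorm M \<tau> T = 1" if "ker_expectation \<Phi> H \<noteq> {0}"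
      unfolding T using L2_opnorm_le L2_opnorm_ge[OF that] by (rule antisym)
    show "\<forall>u\<in>L2 M \<tau>. strong_sum u (strong_scale \<i> (T u)) \<in> H2 M \<tau> H"
      unfolding T using L2_conj_H2 by blast
  qed
qed

end
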